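(* Let $(c_1,B_1),\dots,(c_m,B_m)$ be a Brascamp-Lieb datum on $\mathbb{R}^n$, i.e. for $i\le m$, $c_i>0$ is a real number and $B_i\colon\mathbb{R}^n\to\mathbb{R}^{n_i}$ is a linear surjective map, and suppose $\sum_{i=1}^m c_i n_i=n$. Assume that there exists a symmetric positive definite $n\times n$ matrix $A$ satisfying \[ A^{-1}=\sum_{i=1}^m c_i B_i^*(B_iAB_i^* )^{-1}B_i . \] Then the reversed Brascamp-Lieb constant $C_r$ associated to this datum is \[ C_r=\Bigl(\frac{\det(A)}{\prod_{i=1}^m\det(B_iAB_i^* )^{c_i}}\Bigr)^{1/2}, \] and there is equality in \[ \prod_{i=1}^m\Bigl(\int_{\mathbb{R}^{n_i}}f_i\,\mathrm{d}x\Bigr)^{c_i}\le C_r\int_{\mathbb{R}^n}f\,\mathrm{d}x \] for the following Gaussian functions (which satisfy the constraint $\prod_{i=1}^m f_i(x_i)^{c_i}\le f(\sum_{i=1}^m c_iB_i^*x_i)$ for all $x_i\in\mathbb{R}^{n_i}$): \[ f_i(x)=\mathrm{e}^{-\langle B_iAB_i^*x,x\rangle/2}\ (x\in\mathbb{R}^{n_i},\ i\le m),\qquad f(x)=\mathrm{e}^{-\langle Ax,x\rangle/2}\ (x\in\mathbb{R}^n). \]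
   Context: The reversed Brascamp-Lieb constant associated to the datum $(c_1,B_1),\dots,(c_m,B_m)$ is the smallest constant $C_r$ such that for all non-negative measurable functions $f_i\colon\mathbb{R}^{n_i}\to\mathbb{R}$ ($i\le m$) and $f\colon\mathbb{R}^n\to\mathbb{R}$ satisfying \[ \prod_{i=1}^m f_i(x_i)^{c_i}\le f\Bigl(\sum_{i=1}^m c_iB_i^*x_i\Bigr)\quad\text{for every }(x_1,\dots,x_m)\in\mathbb{R}^{n_1}\times\dots\times\mathbb{R}^{n_m}, \] we have \[ \prod_{i=1}^m\Bigl(\int_{\mathbb{R}^{n_i}}f_i\,\mathrm{d}x\Bigr)^{c_i}\le C_r\int_{\mathbb{R}^n}f\,\mathrm{d}x . \] Here $B_i^*$ denotes the adjoint (transpose) of $B_i$, $\mathrm{d}x$ denotes Lebesgue measure, integrals of non-negative functions take values in $[0,+\infty]$, and $0\cdot\infty=0$. *)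

theory Defs
  imports
    "HOL-Analysis.Analysis"
    "Jordan_Normal_Form.Determinant"
    "Jordan_Normal_Form.Gauss_Jordan_Elimination"
begin

text \<open>\<open>vec\<close>, \<open>det\<close> and \<open>\<bullet>\<close> refer to vectors and matrices whose dimensions are values, not to
  their namesakes in HOL-Analysis.\<close>

hide_const (open) Finite_Cartesian_Product.vec Determinants.det
unbundle no inner_syntax

text \<open>Lebesgue measure on the space \<^term>\<open>carrier_vec k\<close> of real column vectors of length
  \<open>k\<close>: the product measure on coordinate functions, transported along the bijection
  \<^term>\<open>vec k\<close> and completed, so that measurability means Lebesgue measurability.
  For \<open>k = 0\<close> it is the unit point mass.\<close>

definition lebesgue_vec :: "nat \<Rightarrow> real vec measure" where
  "lebesgue_vec k = completion (embed_measure (\<Pi>\<^sub>M j\<in>{..<k}. lborel) (vec k))"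

text \<open>Powers of \<open>[0, \<infinity>]\<close>-valued quantities, used for positive exponents only;
  in particular \<open>0\<close> is sent to \<open>0\<close>.\<close>

definition ennreal_powr :: "ennreal \<Rightarrow> real \<Rightarrow> ennreal" where
  "ennreal_powr x c = (if x = \<infinity> then \<infinity> else ennreal (enn2real x powr c))"

text \<open>The library's inverse is an option; \<open>None\<close> occurs only for non-invertible matrices.\<close>

definition mat_inv :: "real mat \<Rightarrow> real mat" where
  "mat_inv A = the (mat_inverse A)"

text \<open>The matrix counterpart of \<^const>\<open>finsum_vec\<close>: the sum of \<open>k\<close>-by-\<open>l\<close> matrices.\<close>

definition finsum_mat :: "nat \<Rightarrow> nat \<Rightarrow> ('i \<Rightarrow> real mat) \<Rightarrow> 'i set \<Rightarrow> real mat" where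
  "finsum_mat k l = finprod (monoid_mat TYPE(real) k l)"

definition sym_pos_def :: "nat \<Rightarrow> real mat \<Rightarrow> bool" where
  "sym_pos_def n A \<longleftrightarrow> A \<in> carrier_mat n n \<and> A\<^sup>T = A \<and>
     (\<forall>x\<in>carrier_vec n. x \<noteq> 0\<^sub>v n \<longrightarrow> (A *\<^sub>v x) \<bullet> x > 0)"

text \<open>The index \<open>i\<close> ranges over \<open>i < m\<close>; the map from \<open>n\<close>-space to \<open>d i\<close>-space is
  identified with its matrix \<^term>\<open>B i\<close>, and its adjoint with the transpose.\<close>

definition BL_datum :: "nat \<Rightarrow> nat \<Rightarrow> (nat \<Rightarrow> nat) \<Rightarrow> (nat \<Rightarrow> real) \<Rightarrow> (nat \<Rightarrow> real mat) \<Rightarrow> bool" where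
  "BL_datum n m d c B \<longleftrightarrow> (\<forall>i<m. c i > 0 \<and> B i \<in> carrier_mat (d i) n \<and>
     (\<lambda>x. B i *\<^sub>v x) ` carrier_vec n = carrier_vec (d i))"

definition nonneg_measurable :: "nat \<Rightarrow> (real vec \<Rightarrow> real) \<Rightarrow> bool" where
  "nonneg_measurable k g \<longleftrightarrow>
     g \<in> borel_measurable (lebesgue_vec k) \<and> (\<forall>x\<in>carrier_vec k. 0 \<le> g x)"

definition rev_BL_constraint :: "nat \<Rightarrow> nat \<Rightarrow> (nat \<Rightarrow> nat) \<Rightarrow> (nat \<Rightarrow> real) \<Rightarrow> (nat \<Rightarrow> real mat) \<Rightarrow>
    (nat \<Rightarrow> real vec \<Rightarrow> real) \<Rightarrow> (real vec \<Rightarrow> real) \<Rightarrow> bool" where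
  "rev_BL_constraint n m d c B fs f \<longleftrightarrow>
     (\<forall>x. (\<forall>i<m. x i \<in> carrier_vec (d i)) \<longrightarrow>
        (\<Prod>i<m. fs i (x i) powr c i)
          \<le> f (finsum_vec TYPE(real) n (\<lambda>i. c i \<cdot>\<^sub>v ((B i)\<^sup>T *\<^sub>v x i)) {..<m}))"

definition rev_BL_lhs :: "nat \<Rightarrow> (nat \<Rightarrow> nat) \<Rightarrow> (nat \<Rightarrow> real) \<Rightarrow> (nat \<Rightarrow> real vec \<Rightarrow> real) \<Rightarrow> ennreal" where
  "rev_BL_lhs m d c fs =
     (\<Prod>i<m. ennreal_powr (\<integral>\<^sup>+x. ennreal (fs i x) \<partial>lebesgue_vec (d i)) (c i))"

definition rev_BL_inequality :: "nat \<Rightarrow> nat \<Rightarrow> (nat \<Rightarrow> nat) \<Rightarrow> (nat \<Rightarrow> real) \<Rightarrow> (nat \<Rightarrow> real mat) \<Rightarrow>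
    ennreal \<Rightarrow> bool" where
  "rev_BL_inequality n m d c B C \<longleftrightarrow>
     (\<forall>fs f. (\<forall>i<m. nonneg_measurable (d i) (fs i)) \<longrightarrow> nonneg_measurable n f \<longrightarrow>
        rev_BL_constraint n m d c B fs f \<longrightarrow>
        rev_BL_lhs m d c fs \<le> C * (\<integral>\<^sup>+x. ennreal (f x) \<partial>lebesgue_vec n))"

text \<open>\<open>C\<close> is the smallest constant, i.e. the attained minimum over all constants in
  \<open>[0, \<infinity>]\<close>; in \<^typ>\<open>ennreal\<close>, \<open>0 * \<infinity> = 0\<close>.\<close>

definition is_rev_BL_constant :: "nat \<Rightarrow> nat \<Rightarrow> (nat \<Rightarrow> nat) \<Rightarrow> (nat \<Rightarrow> real) \<Rightarrow> (nat \<Rightarrow> real mat) \<Rightarrow>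
    ennreal \<Rightarrow> bool" where
  "is_rev_BL_constant n m d c B C \<longleftrightarrow>
     rev_BL_inequality n m d c B C \<and> (\<forall>C'. rev_BL_inequality n m d c B C' \<longrightarrow> C \<le> C')"

definition gaussian :: "real mat \<Rightarrow> real vec \<Rightarrow> real" where
  "gaussian M x = exp (- ((M *\<^sub>v x) \<bullet> x) / 2)"

end

theory Submission
  imports Defs "HOL-Probability.Distributions"
begin

text \<open>
  Write \<open>S i = B i A (B i)\<^sup>T\<close> and factor \<open>A\<^sup>-\<^sup>1 = P P\<^sup>T\<close>.  In the coordinates given by \<open>P\<close> the hypothesis on
  \<open>A\<close> says that the orthogonal projections \<open>E i\<close> onto the ranges of \<open>P\<^sup>T A (B i)\<^sup>T\<close> satisfy
  \<open>\<Sum>i. c i E i = 1\<close> (locales \<open>projection_frame\<close> and \<open>gaussian_datum\<close>).  The function \<open>f i\<close>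
  becomes a function \<open>g i\<close> on \<open>n\<close>-space with \<open>g i (E i x) = g i x\<close>, and the constraint becomes
  \<open>\<Prod>i. g i (x i) powr c i \<le> f (\<Sum>i. c i E i x i)\<close>.  The map \<open>combine\<close>, which sends the family \<open>x\<close> to
  \<open>\<Sum>i. c i E i x i\<close>, is a contraction: \<open>combine x \<bullet> combine x \<le> \<Sum>i. c i (x i \<bullet> x i)\<close>
  (\<open>combine_contraction\<close>).

  The constraint is preserved if all functions evolve under the heat semigroup
  (\<open>constraint_heat_flow\<close>).  This is a discrete form of the variational argument for Gaussian
  expectations.  Over a short time \<open>h\<close>, translate the noise of the \<open>i\<close>-th function by
  \<open>u i = sqrt h \<nabla> ln g i\<close>.  By the Cameron-Martin formula the logarithm of its heat evolution is then, up
  to \<open>O (h\<^sup>2)\<close>, the expectation of its logarithm at the translated point plus a term of second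
  order.  Translate the noise of \<open>f\<close> by \<open>combine u\<close>; Jensen's inequality bounds the evolution of \<open>f\<close> from
  below with a cost that the contraction property controls (\<open>constraint_step\<close>).  Composing \<open>N\<close> steps of
  length \<open>T / N\<close> loses a factor \<open>exp (O (1 / N))\<close>, which disappears as \<open>N\<close> grows.

  The steps need functions whose logarithms are smooth.  For upper semicontinuous \<open>g i\<close> with bounded
  support modulo the kernel of \<open>E i\<close>, these are obtained by a Lipschitz regularisation from above,
  a short heat evolution and an additive constant.  The limit of the regularised constraints is
  controlled by compactness (\<open>constraint_limit\<close>, \<open>gaussian_inequality_usc\<close>).  The result is an inequality
  between Gaussian integrals at every time \<open>T\<close>.  As \<open>T\<close> tends to infinity the Gaussian weights become
  flat, and after division by the powers of \<open>T\<close>, which agree because \<open>\<Sum>i. c i d i = n\<close>, the inequality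
  between Lebesgue integrals appears (\<open>test_inequality\<close>).  The determinants come from the density of a
  Gaussian vector with covariance \<open>(S i)\<^sup>-\<^sup>1\<close> (\<open>gauss_law\<close>).  Measurable functions are exhausted from below
  by compactly supported upper semicontinuous ones (\<open>usc_test_approximation\<close>).

  For the centred Gaussians of the theorem the constraint is precisely the contraction property
  of \<open>combine\<close>.  Their integrals are explicit and give equality, and since \<open>\<integral>f\<close> is positive and finite
  for them, no smaller constant is possible.
\<close>

hide_const (open) Finite_Cartesian_Product.vec Determinants.det
unbundle no inner_syntax and no vec_syntax

section \<open>Lebesgue measure on coordinate vectors\<close>

definition lborel_vec :: "nat \<Rightarrow> real vec measure" where
  "lborel_vec k = embed_measure (\<Pi>\<^sub>M j\<in>{..<k}. lborel) (vec k)"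

lemma lebesgue_vec_eq_completion: "lebesgue_vec k = completion (lborel_vec k)"
  by (simp add: lebesgue_vec_def lborel_vec_def)

lemma inj_on_vec_extensional: "inj_on (vec k) (space (\<Pi>\<^sub>M j\<in>{..<k}. (lborel :: real measure)))"
proof (rule inj_onI)
  fix f g :: "nat \<Rightarrow> real"
  assume f: "f \<in> space (\<Pi>\<^sub>M j\<in>{..<k}. lborel)" and g: "g \<in> space (\<Pi>\<^sub>M j\<in>{..<k}. lborel)"
    and eq: "vec k f = vec k g"
  have "f j = g j" if "j < k" for j
    using arg_cong[OF eq, of "\<lambda>v. v $ j"] that by simp
  then show "f = g"
    using f g by (intro PiE_ext[of f "{..<k}" "\<lambda>_. UNIV" g]) (auto simp: space_PiM)
qed

lemma space_lborel_vec [simp]: "space (lborel_vec k) = carrier_vec k"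
proof -
  have "x \<in> vec k ` ({..<k} \<rightarrow>\<^sub>E UNIV)" if "x \<in> carrier_vec k" for x :: "real vec"
  proof
    show "x = vec k (\<lambda>j\<in>{..<k}. x $ j)" using that by auto
  qed auto
  then show ?thesis by (auto simp: lborel_vec_def space_embed_measure space_PiM)
qed

lemma measurable_vec [measurable]: "vec k \<in> (\<Pi>\<^sub>M j\<in>{..<k}. lborel) \<rightarrow>\<^sub>M lborel_vec k"
  unfolding lborel_vec_def by (rule measurable_embed_measure2'[OF inj_on_vec_extensional])

lemma measurable_lborel_vecI:
  assumes "\<And>x. x \<in> space M \<Longrightarrow> g x \<in> carrier_vec k"
    and "\<And>j. j < k \<Longrightarrow> (\<lambda>x. g x $ j) \<in> borel_measurable M"
  shows "g \<in> M \<rightarrow>\<^sub>M lborel_vec k"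
proof -
  have "(\<lambda>x. \<lambda>j\<in>{..<k}. g x $ j) \<in> M \<rightarrow>\<^sub>M (\<Pi>\<^sub>M j\<in>{..<k}. lborel)"
    using assms(2) by (intro measurable_restrict) auto
  then have "(\<lambda>x. vec k (\<lambda>j\<in>{..<k}. g x $ j)) \<in> M \<rightarrow>\<^sub>M lborel_vec k"
    by (rule measurable_compose[OF _ measurable_vec])
  moreover have "vec k (\<lambda>j\<in>{..<k}. g x $ j) = g x" if "x \<in> space M" for x
    using assms(1)[OF that] by auto
  ultimately show ?thesis by (simp cong: measurable_cong)
qed

lemma measurable_vec_index [measurable]:
  assumes "j < k" shows "(\<lambda>x. x $ j) \<in> borel_measurable (lborel_vec k)"
proof -
  have "(\<lambda>\<omega>. vec k \<omega> $ j) \<in> borel_measurable (\<Pi>\<^sub>M j\<in>{..<k}. (lborel :: real measure))"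
    using assms by simp
  then show ?thesis unfolding lborel_vec_def by (rule measurable_embed_measure1)
qed

lemma nn_integral_lborel_vec:
  assumes "F \<in> borel_measurable (lborel_vec k)"
  shows "(\<integral>\<^sup>+x. F x \<partial>lborel_vec k) = (\<integral>\<^sup>+\<omega>. F (vec k \<omega>) \<partial>(\<Pi>\<^sub>M j\<in>{..<k}. lborel))"
  using assms unfolding lborel_vec_def
  by (rule nn_integral_embed_measure'[OF inj_on_vec_extensional])

lemma product_sigma_finite_lborel: "product_sigma_finite (\<lambda>_::nat. lborel :: real measure)"
  by (simp add: product_sigma_finite_def lborel.sigma_finite_measure_axioms)

lemma sigma_finite_lborel_vec: "sigma_finite_measure (lborel_vec k)"
proof -
  let ?N = "\<Pi>\<^sub>M j\<in>{..<k}. (lborel :: real measure)"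
  interpret N: sigma_finite_measure ?N
    by (rule product_sigma_finite.sigma_finite[OF product_sigma_finite_lborel]) simp
  obtain A where A: "countable A" "A \<subseteq> sets ?N" "\<Union>A = space ?N" "\<forall>a\<in>A. emeasure ?N a \<noteq> \<infinity>"
    using N.sigma_finite_countable by auto
  show ?thesis
  proof
    show "\<exists>A. countable A \<and> A \<subseteq> sets (lborel_vec k) \<and> \<Union> A = space (lborel_vec k) \<and>
        (\<forall>a\<in>A. emeasure (lborel_vec k) a \<noteq> \<infinity>)"
    proof (intro exI[of _ "(`) (vec k) ` A"] conjI ballI)
      show "\<Union> ((`) (vec k) ` A) = space (lborel_vec k)"
        using A(3) by (auto simp: lborel_vec_def space_embed_measure simp del: space_lborel_vec)
      fix a assume "a \<in> (`) (vec k) ` A"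
      then show "emeasure (lborel_vec k) a \<noteq> \<infinity>"
        using A(2,4) emeasure_embed_measure_image'[OF inj_on_vec_extensional]
        by (auto simp: lborel_vec_def)
    qed (use A in \<open>auto simp: lborel_vec_def in_sets_embed_measure\<close>)
  qed
qed

text \<open>The only computation with coordinates: Fubini isolates one coordinate and the rest is the
  affine substitution on the line.  Translations, dilations and linear maps are composed of
  substitutions of this kind.\<close>

lemma nn_integral_change_coordinate:
  assumes F [measurable]: "F \<in> borel_measurable (lborel_vec k)" and i: "i < k" and a: "a \<noteq> 0"
    and b [measurable]: "b \<in> borel_measurable (lborel_vec k)"
    and indep: "\<And>x y. x \<in> carrier_vec k \<Longrightarrow> y \<in> carrier_vec k \<Longrightarrow>
      (\<And>j. j < k \<Longrightarrow> j \<noteq> i \<Longrightarrow> x $ j = y $ j) \<Longrightarrow> b x = b y"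
  shows "(\<integral>\<^sup>+x. F x \<partial>lborel_vec k) =
    ennreal \<bar>a\<bar> * (\<integral>\<^sup>+x. F (vec k (\<lambda>j. if j = i then a * x $ i + b x else x $ j)) \<partial>lborel_vec k)"
proof -
  let ?L = "\<lambda>_::nat. (lborel :: real measure)"
  define I where "I = {..<k} - {i}"
  have ins: "{..<k} = insert i I" and I: "finite I" "i \<notin> I" using i by (auto simp: I_def)
  interpret product_sigma_finite ?L by (rule product_sigma_finite_lborel)
  define T where "T = (\<lambda>x. vec k (\<lambda>j. if j = i then a * x $ i + b x else x $ j))"
  have T [measurable]: "T \<in> lborel_vec k \<rightarrow>\<^sub>M lborel_vec k"
  proof (rule measurable_lborel_vecI)
    fix j assume j: "j < k"
    note measurable_vec_index[OF j, measurable] measurable_vec_index[OF i, measurable]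
    have "(\<lambda>x. if j = i then a * x $ i + b x else x $ j) \<in> borel_measurable (lborel_vec k)"
      by measurable
    then show "(\<lambda>x. T x $ j) \<in> borel_measurable (lborel_vec k)"
      using j by (simp add: T_def)
  qed (simp add: T_def)
  have m1: "(\<lambda>\<omega>. F (vec k \<omega>)) \<in> borel_measurable (Pi\<^sub>M (insert i I) ?L)"
    and m2: "(\<lambda>\<omega>. F (T (vec k \<omega>))) \<in> borel_measurable (Pi\<^sub>M (insert i I) ?L)"
    unfolding ins[symmetric] by measurable
  have upd: "(\<lambda>y. x(i := y)) \<in> borel \<rightarrow>\<^sub>M Pi\<^sub>M (insert i I) ?L" if "x \<in> space (Pi\<^sub>M I ?L)" for x
  proof -
    have "(\<lambda>y. x(i := y)) \<in> ?L i \<rightarrow>\<^sub>M Pi\<^sub>M (insert i I) ?L"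
      using that by (rule measurable_component_update) (rule I)
    then show ?thesis by simp
  qed
  have "(\<integral>\<^sup>+x. F x \<partial>lborel_vec k) = (\<integral>\<^sup>+\<omega>. F (vec k \<omega>) \<partial>Pi\<^sub>M (insert i I) ?L)"
    by (simp add: nn_integral_lborel_vec ins)
  also have "\<dots> = (\<integral>\<^sup>+x. \<integral>\<^sup>+y. F (vec k (x(i := y))) \<partial>lborel \<partial>Pi\<^sub>M I ?L)"
    by (rule product_nn_integral_insert[OF I m1])
  also have "\<dots> = (\<integral>\<^sup>+x. ennreal \<bar>a\<bar> * (\<integral>\<^sup>+y. F (T (vec k (x(i := y)))) \<partial>lborel) \<partial>Pi\<^sub>M I ?L)"
  proof (rule nn_integral_cong)
    fix x assume x: "x \<in> space (Pi\<^sub>M I ?L)"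
    define \<beta> where "\<beta> = b (vec k (x(i := 0)))"
    have "(\<integral>\<^sup>+y. F (vec k (x(i := y))) \<partial>lborel) =
        ennreal \<bar>a\<bar> * (\<integral>\<^sup>+y. F (vec k (x(i := \<beta> + a * y))) \<partial>lborel)"
      using measurable_compose[OF upd[OF x] m1] a by (rule nn_integral_real_affine)
    also have "(\<lambda>y. vec k (x(i := \<beta> + a * y))) = (\<lambda>y. T (vec k (x(i := y))))"
    proof
      fix y
      have "b (vec k (x(i := y))) = \<beta>" unfolding \<beta>_def by (rule indep) auto
      then show "vec k (x(i := \<beta> + a * y)) = T (vec k (x(i := y)))"
        using i by (auto simp: T_def)
    qed
    finally show "(\<integral>\<^sup>+y. F (vec k (x(i := y))) \<partial>lborel) =
        ennreal \<bar>a\<bar> * (\<integral>\<^sup>+y. F (T (vec k (x(i := y)))) \<partial>lborel)" .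
  qed
  also have "\<dots> = ennreal \<bar>a\<bar> * (\<integral>\<^sup>+x. \<integral>\<^sup>+y. F (T (vec k (x(i := y)))) \<partial>lborel \<partial>Pi\<^sub>M I ?L)"
  proof (rule nn_integral_cmult)
    have *: "(\<lambda>(x, y). x(i := y)) \<in> Pi\<^sub>M I ?L \<Otimes>\<^sub>M lborel \<rightarrow>\<^sub>M Pi\<^sub>M (insert i I) ?L"
      using measurable_add_dim[of i I ?L] by simp
    show "(\<lambda>x. \<integral>\<^sup>+y. F (T (vec k (x(i := y)))) \<partial>lborel) \<in> borel_measurable (Pi\<^sub>M I ?L)"
      using measurable_compose[OF * m2]
      by (intro lborel.borel_measurable_nn_integral) (simp add: case_prod_unfold)
  qed
  also have "(\<integral>\<^sup>+x. \<integral>\<^sup>+y. F (T (vec k (x(i := y)))) \<partial>lborel \<partial>Pi\<^sub>M I ?L) =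
      (\<integral>\<^sup>+\<omega>. F (T (vec k \<omega>)) \<partial>Pi\<^sub>M (insert i I) ?L)"
    by (rule product_nn_integral_insert[OF I m2, symmetric])
  also have "\<dots> = (\<integral>\<^sup>+x. F (T x) \<partial>lborel_vec k)"
    by (simp add: nn_integral_lborel_vec ins)
  finally show ?thesis by (simp add: T_def)
qed

lemma nn_integral_lborel_vec_affine:
  assumes F [measurable]: "F \<in> borel_measurable (lborel_vec k)" and a: "a \<noteq> 0"
    and w: "w \<in> carrier_vec k"
  shows "(\<integral>\<^sup>+x. F x \<partial>lborel_vec k) = ennreal (\<bar>a\<bar> ^ k) * (\<integral>\<^sup>+x. F (a \<cdot>\<^sub>v x + w) \<partial>lborel_vec k)"
proof -
  define T where "T = (\<lambda>p x. vec k (\<lambda>j. if j < p then a * x $ j + w $ j else x $ j))"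
  have T [measurable]: "T p \<in> lborel_vec k \<rightarrow>\<^sub>M lborel_vec k" for p
  proof (rule measurable_lborel_vecI)
    fix j assume j: "j < k"
    note measurable_vec_index[OF j, measurable]
    have "(\<lambda>x. if j < p then a * x $ j + w $ j else x $ j) \<in> borel_measurable (lborel_vec k)"
      by measurable
    then show "(\<lambda>x. T p x $ j) \<in> borel_measurable (lborel_vec k)"
      using j by (simp add: T_def)
  qed (simp add: T_def)
  have steps: "(\<integral>\<^sup>+x. F x \<partial>lborel_vec k) = ennreal (\<bar>a\<bar> ^ p) * (\<integral>\<^sup>+x. F (T p x) \<partial>lborel_vec k)"
    if "p \<le> k" for p
    using that
  proof (induction p)
    case 0
    have "T 0 x = x" if "x \<in> carrier_vec k" for x using that by (auto simp: T_def)
    then show ?case by (simp cong: nn_integral_cong_simp)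
  next
    case (Suc p)
    have "(\<integral>\<^sup>+x. F (T p x) \<partial>lborel_vec k) = ennreal \<bar>a\<bar> * (\<integral>\<^sup>+x. F (T p (vec k
        (\<lambda>j. if j = p then a * x $ p + w $ p else x $ j))) \<partial>lborel_vec k)"
      using Suc.prems a
      by (intro nn_integral_change_coordinate[where F = "\<lambda>x. F (T p x)" and b = "\<lambda>_. w $ p"]) auto
    also have "(\<lambda>x. T p (vec k (\<lambda>j. if j = p then a * x $ p + w $ p else x $ j))) = T (Suc p)"
      using Suc.prems by (intro ext eq_vecI) (auto simp: T_def less_Suc_eq)
    finally show ?case using Suc by (simp add: ennreal_mult mult_ac)
  qed
  have "T k x = a \<cdot>\<^sub>v x + w" if "x \<in> carrier_vec k" for x
    using that w by (auto simp: T_def)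
  then show ?thesis using steps[of k] by (simp cong: nn_integral_cong_simp)
qed

lemma measurable_mult_mat_vec:
  assumes "M \<in> carrier_mat d k" shows "(\<lambda>x. M *\<^sub>v x) \<in> lborel_vec k \<rightarrow>\<^sub>M lborel_vec d"
proof (rule measurable_lborel_vecI)
  fix j assume j: "j < d"
  have "(\<lambda>x. \<Sum>l<k. M $$ (j, l) * x $ l) \<in> borel_measurable (lborel_vec k)"
    by (intro borel_measurable_sum borel_measurable_times measurable_vec_index) auto
  moreover have "(M *\<^sub>v x) $ j = (\<Sum>l<k. M $$ (j, l) * x $ l)" if "x \<in> carrier_vec k" for x
    using assms j that by (auto simp: scalar_prod_def atLeast0LessThan intro!: sum.cong)
  ultimately show "(\<lambda>x. (M *\<^sub>v x) $ j) \<in> borel_measurable (lborel_vec k)"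
    by (subst measurable_cong[where g = "\<lambda>x. \<Sum>l<k. M $$ (j, l) * x $ l"]) simp_all
qed (use assms in auto)

text \<open>The identity matrix with row \<open>i\<close> replaced by \<open>r\<close>; it changes one coordinate only, and
  every invertible matrix is a product of such matrices.\<close>

definition row_mat :: "nat \<Rightarrow> nat \<Rightarrow> (nat \<Rightarrow> real) \<Rightarrow> real mat" where
  "row_mat k i r = mat k k (\<lambda>(l, j). if l = i then r j else if l = j then 1 else 0)"

lemma row_mat_carrier [simp]: "row_mat k i r \<in> carrier_mat k k"
  by (simp add: row_mat_def)

lemma det_row_mat:
  assumes i: "i < k" shows "det (row_mat k i r) = r i"
proof -
  define s where "s = (\<lambda>p j. if j < p \<or> j = i then r j else 0)"
  have "det (row_mat k i (s p)) = r i" if "p \<le> k" for p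
    using that
  proof (induction p)
    case 0
    have "row_mat k i (s 0) = multrow_mat k i (r i)"
      by (intro eq_matI) (auto simp: row_mat_def s_def)
    then show ?case using i by (simp add: det_multrow_mat)
  next
    case (Suc p)
    show ?case
    proof (cases "p = i")
      case True
      then have "s (Suc p) = s p" by (auto simp: s_def less_Suc_eq)
      then show ?thesis using Suc by simp
    next
      case False
      have "row_mat k i (s (Suc p)) = addrow (r p) i p (row_mat k i (s p))"
        using False i Suc.prems by (intro eq_matI) (auto simp: row_mat_def s_def less_Suc_eq)
      then show ?thesis
        using det_addrow[of p k i "row_mat k i (s p)" "r p"] False Suc by simp
    qed
  qed
  from this[of k] have "det (row_mat k i (s k)) = r i" by simp
  moreover have "row_mat k i (s k) = row_mat k i r"
    by (intro eq_matI) (auto simp: row_mat_def s_def)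
  ultimately show ?thesis by simp
qed

lemma mult_row_mat_index:
  assumes M: "M \<in> carrier_mat k k" and l: "l < k" and p: "p < k" and i: "i < k"
  shows "(M * row_mat k i r) $$ (l, p) = (if p = i then 0 else M $$ (l, p)) + M $$ (l, i) * r p"
proof -
  have "(M * row_mat k i r) $$ (l, p) =
      (\<Sum>q<k. M $$ (l, q) * (if q = i then r p else if q = p then 1 else 0))"
    using assms by (auto simp: scalar_prod_def row_mat_def atLeast0LessThan intro!: sum.cong)
  also have "\<dots> = (\<Sum>q<k. (if q = i then M $$ (l, q) * r p else 0) +
      (if q = p then (if p = i then 0 else M $$ (l, q)) else 0))"
    by (intro sum.cong) auto
  also have "\<dots> = (if p = i then 0 else M $$ (l, p)) + M $$ (l, i) * r p"
    using i p by (simp add: sum.distrib sum.delta)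
  finally show ?thesis .
qed

definition has_change_of_variables :: "nat \<Rightarrow> real mat \<Rightarrow> bool" where
  "has_change_of_variables k M \<longleftrightarrow> (\<forall>F \<in> borel_measurable (lborel_vec k).
     (\<integral>\<^sup>+x. F x \<partial>lborel_vec k) = ennreal \<bar>det M\<bar> * (\<integral>\<^sup>+x. F (M *\<^sub>v x) \<partial>lborel_vec k))"

lemma has_change_of_variables_mult:
  assumes M: "M \<in> carrier_mat k k" and N: "N \<in> carrier_mat k k"
    and hM: "has_change_of_variables k M" and hN: "has_change_of_variables k N"
  shows "has_change_of_variables k (M * N)"
  unfolding has_change_of_variables_def
proof
  fix F :: "real vec \<Rightarrow> ennreal" assume F [measurable]: "F \<in> borel_measurable (lborel_vec k)"
  note measurable_mult_mat_vec[OF M, measurable] measurable_mult_mat_vec[OF N, measurable]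
  have "(\<integral>\<^sup>+x. F x \<partial>lborel_vec k) = ennreal \<bar>det M\<bar> * (\<integral>\<^sup>+x. F (M *\<^sub>v x) \<partial>lborel_vec k)"
    using hM F unfolding has_change_of_variables_def by (rule bspec)
  also have "(\<integral>\<^sup>+x. F (M *\<^sub>v x) \<partial>lborel_vec k) =
      ennreal \<bar>det N\<bar> * (\<integral>\<^sup>+x. F (M *\<^sub>v (N *\<^sub>v x)) \<partial>lborel_vec k)"
    by (rule bspec[OF hN[unfolded has_change_of_variables_def]]) measurable
  also have "(\<integral>\<^sup>+x. F (M *\<^sub>v (N *\<^sub>v x)) \<partial>lborel_vec k) = (\<integral>\<^sup>+x. F ((M * N) *\<^sub>v x) \<partial>lborel_vec k)"
    using M N by (intro nn_integral_cong) simp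
  finally show "(\<integral>\<^sup>+x. F x \<partial>lborel_vec k) =
      ennreal \<bar>det (M * N)\<bar> * (\<integral>\<^sup>+x. F ((M * N) *\<^sub>v x) \<partial>lborel_vec k)"
    by (simp add: det_mult[OF M N] abs_mult ennreal_mult mult.assoc)
qed

text \<open>Only coordinate \<open>i\<close> changes, and for fixed other coordinates it changes affinely with slope \<open>r i\<close>,
  the determinant.\<close>

lemma has_change_of_variables_row_mat:
  assumes i: "i < k" and r: "r i \<noteq> 0"
  shows "has_change_of_variables k (row_mat k i r)"
  unfolding has_change_of_variables_def
proof
  fix F :: "real vec \<Rightarrow> ennreal" assume F: "F \<in> borel_measurable (lborel_vec k)"
  define b where "b = (\<lambda>x :: real vec. \<Sum>j\<in>{..<k} - {i}. r j * x $ j)"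
  have b: "b \<in> borel_measurable (lborel_vec k)"
    unfolding b_def by (intro borel_measurable_sum borel_measurable_times measurable_vec_index) auto
  have "(\<integral>\<^sup>+x. F x \<partial>lborel_vec k) = ennreal \<bar>r i\<bar> *
      (\<integral>\<^sup>+x. F (vec k (\<lambda>j. if j = i then r i * x $ i + b x else x $ j)) \<partial>lborel_vec k)"
    using F i r b by (rule nn_integral_change_coordinate) (auto simp: b_def intro!: sum.cong)
  also have "(\<integral>\<^sup>+x. F (vec k (\<lambda>j. if j = i then r i * x $ i + b x else x $ j)) \<partial>lborel_vec k) =
      (\<integral>\<^sup>+x. F (row_mat k i r *\<^sub>v x) \<partial>lborel_vec k)"
  proof (rule nn_integral_cong)
    fix x assume "x \<in> space (lborel_vec k)"
    then have x: "x \<in> carrier_vec k" by simp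
    have "(row_mat k i r *\<^sub>v x) $ l = (if l = i then r i * x $ i + b x else x $ l)" if l: "l < k" for l
    proof -
      have "(row_mat k i r *\<^sub>v x) $ l =
          (\<Sum>j<k. (if l = i then r j else if l = j then 1 else 0) * x $ j)"
        using x l by (auto simp: row_mat_def scalar_prod_def atLeast0LessThan intro!: sum.cong)
      also have "\<dots> = (if l = i then r i * x $ i + b x else x $ l)"
      proof (cases "l = i")
        case True
        then show ?thesis using i sum.remove[of "{..<k}" i "\<lambda>j. r j * x $ j"] by (simp add: b_def)
      next
        case False
        have "(\<Sum>j<k. (if l = j then 1 else 0) * x $ j) = (\<Sum>j<k. if j = l then x $ j else 0)"
          by (intro sum.cong) auto
        then show ?thesis using False l by simp
      qed
      finally show ?thesis .
    qed
    then have "vec k (\<lambda>j. if j = i then r i * x $ i + b x else x $ j) = row_mat k i r *\<^sub>v x"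
      by (intro eq_vecI) (auto simp: row_mat_def)
    then show "F (vec k (\<lambda>j. if j = i then r i * x $ i + b x else x $ j)) = F (row_mat k i r *\<^sub>v x)"
      by simp
  qed
  finally show "(\<integral>\<^sup>+x. F x \<partial>lborel_vec k) =
      ennreal \<bar>det (row_mat k i r)\<bar> * (\<integral>\<^sup>+x. F (row_mat k i r *\<^sub>v x) \<partial>lborel_vec k)"
    using i by (simp add: det_row_mat)
qed

text \<open>Gaussian elimination by rows, inducting on the number of rows that are not yet rows of the identity:
  a nonzero pivot allows one to split off a factor \<open>row_mat\<close> on the right.  A zero pivot is first made
  nonzero by adding to its column another one in which the entry of the pivot row is nonzero.\<close>

lemma has_change_of_variables_invertible:
  assumes "M \<in> carrier_mat k k" and "det M \<noteq> 0"
  shows "has_change_of_variables k M"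
  using assms
proof (induction "card {l. l < k \<and> row M l \<noteq> unit_vec k l}" arbitrary: M rule: less_induct)
  case less
  define D where "D = (\<lambda>M :: real mat. {l. l < k \<and> row M l \<noteq> unit_vec k l})"
  have finD: "finite (D M)" for M by (simp add: D_def)
  have notD: "N $$ (l, j) = (if j = l then 1 else 0)"
    if "N \<in> carrier_mat k k" "l < k" "l \<notin> D N" "j < k" for N l j
  proof -
    have "row N l $ j = unit_vec k l $ j" using that by (simp add: D_def)
    then show ?thesis using that by simp
  qed
  have inD: "l \<notin> D N"
    if "N \<in> carrier_mat k k" "l < k" "\<And>j. j < k \<Longrightarrow> N $$ (l, j) = (if j = l then 1 else 0)" for N l
  proof -
    have "row N l = unit_vec k l" using that by (intro eq_vecI) auto
    then show ?thesis by (simp add: D_def)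
  qed
  have pivot: "has_change_of_variables k N"
    if N: "N \<in> carrier_mat k k" "det N \<noteq> 0" and card: "card (D N) \<le> card (D M)"
      and i: "i \<in> D N" and Nii: "N $$ (i, i) \<noteq> 0" for N i
  proof -
    have ik: "i < k" using i by (simp add: D_def)
    define R where "R = row_mat k i (\<lambda>j. N $$ (i, j))"
    define R' where "R' = row_mat k i (\<lambda>j. if j = i then 1 / N $$ (i, i) else - N $$ (i, j) / N $$ (i, i))"
    have RR: "R' * R = 1\<^sub>m k"
    proof (rule eq_matI)
      fix l j assume "l < dim_row (1\<^sub>m k :: real mat)" "j < dim_col (1\<^sub>m k :: real mat)"
      then have lj: "l < k" "j < k" by auto
      show "(R' * R) $$ (l, j) = 1\<^sub>m k $$ (l, j)"
        unfolding R_def using lj ik Nii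
        by (subst mult_row_mat_index[where k = k]) (auto simp: R'_def row_mat_def)
    qed (auto simp: R_def R'_def row_mat_def)
    define L where "L = N * R'"
    have L: "L \<in> carrier_mat k k" using N by (auto simp: L_def R'_def)
    have NL: "N = L * R"
      using N RR assoc_mult_mat[of N k k R' k R k] by (simp add: L_def R_def R'_def)
    have Lent: "L $$ (l, p) = (if p = i then 0 else N $$ (l, p)) +
        N $$ (l, i) * (if p = i then 1 / N $$ (i, i) else - N $$ (i, p) / N $$ (i, i))"
      if "l < k" "p < k" for l p
      unfolding L_def R'_def using N(1) that ik by (rule mult_row_mat_index)
    have "i \<notin> D L" using Nii ik by (intro inD L) (auto simp: Lent)
    moreover have "l \<notin> D L" if "l < k" "l \<notin> D N" for l
      using that ik i by (intro inD L) (auto simp: Lent notD[OF N(1) that])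
    ultimately have "D L \<subseteq> D N - {i}" by (auto simp: D_def)
    then have "card (D L) < card (D N)"
      using i finD[of N] by (intro psubset_card_mono) auto
    moreover have "det N = det L * det R"
      unfolding NL by (rule det_mult[OF L]) (simp add: R_def)
    then have "det L \<noteq> 0" using N(2) by auto
    ultimately have "has_change_of_variables k L"
      using L card less.hyps[of L] by (simp add: D_def)
    moreover have "has_change_of_variables k R"
      unfolding R_def using ik Nii by (rule has_change_of_variables_row_mat)
    ultimately show ?thesis
      unfolding NL using L by (intro has_change_of_variables_mult) (auto simp: R_def)
  qed
  show ?case
  proof (cases "D M = {}")
    case True
    then have "M = 1\<^sub>m k" using notD[OF less.prems(1)] less.prems(1) by (intro eq_matI) auto
    moreover have "(\<integral>\<^sup>+x. F (1\<^sub>m k *\<^sub>v x) \<partial>lborel_vec k) = (\<integral>\<^sup>+x. F x \<partial>lborel_vec k)"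
      for F :: "real vec \<Rightarrow> ennreal"
      by (intro nn_integral_cong) simp
    ultimately show ?thesis by (simp add: has_change_of_variables_def)
  next
    case False
    then obtain i where i: "i \<in> D M" by blast
    then have ik: "i < k" by (simp add: D_def)
    have M: "M \<in> carrier_mat k k" by (rule less.prems)
    show ?thesis
    proof (cases "M $$ (i, i) = 0")
      case False
      with less.prems i show ?thesis by (intro pivot[of M i]) simp_all
    next
      case Mii: True
      have "\<exists>j\<in>D M. M $$ (i, j) \<noteq> 0"
      proof (rule ccontr)
        assume "\<not> (\<exists>j\<in>D M. M $$ (i, j) \<noteq> 0)"
        then have M0: "M $$ (i, j) = 0" if "j \<in> D M" for j using that by blast
        \<comment> \<open>row \<open>i\<close> would be a combination of rows of the identity that are also rows of \<open>M\<close>\<close>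
        define w where "w = vec k (\<lambda>l. if l = i then 1 else - M $$ (i, l))"
        have "M\<^sup>T *\<^sub>v w = 0\<^sub>v k"
        proof (rule eq_vecI)
          fix j assume "j < dim_vec (0\<^sub>v k :: real vec)"
          then have jk: "j < k" by simp
          have "(M\<^sup>T *\<^sub>v w) $ j = (\<Sum>l<k. M $$ (l, j) * (if l = i then 1 else - M $$ (i, l)))"
            using jk M by (auto simp: w_def scalar_prod_def atLeast0LessThan intro!: sum.cong)
          also have "\<dots> = (\<Sum>l<k. (if l = i then M $$ (i, j) else 0) + (if l = j then - M $$ (i, j) else 0))"
          proof (rule sum.cong[OF refl])
            fix l assume "l \<in> {..<k}"
            then show "M $$ (l, j) * (if l = i then 1 else - M $$ (i, l)) =
                (if l = i then M $$ (i, j) else 0) + (if l = j then - M $$ (i, j) else 0)"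
              using M0[of l] M0[OF i] notD[OF M, of l j] jk
              by (cases "l \<in> D M"; cases "l = i"; cases "l = j") simp_all
          qed
          also have "\<dots> = 0" using ik jk by (simp add: sum.distrib)
          finally show "(M\<^sup>T *\<^sub>v w) $ j = 0\<^sub>v k $ j" using jk by simp
        qed (use M in auto)
        moreover have "w \<noteq> 0\<^sub>v k"
        proof
          assume "w = 0\<^sub>v k"
          then have "w $ i = 0" using ik by simp
          then show False using ik by (simp add: w_def)
        qed
        moreover have "w \<in> carrier_vec k" by (simp add: w_def)
        ultimately have "det (M\<^sup>T) = 0"
          using M det_0_iff_vec_prod_zero_field[of "M\<^sup>T" k] by auto
        then show False using less.prems det_transpose[OF M] by simp
      qed
      then obtain j where j: "j \<in> D M" "M $$ (i, j) \<noteq> 0" by blast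
      then have jk: "j < k" and ji: "j \<noteq> i" using Mii by (auto simp: D_def)
      define R where "R = row_mat k j (\<lambda>p. if p = i \<or> p = j then 1 else 0)"
      define R' where "R' = row_mat k j (\<lambda>p. if p = j then 1 else if p = i then -1 else 0)"
      define N where "N = M * R"
      have N: "N \<in> carrier_mat k k" using M by (simp add: N_def R_def)
      have RR: "R * R' = 1\<^sub>m k"
      proof (rule eq_matI)
        fix l p assume "l < dim_row (1\<^sub>m k :: real mat)" "p < dim_col (1\<^sub>m k :: real mat)"
        then have lp: "l < k" "p < k" by auto
        show "(R * R') $$ (l, p) = 1\<^sub>m k $$ (l, p)"
          unfolding R'_def using lp jk ji
          by (subst mult_row_mat_index[where k = k]) (auto simp: R_def row_mat_def)
      qed (auto simp: R_def R'_def row_mat_def)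
      have MN: "M = N * R'"
        using M RR assoc_mult_mat[of M k k R k R' k] by (simp add: N_def R_def R'_def)
      have Nent: "N $$ (l, p) = (if p = j then 0 else M $$ (l, p)) +
          M $$ (l, j) * (if p = i \<or> p = j then 1 else 0)" if "l < k" "p < k" for l p
        unfolding N_def R_def using M that jk by (rule mult_row_mat_index)
      have "l \<notin> D N" if "l < k" "l \<notin> D M" for l
        using that j by (intro inD N) (auto simp: Nent notD[OF M that] jk)
      then have DN: "D N \<subseteq> D M" by (auto simp: D_def)
      have "det M = det N * det R'"
        unfolding MN by (rule det_mult[OF N]) (simp add: R'_def)
      then have detN: "det N \<noteq> 0" using less.prems(2) by auto
      have "has_change_of_variables k N"
      proof (cases "i \<in> D N")
        case True
        have "N $$ (i, i) \<noteq> 0" using ik jk ji Mii j(2) by (simp add: Nent)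
        with True N detN card_mono[OF finD DN] show ?thesis by (intro pivot[of N i])
      next
        case False
        then have "card (D N) < card (D M)"
          using DN i finD[of M] by (intro psubset_card_mono) auto
        then show ?thesis using N detN less.hyps[of N] by (simp add: D_def)
      qed
      moreover have "has_change_of_variables k R'"
        unfolding R'_def using jk by (intro has_change_of_variables_row_mat) auto
      ultimately show ?thesis
        unfolding MN using N by (intro has_change_of_variables_mult) (auto simp: R'_def)
    qed
  qed
qed

lemma nn_integral_lborel_vec_linear:
  assumes "F \<in> borel_measurable (lborel_vec k)" and "M \<in> carrier_mat k k" and "det M \<noteq> 0"
  shows "(\<integral>\<^sup>+x. F x \<partial>lborel_vec k) = ennreal \<bar>det M\<bar> * (\<integral>\<^sup>+x. F (M *\<^sub>v x) \<partial>lborel_vec k)"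
  using has_change_of_variables_invertible[OF assms(2,3)] assms(1)
  unfolding has_change_of_variables_def by (rule bspec)

section \<open>The standard Gaussian measure\<close>

lemma scalar_prod_real:
  fixes x y :: "real vec"
  assumes "y \<in> carrier_vec n" shows "x \<bullet> y = (\<Sum>j<n. x $ j * y $ j)"
  using assms by (simp add: scalar_prod_def atLeast0LessThan)

lemma scalar_prod_self_nonneg: "0 \<le> x \<bullet> (x :: real vec)"
  by (simp add: scalar_prod_def sum_nonneg)

lemma scalar_prod_self_eq_0:
  fixes x :: "real vec"
  assumes "x \<in> carrier_vec n" and "x \<bullet> x = 0" shows "x = 0\<^sub>v n"
proof -
  have "x $ j * x $ j = 0" if "j < n" for j
    using assms that sum_nonneg_eq_0_iff[of "{..<n}" "\<lambda>j. x $ j * x $ j"]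
    by (simp add: scalar_prod_real)
  then show ?thesis using assms by (intro eq_vecI) auto
qed

lemma scalar_prod_Cauchy_Schwarz:
  fixes x y :: "real vec"
  assumes "x \<in> carrier_vec n" "y \<in> carrier_vec n"
  shows "(x \<bullet> y)\<^sup>2 \<le> (x \<bullet> x) * (y \<bullet> y)"
  using assms Cauchy_Schwarz_ineq_sum[of "\<lambda>j. x $ j" "\<lambda>j. y $ j" "{..<n}"]
  by (simp add: scalar_prod_real power2_eq_square)

definition vnorm :: "real vec \<Rightarrow> real" where
  "vnorm x = sqrt (x \<bullet> x)"

lemma vnorm_nonneg [simp]: "0 \<le> vnorm x"
  by (simp add: vnorm_def scalar_prod_self_nonneg)

lemma vnorm_sq: "(vnorm x)\<^sup>2 = x \<bullet> x"
  by (simp add: vnorm_def scalar_prod_self_nonneg)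

lemma vnorm_smult: "vnorm (a \<cdot>\<^sub>v x) = \<bar>a\<bar> * vnorm x"
  by (simp add: vnorm_def real_sqrt_mult flip: mult.assoc)

lemma vnorm_triangle:
  assumes "x \<in> carrier_vec n" "y \<in> carrier_vec n" shows "vnorm (x + y) \<le> vnorm x + vnorm y"
proof -
  have *: "vnorm z = L2_set (\<lambda>j. z $ j) {..<n}" if "z \<in> carrier_vec n" for z
    using that by (simp add: vnorm_def L2_set_def scalar_prod_real power2_eq_square)
  have "L2_set (\<lambda>j. (x + y) $ j) {..<n} = L2_set (\<lambda>j. x $ j + y $ j) {..<n}"
    using assms by (intro L2_set_cong) auto
  then show ?thesis
    using assms L2_set_triangle_ineq[of "\<lambda>j. x $ j" "\<lambda>j. y $ j" "{..<n}"] by (simp add: *)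
qed

lemma abs_scalar_prod_le_vnorm:
  assumes "x \<in> carrier_vec n" "y \<in> carrier_vec n" shows "\<bar>x \<bullet> y\<bar> \<le> vnorm x * vnorm y"
  using real_sqrt_le_mono[OF scalar_prod_Cauchy_Schwarz[OF assms]]
  by (simp add: vnorm_def real_sqrt_mult)

lemma measurable_add_vec [measurable]:
  assumes f: "f \<in> M \<rightarrow>\<^sub>M lborel_vec n" and g: "g \<in> M \<rightarrow>\<^sub>M lborel_vec n"
  shows "(\<lambda>x. f x + g x) \<in> M \<rightarrow>\<^sub>M lborel_vec n"
proof (rule measurable_lborel_vecI)
  have c: "f x \<in> carrier_vec n" and c': "g x \<in> carrier_vec n" if "x \<in> space M" for x
    using measurable_space[OF f that] measurable_space[OF g that] by auto
  then show "f x + g x \<in> carrier_vec n" if "x \<in> space M" for x using that by auto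
  fix j assume j: "j < n"
  have "(\<lambda>x. f x $ j + g x $ j) \<in> borel_measurable M"
    using j f g by (intro borel_measurable_add measurable_compose[OF _ measurable_vec_index])
  then show "(\<lambda>x. (f x + g x) $ j) \<in> borel_measurable M"
    by (rule measurable_cong[THEN iffD1, rotated]) (use carrier_vecD[OF c] carrier_vecD[OF c'] j in auto)
qed

lemma measurable_smult_vec [measurable]:
  assumes a: "a \<in> borel_measurable M" and f: "f \<in> M \<rightarrow>\<^sub>M lborel_vec n"
  shows "(\<lambda>x. a x \<cdot>\<^sub>v f x) \<in> M \<rightarrow>\<^sub>M lborel_vec n"
proof (rule measurable_lborel_vecI)
  have c: "f x \<in> carrier_vec n" if "x \<in> space M" for x
    using measurable_space[OF f that] by auto
  then show "a x \<cdot>\<^sub>v f x \<in> carrier_vec n" if "x \<in> space M" for x using that by auto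
  fix j assume j: "j < n"
  have "(\<lambda>x. a x * f x $ j) \<in> borel_measurable M"
    using j a f by (intro borel_measurable_times measurable_compose[OF _ measurable_vec_index])
  then show "(\<lambda>x. (a x \<cdot>\<^sub>v f x) $ j) \<in> borel_measurable M"
    by (rule measurable_cong[THEN iffD1, rotated]) (use carrier_vecD[OF c] j in auto)
qed

lemma measurable_scalar_prod [measurable]:
  assumes f: "f \<in> M \<rightarrow>\<^sub>M lborel_vec n" and g: "g \<in> M \<rightarrow>\<^sub>M lborel_vec n"
  shows "(\<lambda>x. f x \<bullet> g x) \<in> borel_measurable M"
proof -
  have "(\<lambda>x. \<Sum>j<n. f x $ j * g x $ j) \<in> borel_measurable M"
    using f g by (intro borel_measurable_sum borel_measurable_times
        measurable_compose[OF _ measurable_vec_index]) auto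
  then show ?thesis
    by (rule measurable_cong[THEN iffD1, rotated])
      (use measurable_space[OF g] in \<open>auto simp: scalar_prod_real[where n = n]\<close>)
qed

definition gauss_density :: "nat \<Rightarrow> real vec \<Rightarrow> real" where
  "gauss_density n x = exp (- (x \<bullet> x) / 2) / sqrt (2 * pi) ^ n"

definition std_gauss :: "nat \<Rightarrow> real vec measure" where
  "std_gauss n = density (lborel_vec n) (\<lambda>x. ennreal (gauss_density n x))"

lemma gauss_density_pos: "0 < gauss_density n x"
  by (simp add: gauss_density_def)

lemma measurable_gauss_density [measurable]: "gauss_density n \<in> borel_measurable (lborel_vec n)"
  unfolding gauss_density_def by measurable

lemma sets_std_gauss [simp, measurable_cong]: "sets (std_gauss n) = sets (lborel_vec n)"
  by (simp add: std_gauss_def)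

lemma space_std_gauss [simp]: "space (std_gauss n) = carrier_vec n"
  by (simp add: std_gauss_def)

lemma nn_integral_std_gauss:
  assumes "F \<in> borel_measurable (lborel_vec n)"
  shows "(\<integral>\<^sup>+x. F x \<partial>std_gauss n) = (\<integral>\<^sup>+x. ennreal (gauss_density n x) * F x \<partial>lborel_vec n)"
  unfolding std_gauss_def using assms by (intro nn_integral_density) auto

lemma gauss_density_vec:
  "gauss_density n (vec n \<omega>) = (\<Prod>j<n. std_normal_density (\<omega> j))"
proof -
  have "(\<Prod>j<n. std_normal_density (\<omega> j)) = (\<Prod>j<n. 1 / sqrt (2 * pi)) * exp (\<Sum>j<n. - (\<omega> j)\<^sup>2 / 2)"
    by (simp add: normal_density_def prod_dividef exp_sum power_one_over)
  also have "(\<Sum>j<n. - (\<omega> j)\<^sup>2 / 2) = - (vec n \<omega> \<bullet> vec n \<omega>) / 2"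
    by (simp add: scalar_prod_real[where n = n] power2_eq_square sum_negf flip: sum_divide_distrib)
  finally show ?thesis by (simp add: gauss_density_def power_one_over field_simps)
qed

lemma measurable_take_coordinates:
  assumes "d \<le> n" shows "(\<lambda>x. vec d (\<lambda>j. x $ j)) \<in> lborel_vec n \<rightarrow>\<^sub>M lborel_vec d"
  using assms by (intro measurable_lborel_vecI) auto

lemma nn_integral_std_gauss_take:
  assumes F: "F \<in> borel_measurable (lborel_vec d)" and "d \<le> n"
  shows "(\<integral>\<^sup>+x. F (vec d (\<lambda>j. x $ j)) \<partial>std_gauss n) = (\<integral>\<^sup>+x. F x \<partial>std_gauss d)"
  using \<open>d \<le> n\<close>
proof (induction n rule: dec_induct)
  case base
  have "vec d (\<lambda>j. x $ j) = x" if "x \<in> carrier_vec d" for x :: "real vec" using that by auto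
  then show ?case by (intro nn_integral_cong) simp
next
  case (step n)
  let ?L = "\<lambda>_::nat. (lborel :: real measure)"
  interpret product_sigma_finite ?L by (rule product_sigma_finite_lborel)
  define G where "G = (\<lambda>k x. ennreal (gauss_density k x) * F (vec d (\<lambda>j. x $ j)))"
  have G [measurable]: "G k \<in> borel_measurable (lborel_vec k)" if "d \<le> k" for k
    unfolding G_def using measurable_compose[OF measurable_take_coordinates[OF that] F] by measurable
  have ins: "{..<Suc n} = insert n {..<n}" by auto
  have split: "G (Suc n) (vec (Suc n) (x(n := y))) = G n (vec n x) * ennreal (std_normal_density y)" for x y
  proof -
    have "(\<Prod>j<Suc n. std_normal_density ((x(n := y)) j)) =
        (\<Prod>j<n. std_normal_density (x j)) * std_normal_density y"
      by (simp add: ins prod.insert)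
    then have "gauss_density (Suc n) (vec (Suc n) (x(n := y))) = gauss_density n (vec n x) * std_normal_density y"
      by (simp only: gauss_density_vec)
    moreover have "vec d (\<lambda>j. vec (Suc n) (x(n := y)) $ j) = vec d (\<lambda>j. vec n x $ j)"
      using step.hyps by (intro eq_vecI) auto
    ultimately show ?thesis
      by (simp add: G_def ennreal_mult gauss_density_pos less_imp_le mult_ac)
  qed
  have std: "(\<integral>\<^sup>+y. ennreal (std_normal_density y) \<partial>lborel) = 1"
    using prob_space.emeasure_space_1[OF prob_space_normal_density[of 1 0]]
    by (simp add: emeasure_density cong: nn_integral_cong_simp)
  have "(\<integral>\<^sup>+x. F (vec d (\<lambda>j. x $ j)) \<partial>std_gauss (Suc n)) = (\<integral>\<^sup>+x. G (Suc n) x \<partial>lborel_vec (Suc n))"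
    unfolding G_def using step.hyps
    by (intro nn_integral_std_gauss measurable_compose[OF measurable_take_coordinates F]) auto
  also have "\<dots> = (\<integral>\<^sup>+\<omega>. G (Suc n) (vec (Suc n) \<omega>) \<partial>Pi\<^sub>M (insert n {..<n}) ?L)"
    using step.hyps by (subst nn_integral_lborel_vec) (auto simp: ins)
  also have "\<dots> = (\<integral>\<^sup>+x. \<integral>\<^sup>+y. G (Suc n) (vec (Suc n) (x(n := y))) \<partial>lborel \<partial>Pi\<^sub>M {..<n} ?L)"
  proof (rule product_nn_integral_insert)
    have "(\<lambda>\<omega>. G (Suc n) (vec (Suc n) \<omega>)) \<in> borel_measurable (Pi\<^sub>M {..<Suc n} ?L)"
      using step.hyps by (intro measurable_compose[OF measurable_vec G]) auto
    then show "(\<lambda>\<omega>. G (Suc n) (vec (Suc n) \<omega>)) \<in> borel_measurable (Pi\<^sub>M (insert n {..<n}) ?L)"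
      by (simp only: ins)
  qed auto
  also have "\<dots> = (\<integral>\<^sup>+x. G n (vec n x) \<partial>Pi\<^sub>M {..<n} ?L)"
    by (simp add: split nn_integral_cmult std)
  also have "\<dots> = (\<integral>\<^sup>+x. G n x \<partial>lborel_vec n)"
    using step.hyps by (subst nn_integral_lborel_vec) auto
  also have "\<dots> = (\<integral>\<^sup>+x. F (vec d (\<lambda>j. x $ j)) \<partial>std_gauss n)"
    unfolding G_def using step.hyps
    by (intro nn_integral_std_gauss[symmetric] measurable_compose[OF measurable_take_coordinates F]) auto
  finally show ?case using step.IH by simp
qed

lemma prob_space_std_gauss: "prob_space (std_gauss n)"
proof
  have "(\<integral>\<^sup>+x. 1 \<partial>std_gauss n) = (\<integral>\<^sup>+x. 1 \<partial>std_gauss 0)"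
    using nn_integral_std_gauss_take[of "\<lambda>_. 1" 0 n] by simp
  also have "\<dots> = (\<integral>\<^sup>+x. ennreal (gauss_density 0 x) * 1 \<partial>lborel_vec 0)"
    by (rule nn_integral_std_gauss) simp
  also have "\<dots> = (\<integral>\<^sup>+\<omega>. 1 \<partial>(\<Pi>\<^sub>M j\<in>({} :: nat set). (lborel :: real measure)))"
    by (subst nn_integral_lborel_vec) (auto simp: gauss_density_vec)
  also have "\<dots> = 1" by (simp add: PiM_empty)
  finally show "emeasure (std_gauss n) (space (std_gauss n)) = 1" by simp
qed

text \<open>Cameron-Martin: translating the Gaussian measure by \<open>w\<close> multiplies it by an explicit
  exponential weight.  Every estimate of the heat flow below is an estimate of this weight.\<close>

lemma gauss_density_add:
  assumes "x \<in> carrier_vec n" "w \<in> carrier_vec n"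
  shows "gauss_density n (x + w) = gauss_density n x * exp (- (w \<bullet> x) - (w \<bullet> w) / 2)"
proof -
  have "(x + w) \<bullet> (x + w) = x \<bullet> x + 2 * (w \<bullet> x) + w \<bullet> w"
    using assms by (simp add: scalar_prod_real[where n = n] sum.distrib[symmetric] sum_distrib_left
        algebra_simps)
  then show ?thesis by (simp add: gauss_density_def mult_exp_exp[symmetric] field_simps flip: exp_add)
qed

lemma nn_integral_std_gauss_translate:
  assumes F [measurable]: "F \<in> borel_measurable (lborel_vec n)" and w: "w \<in> carrier_vec n"
  shows "(\<integral>\<^sup>+x. F x \<partial>std_gauss n) =
    (\<integral>\<^sup>+x. ennreal (exp (- (w \<bullet> x) - (w \<bullet> w) / 2)) * F (x + w) \<partial>std_gauss n)"
proof -
  have [measurable]: "(\<lambda>x. w) \<in> M \<rightarrow>\<^sub>M lborel_vec n" for M :: "real vec measure" using w by simp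
  have "(\<integral>\<^sup>+x. F x \<partial>std_gauss n) = (\<integral>\<^sup>+x. ennreal (gauss_density n x) * F x \<partial>lborel_vec n)"
    by (rule nn_integral_std_gauss) fact
  also have "\<dots> = (\<integral>\<^sup>+x. ennreal (gauss_density n (1 \<cdot>\<^sub>v x + w)) * F (1 \<cdot>\<^sub>v x + w) \<partial>lborel_vec n)"
    using w by (subst nn_integral_lborel_vec_affine[where a = 1 and w = w]) simp_all
  also have "\<dots> = (\<integral>\<^sup>+x. ennreal (gauss_density n x) *
      (ennreal (exp (- (w \<bullet> x) - (w \<bullet> w) / 2)) * F (x + w)) \<partial>lborel_vec n)"
    using w by (intro nn_integral_cong)
      (simp add: gauss_density_add ennreal_mult gauss_density_pos less_imp_le mult.assoc)
  also have "\<dots> = (\<integral>\<^sup>+x. ennreal (exp (- (w \<bullet> x) - (w \<bullet> w) / 2)) * F (x + w) \<partial>std_gauss n)"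
    by (rule nn_integral_std_gauss[symmetric]) measurable
  finally show ?thesis .
qed

text \<open>A finite exponential moment, which dominates all polynomial moments at once.\<close>

lemma nn_integral_exp_quarter:
  "(\<integral>\<^sup>+x. ennreal (exp ((x \<bullet> x) / 4)) \<partial>std_gauss n) = ennreal (sqrt 2 ^ n)"
proof -
  have m: "(\<lambda>x. ennreal (gauss_density n x) * ennreal (exp ((x \<bullet> x) / 4))) \<in> borel_measurable (lborel_vec n)"
    by measurable
  have "(\<integral>\<^sup>+x. ennreal (exp ((x \<bullet> x) / 4)) \<partial>std_gauss n) =
      (\<integral>\<^sup>+x. ennreal (gauss_density n x) * ennreal (exp ((x \<bullet> x) / 4)) \<partial>lborel_vec n)"
    by (rule nn_integral_std_gauss) measurable
  also have "\<dots> = ennreal (\<bar>sqrt 2\<bar> ^ n) * (\<integral>\<^sup>+x. ennreal (gauss_density n (sqrt 2 \<cdot>\<^sub>v x + 0\<^sub>v n)) *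
      ennreal (exp (((sqrt 2 \<cdot>\<^sub>v x + 0\<^sub>v n) \<bullet> (sqrt 2 \<cdot>\<^sub>v x + 0\<^sub>v n)) / 4)) \<partial>lborel_vec n)"
    by (rule nn_integral_lborel_vec_affine[OF m]) simp_all
  also have "(\<integral>\<^sup>+x. ennreal (gauss_density n (sqrt 2 \<cdot>\<^sub>v x + 0\<^sub>v n)) *
      ennreal (exp (((sqrt 2 \<cdot>\<^sub>v x + 0\<^sub>v n) \<bullet> (sqrt 2 \<cdot>\<^sub>v x + 0\<^sub>v n)) / 4)) \<partial>lborel_vec n) =
      (\<integral>\<^sup>+x. ennreal (gauss_density n x) * 1 \<partial>lborel_vec n)"
  proof (rule nn_integral_cong)
    fix x assume "x \<in> space (lborel_vec n)"
    then have x: "x \<in> carrier_vec n" by simp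
    define y where "y = sqrt 2 \<cdot>\<^sub>v x + 0\<^sub>v n"
    have y: "y = sqrt 2 \<cdot>\<^sub>v x" using x by (auto simp: y_def)
    have yy: "y \<bullet> y = 2 * (x \<bullet> x)" using x by (simp add: y flip: mult.assoc)
    have "exp (- (y \<bullet> y) / 2) * exp ((y \<bullet> y) / 4) = exp (- (x \<bullet> x) / 2)"
      unfolding yy by (simp flip: exp_add)
    then show "ennreal (gauss_density n (sqrt 2 \<cdot>\<^sub>v x + 0\<^sub>v n)) *
        ennreal (exp (((sqrt 2 \<cdot>\<^sub>v x + 0\<^sub>v n) \<bullet> (sqrt 2 \<cdot>\<^sub>v x + 0\<^sub>v n)) / 4)) = ennreal (gauss_density n x) * 1"
      unfolding y_def[symmetric] by (simp add: gauss_density_def flip: ennreal_mult)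
  qed
  also have "\<dots> = (\<integral>\<^sup>+x. 1 \<partial>std_gauss n)"
    by (rule nn_integral_std_gauss[symmetric]) simp
  also have "\<dots> = 1"
    using prob_space.emeasure_space_1[OF prob_space_std_gauss, of n] by simp
  finally show ?thesis by simp
qed

definition gauss_fourth_moment :: "nat \<Rightarrow> real" where
  "gauss_fourth_moment n = (\<integral>x. (x \<bullet> x)\<^sup>2 \<partial>std_gauss n)"

lemma integrable_fourth_moment: "integrable (std_gauss n) (\<lambda>x. (x \<bullet> x)\<^sup>2)"
proof (rule integrableI_bounded)
  have "ennreal (norm ((x \<bullet> x)\<^sup>2)) \<le> ennreal 32 * ennreal (exp ((x \<bullet> x) / 4))" for x :: "real vec"
  proof -
    have "1 + (x \<bullet> x) / 4 + ((x \<bullet> x) / 4)\<^sup>2 / 2 \<le> exp ((x \<bullet> x) / 4)"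
      by (rule exp_lower_Taylor_quadratic) (simp add: scalar_prod_self_nonneg)
    then have "(x \<bullet> x)\<^sup>2 \<le> 32 * exp ((x \<bullet> x) / 4)"
      using scalar_prod_self_nonneg[of x] by (simp add: power2_eq_square)
    then have "ennreal (norm ((x \<bullet> x)\<^sup>2)) \<le> ennreal (32 * exp ((x \<bullet> x) / 4))"
      by (intro ennreal_leI) simp
    then show ?thesis by (subst (asm) ennreal_mult) simp_all
  qed
  then have "(\<integral>\<^sup>+x. ennreal (norm ((x \<bullet> x)\<^sup>2)) \<partial>std_gauss n) \<le>
      (\<integral>\<^sup>+x. ennreal 32 * ennreal (exp ((x \<bullet> x) / 4)) \<partial>std_gauss n)"
    by (intro nn_integral_mono)
  also have "\<dots> = ennreal 32 * ennreal (sqrt 2 ^ n)"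
    by (subst nn_integral_cmult) (auto simp: nn_integral_exp_quarter)
  finally show "(\<integral>\<^sup>+x. ennreal (norm ((x \<bullet> x)\<^sup>2)) \<partial>std_gauss n) < \<infinity>"
    by (simp add: order_le_less_trans ennreal_mult_less_top)
qed measurable

lemma nn_integral_gauss_density: "(\<integral>\<^sup>+x. ennreal (gauss_density n x) \<partial>lborel_vec n) = 1"
  using prob_space.emeasure_space_1[OF prob_space_std_gauss, of n]
    nn_integral_std_gauss[of "\<lambda>_. 1" n] by simp

definition heat :: "nat \<Rightarrow> real \<Rightarrow> (real vec \<Rightarrow> ennreal) \<Rightarrow> real vec \<Rightarrow> ennreal" where
  "heat n t F x = (\<integral>\<^sup>+\<xi>. F (x + sqrt t \<cdot>\<^sub>v \<xi>) \<partial>std_gauss n)"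

lemma sigma_finite_std_gauss: "sigma_finite_measure (std_gauss n)"
  using prob_space_std_gauss by (simp add: prob_space_def finite_measure_def)

lemma measurable_heat [measurable]:
  assumes F [measurable]: "F \<in> borel_measurable (lborel_vec n)"
  shows "heat n t F \<in> borel_measurable (lborel_vec n)"
proof -
  interpret sigma_finite_measure "std_gauss n" by (rule sigma_finite_std_gauss)
  show ?thesis unfolding heat_def by measurable
qed

lemma measurable_compose_affine:
  assumes x: "x \<in> carrier_vec n" and F: "F \<in> borel_measurable (lborel_vec n)"
  shows "(\<lambda>\<xi>. F (x + a \<cdot>\<^sub>v \<xi>)) \<in> borel_measurable (lborel_vec n)"
proof (rule measurable_compose[OF _ F])
  show "(\<lambda>\<xi>. x + a \<cdot>\<^sub>v \<xi>) \<in> lborel_vec n \<rightarrow>\<^sub>M lborel_vec n"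
    using x by (intro measurable_add_vec measurable_smult_vec) auto
qed

lemma gauss_density_rotate:
  assumes y: "y \<in> carrier_vec n" and z: "z \<in> carrier_vec n" and a: "0 < a" "a\<^sup>2 = 1 + b\<^sup>2"
  shows "gauss_density n ((1 / a) \<cdot>\<^sub>v y + (b / a) \<cdot>\<^sub>v z) *
      gauss_density n (a \<cdot>\<^sub>v z + (- b) \<cdot>\<^sub>v ((1 / a) \<cdot>\<^sub>v y + (b / a) \<cdot>\<^sub>v z)) = gauss_density n y * gauss_density n z"
proof -
  define p where "p = (1 / a) \<cdot>\<^sub>v y + (b / a) \<cdot>\<^sub>v z"
  define q where "q = a \<cdot>\<^sub>v z + (- b) \<cdot>\<^sub>v p"
  have c: "p \<in> carrier_vec n" "q \<in> carrier_vec n" using y z by (auto simp: p_def q_def)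
  have "p $ j * p $ j + q $ j * q $ j = y $ j * y $ j + z $ j * z $ j" if j: "j < n" for j
  proof -
    have p: "p $ j = (y $ j + b * z $ j) / a" using y z j by (simp add: p_def add_divide_distrib)
    have q0: "q $ j = a * z $ j - b * p $ j" using c y z j by (simp add: q_def)
    have "a * q $ j = a\<^sup>2 * z $ j - b * (a * p $ j)" by (simp add: q0 power2_eq_square algebra_simps)
    also have ap: "a * p $ j = y $ j + b * z $ j" using a by (simp add: p)
    finally have "a * q $ j = (1 + b\<^sup>2) * z $ j - b * (y $ j + b * z $ j)" by (simp only: a(2))
    then have "a * q $ j = z $ j - b * y $ j" by (simp add: power2_eq_square algebra_simps)
    then have aq: "z $ j - b * y $ j = a * q $ j" by simp
    have "a\<^sup>2 * (p $ j * p $ j + q $ j * q $ j) = (y $ j + b * z $ j)\<^sup>2 + (z $ j - b * y $ j)\<^sup>2"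
      unfolding aq ap[symmetric] by (simp add: power2_eq_square algebra_simps)
    also have "\<dots> = (1 + b\<^sup>2) * (y $ j * y $ j + z $ j * z $ j)"
      by (simp add: power2_eq_square algebra_simps)
    finally show ?thesis using a(1) by (simp flip: a(2))
  qed
  then have "p \<bullet> p + q \<bullet> q = y \<bullet> y + z \<bullet> z"
    using c y z by (simp add: scalar_prod_real[where n = n] flip: sum.distrib)
  then have "- (p \<bullet> p) / 2 + - (q \<bullet> q) / 2 = - (y \<bullet> y) / 2 + - (z \<bullet> z) / 2" by argo
  then have "exp (- (p \<bullet> p) / 2) * exp (- (q \<bullet> q) / 2) = exp (- (y \<bullet> y) / 2) * exp (- (z \<bullet> z) / 2)"
    by (simp only: mult_exp_exp)
  then show ?thesis unfolding p_def[symmetric] q_def[symmetric] by (simp add: gauss_density_def)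
qed

text \<open>The semigroup property: a rotation of the pair of Gaussian variables turns
  \<open>sqrt s \<xi> + sqrt t \<zeta>\<close> into \<open>sqrt (s + t) \<zeta>'\<close> with an independent second variable, which is
  integrated out.  The rotation is carried out as two affine substitutions, in \<open>\<zeta>\<close> for fixed \<open>\<xi>\<close>
  and then in \<open>\<xi>\<close>.\<close>

lemma heat_heat:
  assumes F [measurable]: "F \<in> borel_measurable (lborel_vec n)" and x: "x \<in> carrier_vec n"
    and s: "0 < s" and t: "0 < t"
  shows "heat n s (heat n t F) x = heat n (s + t) F x"
proof -
  let ?g = "gauss_density n"
  define b where "b = sqrt (s / t)"
  define a where "a = sqrt ((s + t) / t)"
  have a: "0 < a" "a\<^sup>2 = 1 + b\<^sup>2" using s t by (auto simp: a_def b_def field_simps)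
  have ta: "sqrt t * a = sqrt (s + t)" and tb: "sqrt t * b = sqrt s"
    using s t by (auto simp: a_def b_def simp flip: real_sqrt_mult)
  interpret P: pair_sigma_finite "lborel_vec n" "lborel_vec n"
    by (simp add: pair_sigma_finite_def sigma_finite_lborel_vec)
  define K where "K = (\<lambda>z \<xi>. ennreal (a ^ n) * (ennreal (?g \<xi>) * ennreal (?g (a \<cdot>\<^sub>v z + (- b) \<cdot>\<^sub>v \<xi>))))"
  define \<Phi> where "\<Phi> = (\<lambda>z. F (x + sqrt (s + t) \<cdot>\<^sub>v z))"
  have \<Phi> [measurable]: "\<Phi> \<in> borel_measurable (lborel_vec n)"
    unfolding \<Phi>_def using x F by (rule measurable_compose_affine)
  have inner: "(\<integral>\<^sup>+\<zeta>. F ((x + sqrt s \<cdot>\<^sub>v \<xi>) + sqrt t \<cdot>\<^sub>v \<zeta>) \<partial>std_gauss n) =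
      ennreal (a ^ n) * (\<integral>\<^sup>+z. ennreal (?g (a \<cdot>\<^sub>v z + (- b) \<cdot>\<^sub>v \<xi>)) * \<Phi> z \<partial>lborel_vec n)"
    if \<xi>: "\<xi> \<in> carrier_vec n" for \<xi>
  proof -
    have [measurable]: "(\<lambda>\<zeta>. F ((x + sqrt s \<cdot>\<^sub>v \<xi>) + sqrt t \<cdot>\<^sub>v \<zeta>)) \<in> borel_measurable (lborel_vec n)"
      using x \<xi> F by (intro measurable_compose_affine) auto
    have m: "(\<lambda>\<zeta>. ennreal (?g \<zeta>) * F ((x + sqrt s \<cdot>\<^sub>v \<xi>) + sqrt t \<cdot>\<^sub>v \<zeta>)) \<in> borel_measurable (lborel_vec n)"
      by measurable
    have arg: "(x + sqrt s \<cdot>\<^sub>v \<xi>) + sqrt t \<cdot>\<^sub>v (a \<cdot>\<^sub>v z + (- b) \<cdot>\<^sub>v \<xi>) = x + sqrt (s + t) \<cdot>\<^sub>v z"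
      if z: "z \<in> carrier_vec n" for z
    proof (rule eq_vecI)
      fix j assume "j < dim_vec (x + sqrt (s + t) \<cdot>\<^sub>v z)"
      then have j: "j < n" using z by simp
      have "x $ j + sqrt s * \<xi> $ j + sqrt t * (a * z $ j + (- b) * \<xi> $ j) =
          x $ j + sqrt s * \<xi> $ j + ((sqrt t * a) * z $ j - (sqrt t * b) * \<xi> $ j)"
        by (simp add: algebra_simps)
      then show "((x + sqrt s \<cdot>\<^sub>v \<xi>) + sqrt t \<cdot>\<^sub>v (a \<cdot>\<^sub>v z + (- b) \<cdot>\<^sub>v \<xi>)) $ j = (x + sqrt (s + t) \<cdot>\<^sub>v z) $ j"
        using j x \<xi> z by (simp add: ta tb)
    qed (use x \<xi> z in auto)
    have "(\<integral>\<^sup>+\<zeta>. F ((x + sqrt s \<cdot>\<^sub>v \<xi>) + sqrt t \<cdot>\<^sub>v \<zeta>) \<partial>std_gauss n) =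
        (\<integral>\<^sup>+\<zeta>. ennreal (?g \<zeta>) * F ((x + sqrt s \<cdot>\<^sub>v \<xi>) + sqrt t \<cdot>\<^sub>v \<zeta>) \<partial>lborel_vec n)"
      by (rule nn_integral_std_gauss) fact
    also have "\<dots> = ennreal (\<bar>a\<bar> ^ n) * (\<integral>\<^sup>+z. ennreal (?g (a \<cdot>\<^sub>v z + (- b) \<cdot>\<^sub>v \<xi>)) *
        F ((x + sqrt s \<cdot>\<^sub>v \<xi>) + sqrt t \<cdot>\<^sub>v (a \<cdot>\<^sub>v z + (- b) \<cdot>\<^sub>v \<xi>)) \<partial>lborel_vec n)"
      using a \<xi> by (intro nn_integral_lborel_vec_affine[OF m]) auto
    also have "(\<integral>\<^sup>+z. ennreal (?g (a \<cdot>\<^sub>v z + (- b) \<cdot>\<^sub>v \<xi>)) *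
        F ((x + sqrt s \<cdot>\<^sub>v \<xi>) + sqrt t \<cdot>\<^sub>v (a \<cdot>\<^sub>v z + (- b) \<cdot>\<^sub>v \<xi>)) \<partial>lborel_vec n) =
        (\<integral>\<^sup>+z. ennreal (?g (a \<cdot>\<^sub>v z + (- b) \<cdot>\<^sub>v \<xi>)) * \<Phi> z \<partial>lborel_vec n)"
      by (rule nn_integral_cong) (simp add: arg \<Phi>_def)
    finally show ?thesis using a by simp
  qed
  have outer: "(\<integral>\<^sup>+\<xi>. K z \<xi> \<partial>lborel_vec n) = ennreal (?g z)" if z: "z \<in> carrier_vec n" for z
  proof -
    have [measurable]: "(\<lambda>y. z) \<in> lborel_vec n \<rightarrow>\<^sub>M lborel_vec n" using z by simp
    have m: "K z \<in> borel_measurable (lborel_vec n)" unfolding K_def by measurable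
    have "(\<integral>\<^sup>+\<xi>. K z \<xi> \<partial>lborel_vec n) = ennreal (\<bar>1 / a\<bar> ^ n) *
        (\<integral>\<^sup>+y. K z ((1 / a) \<cdot>\<^sub>v y + (b / a) \<cdot>\<^sub>v z) \<partial>lborel_vec n)"
      using a z by (intro nn_integral_lborel_vec_affine[OF m]) auto
    also have "(\<integral>\<^sup>+y. K z ((1 / a) \<cdot>\<^sub>v y + (b / a) \<cdot>\<^sub>v z) \<partial>lborel_vec n) =
        (\<integral>\<^sup>+y. ennreal (a ^ n * ?g z) * ennreal (?g y) \<partial>lborel_vec n)"
    proof (rule nn_integral_cong)
      fix y assume "y \<in> space (lborel_vec n)"
      then have "y \<in> carrier_vec n" by simp
      from gauss_density_rotate[OF this z a]
      show "K z ((1 / a) \<cdot>\<^sub>v y + (b / a) \<cdot>\<^sub>v z) = ennreal (a ^ n * ?g z) * ennreal (?g y)"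
        using a by (simp add: K_def gauss_density_pos less_imp_le mult_ac flip: ennreal_mult)
    qed
    also have "\<dots> = ennreal (a ^ n * ?g z)"
      by (simp add: nn_integral_cmult nn_integral_gauss_density)
    also have "ennreal (\<bar>1 / a\<bar> ^ n) * ennreal (a ^ n * ?g z) = ennreal (?g z)"
      using a by (simp add: gauss_density_pos less_imp_le power_divide flip: ennreal_mult)
    finally show ?thesis .
  qed
  have "heat n s (heat n t F) x = (\<integral>\<^sup>+\<xi>. ennreal (?g \<xi>) * heat n t F (x + sqrt s \<cdot>\<^sub>v \<xi>) \<partial>lborel_vec n)"
    unfolding heat_def[of n s] using x F
    by (intro nn_integral_std_gauss measurable_compose_affine measurable_heat)
  also have "\<dots> = (\<integral>\<^sup>+\<xi>. \<integral>\<^sup>+z. K z \<xi> * \<Phi> z \<partial>lborel_vec n \<partial>lborel_vec n)"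
  proof (rule nn_integral_cong)
    fix \<xi> assume "\<xi> \<in> space (lborel_vec n)"
    then have \<xi>: "\<xi> \<in> carrier_vec n" by simp
    have [measurable]: "(\<lambda>y. \<xi>) \<in> lborel_vec n \<rightarrow>\<^sub>M lborel_vec n" using \<xi> by simp
    have "ennreal (?g \<xi>) * heat n t F (x + sqrt s \<cdot>\<^sub>v \<xi>) = ennreal (?g \<xi>) * ennreal (a ^ n) *
        (\<integral>\<^sup>+z. ennreal (?g (a \<cdot>\<^sub>v z + (- b) \<cdot>\<^sub>v \<xi>)) * \<Phi> z \<partial>lborel_vec n)"
      unfolding heat_def inner[OF \<xi>] by (simp add: mult.assoc)
    also have "\<dots> = (\<integral>\<^sup>+z. ennreal (?g \<xi>) * ennreal (a ^ n) *
        (ennreal (?g (a \<cdot>\<^sub>v z + (- b) \<cdot>\<^sub>v \<xi>)) * \<Phi> z) \<partial>lborel_vec n)"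
      by (rule nn_integral_cmult[symmetric]) measurable
    finally show "ennreal (?g \<xi>) * heat n t F (x + sqrt s \<cdot>\<^sub>v \<xi>) = (\<integral>\<^sup>+z. K z \<xi> * \<Phi> z \<partial>lborel_vec n)"
      by (simp add: K_def mult_ac)
  qed
  also have "\<dots> = (\<integral>\<^sup>+z. \<integral>\<^sup>+\<xi>. K z \<xi> * \<Phi> z \<partial>lborel_vec n \<partial>lborel_vec n)"
    unfolding K_def by (rule P.Fubini') measurable
  also have "\<dots> = (\<integral>\<^sup>+z. ennreal (?g z) * \<Phi> z \<partial>lborel_vec n)"
  proof (rule nn_integral_cong)
    fix z assume "z \<in> space (lborel_vec n)"
    then have z: "z \<in> carrier_vec n" by simp
    have [measurable]: "(\<lambda>y. z) \<in> lborel_vec n \<rightarrow>\<^sub>M lborel_vec n" using z by simp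
    have "K z \<in> borel_measurable (lborel_vec n)" unfolding K_def by measurable
    then show "(\<integral>\<^sup>+\<xi>. K z \<xi> * \<Phi> z \<partial>lborel_vec n) = ennreal (?g z) * \<Phi> z"
      by (simp add: nn_integral_multc outer[OF z])
  qed
  also have "\<dots> = heat n (s + t) F x"
    unfolding heat_def using nn_integral_std_gauss[OF \<Phi>] by (simp add: \<Phi>_def)
  finally show ?thesis .
qed

section \<open>Tilting and moments of the Gaussian measure\<close>

lemma finite_measure_std_gauss: "finite_measure (std_gauss n)"
  using prob_space_std_gauss by (simp add: prob_space_def)

lemma measure_std_gauss_space [simp]: "measure (std_gauss n) (carrier_vec n) = 1"
  using prob_space.prob_space[OF prob_space_std_gauss, of n] by simp

lemma measurable_std_gauss_iff [simp]:
  "borel_measurable (std_gauss n) = borel_measurable (lborel_vec n)"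
  by (rule measurable_cong_sets) simp_all

lemma integrable_std_gauss_bounded:
  assumes "f \<in> borel_measurable (lborel_vec n)" and "\<And>x. x \<in> carrier_vec n \<Longrightarrow> \<bar>f x\<bar> \<le> B"
  shows "integrable (std_gauss n) (f :: real vec \<Rightarrow> real)"
  using assms by (intro finite_measure.integrable_const_bound[OF finite_measure_std_gauss, where B = B])
    (auto intro!: AE_I2)

lemma integrable_std_gauss_const [simp]: "integrable (std_gauss n) (\<lambda>_. B :: real)"
  by (rule finite_measure.integrable_const[OF finite_measure_std_gauss])

lemma integrable_std_gauss_dominated:
  assumes "integrable (std_gauss n) g" and "f \<in> borel_measurable (lborel_vec n)"
    and "\<And>x. x \<in> carrier_vec n \<Longrightarrow> \<bar>f x\<bar> \<le> g x"
  shows "integrable (std_gauss n) (f :: real vec \<Rightarrow> real)"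
proof (rule Bochner_Integration.integrable_bound[OF assms(1)])
  show "AE x in std_gauss n. norm (f x) \<le> norm (g x)"
  proof (rule AE_I2)
    fix x assume "x \<in> space (std_gauss n)"
    then have "\<bar>f x\<bar> \<le> g x" by (simp add: assms(3))
    then show "norm (f x) \<le> norm (g x)" by simp
  qed
qed (use assms(2) in simp)

lemma integral_std_gauss_mono:
  assumes "integrable (std_gauss n) f" "integrable (std_gauss n) g"
    and "\<And>x. x \<in> carrier_vec n \<Longrightarrow> f x \<le> (g x :: real)"
  shows "(\<integral>x. f x \<partial>std_gauss n) \<le> (\<integral>x. g x \<partial>std_gauss n)"
  using assms by (intro integral_mono) auto

lemma measurable_scalar_prod_const:
  assumes "w \<in> carrier_vec n" shows "(\<lambda>x. w \<bullet> x) \<in> borel_measurable (lborel_vec n)"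
  using assms by (intro measurable_scalar_prod[where n = n]) auto

lemma measurable_compose_translate:
  assumes w: "w \<in> carrier_vec n" and F: "F \<in> borel_measurable (lborel_vec n)"
  shows "(\<lambda>x. F (x + w)) \<in> borel_measurable (lborel_vec n)"
  using w by (intro measurable_compose[OF _ F] measurable_add_vec) auto

lemma gauss_translate:
  assumes F: "integrable (std_gauss n) F" and w: "w \<in> carrier_vec n"
    and nonneg: "\<And>x. x \<in> carrier_vec n \<Longrightarrow> 0 \<le> F x"
  shows "has_bochner_integral (std_gauss n)
    (\<lambda>x. exp (- (w \<bullet> x) - (w \<bullet> w) / 2) * F (x + w)) (\<integral>x. F x \<partial>std_gauss n)"
proof (rule has_bochner_integral_nn_integral)
  have Fm: "F \<in> borel_measurable (lborel_vec n)"
    using borel_measurable_integrable[OF F] by simp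
  have wm: "(\<lambda>x. w \<bullet> x) \<in> borel_measurable (lborel_vec n)"
    using w by (rule measurable_scalar_prod_const)
  show "(\<lambda>x. exp (- (w \<bullet> x) - (w \<bullet> w) / 2) * F (x + w)) \<in> borel_measurable (std_gauss n)"
    using measurable_compose_translate[OF w Fm] wm by simp
  show "0 \<le> (\<integral>x. F x \<partial>std_gauss n)" using nonneg by (intro integral_nonneg_AE) (auto intro!: AE_I2)
  have "(\<integral>\<^sup>+x. ennreal (exp (- (w \<bullet> x) - (w \<bullet> w) / 2) * F (x + w)) \<partial>std_gauss n) =
      (\<integral>\<^sup>+x. ennreal (exp (- (w \<bullet> x) - (w \<bullet> w) / 2)) * ennreal (F (x + w)) \<partial>std_gauss n)"
    by (intro nn_integral_cong) (simp add: ennreal_mult')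
  also have "\<dots> = (\<integral>\<^sup>+x. ennreal (F x) \<partial>std_gauss n)"
    using Fm w by (intro nn_integral_std_gauss_translate[symmetric]) auto
  also have "\<dots> = ennreal (\<integral>x. F x \<partial>std_gauss n)"
    using F nonneg by (intro nn_integral_eq_integral) (auto intro!: AE_I2)
  finally show "(\<integral>\<^sup>+x. ennreal (exp (- (w \<bullet> x) - (w \<bullet> w) / 2) * F (x + w)) \<partial>std_gauss n) =
      ennreal (\<integral>x. F x \<partial>std_gauss n)" .
qed (use w nonneg in \<open>auto intro!: AE_I2\<close>)

text \<open>The Bochner form of the Cameron-Martin formula: tilting by an exponential weight is translation.\<close>

lemma gauss_tilt:
  assumes F: "integrable (std_gauss n) (\<lambda>x. F (x + w))" and w: "w \<in> carrier_vec n"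
    and nonneg: "\<And>x. x \<in> carrier_vec n \<Longrightarrow> 0 \<le> F x"
  shows "has_bochner_integral (std_gauss n)
    (\<lambda>x. exp (w \<bullet> x - (w \<bullet> w) / 2) * F x) (\<integral>x. F (x + w) \<partial>std_gauss n)"
proof -
  \<comment> \<open>the translation by \<open>- w\<close>\<close>
  define w' where "w' = (-1) \<cdot>\<^sub>v w"
  have w': "w' \<in> carrier_vec n" using w by (simp add: w'_def)
  have *: "has_bochner_integral (std_gauss n)
      (\<lambda>x. exp (- (w' \<bullet> x) - (w' \<bullet> w') / 2) * F ((x + w') + w)) (\<integral>x. F (x + w) \<partial>std_gauss n)"
    using F w' by (rule gauss_translate[where F = "\<lambda>x. F (x + w)"]) (use w nonneg in auto)
  have eq: "exp (- (w' \<bullet> x) - (w' \<bullet> w') / 2) * F ((x + w') + w) = exp (w \<bullet> x - (w \<bullet> w) / 2) * F x"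
    if x: "x \<in> carrier_vec n" for x
  proof -
    have "(x + w') + w = x" using x w by (intro eq_vecI) (auto simp: w'_def)
    moreover have "w' \<bullet> x = - (w \<bullet> x)" "w' \<bullet> w' = w \<bullet> w" using x w by (simp_all add: w'_def)
    ultimately show ?thesis by simp
  qed
  have "has_bochner_integral (std_gauss n)
      (\<lambda>x. exp (- (w' \<bullet> x) - (w' \<bullet> w') / 2) * F ((x + w') + w)) (\<integral>x. F (x + w) \<partial>std_gauss n) =
    has_bochner_integral (std_gauss n)
      (\<lambda>x. exp (w \<bullet> x - (w \<bullet> w) / 2) * F x) (\<integral>x. F (x + w) \<partial>std_gauss n)"
    by (rule has_bochner_integral_cong) (simp_all only: eq space_std_gauss)
  then show ?thesis using * by blast
qed

lemma gauss_exp: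
  assumes w: "w \<in> carrier_vec n"
  shows "has_bochner_integral (std_gauss n) (\<lambda>x. exp (w \<bullet> x - (w \<bullet> w) / 2)) 1"
  using gauss_tilt[of n "\<lambda>_. 1" w] w by simp

lemma measurable_sq_vec [measurable]: "(\<lambda>x. x \<bullet> x) \<in> borel_measurable (lborel_vec n)"
  by (intro measurable_scalar_prod[where n = n]) auto

definition gauss_second_moment :: "nat \<Rightarrow> real" where
  "gauss_second_moment n = (\<integral>x. x \<bullet> x \<partial>std_gauss n)"

lemma integrable_second_moment: "integrable (std_gauss n) (\<lambda>x. x \<bullet> x)"
proof (rule integrable_std_gauss_dominated[where g = "\<lambda>x. 1 + (x \<bullet> x)\<^sup>2"])
  show "integrable (std_gauss n) (\<lambda>x. 1 + (x \<bullet> x)\<^sup>2)"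
    using integrable_fourth_moment by simp
  show "\<bar>x \<bullet> x\<bar> \<le> 1 + (x \<bullet> x)\<^sup>2" for x :: "real vec"
    using zero_le_power2[of "x \<bullet> x - 1"] scalar_prod_self_nonneg[of x] unfolding power2_diff by simp
qed measurable

lemma gauss_second_moment_nonneg: "0 \<le> gauss_second_moment n"
  unfolding gauss_second_moment_def by (rule integral_nonneg_AE) (simp add: scalar_prod_self_nonneg)

text \<open>The Cauchy-Schwarz inequality gives up the sharp constant one, but only the order of magnitude in
  \<open>w\<close> matters below.\<close>

lemma gauss_linear_sq:
  assumes w: "w \<in> carrier_vec n"
  shows "integrable (std_gauss n) (\<lambda>x. (w \<bullet> x)\<^sup>2)"
    and "(\<integral>x. (w \<bullet> x)\<^sup>2 \<partial>std_gauss n) \<le> (w \<bullet> w) * gauss_second_moment n"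
proof -
  have i: "integrable (std_gauss n) (\<lambda>x. (w \<bullet> w) * (x \<bullet> x))"
    using integrable_second_moment by simp
  have b: "(w \<bullet> x)\<^sup>2 \<le> (w \<bullet> w) * (x \<bullet> x)" if "x \<in> carrier_vec n" for x
    using w that by (rule scalar_prod_Cauchy_Schwarz)
  show i': "integrable (std_gauss n) (\<lambda>x. (w \<bullet> x)\<^sup>2)"
    using b measurable_scalar_prod_const[OF w] by (intro integrable_std_gauss_dominated[OF i]) auto
  have "(\<integral>x. (w \<bullet> x)\<^sup>2 \<partial>std_gauss n) \<le> (\<integral>x. (w \<bullet> w) * (x \<bullet> x) \<partial>std_gauss n)"
    using i' i b by (rule integral_std_gauss_mono)
  then show "(\<integral>x. (w \<bullet> x)\<^sup>2 \<partial>std_gauss n) \<le> (w \<bullet> w) * gauss_second_moment n"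
    by (simp add: gauss_second_moment_def)
qed

lemma exp_mult_one_minus_le: "exp s * (1 - s) \<le> 1" for s :: real
proof -
  have "exp s * (1 - s) \<le> exp s * exp (- s)"
    using exp_ge_add_one_self[of "- s"] by (intro mult_left_mono) auto
  then show ?thesis by (simp add: exp_minus)
qed

lemma exp_remainder_bound: "\<bar>exp s - 1 - s\<bar> \<le> s\<^sup>2 * (1 + exp s)" for s :: real
proof (cases "0 \<le> s")
  case True
  note exp_mult_one_minus_le[of s]
  then have "(1 + s) * (exp s * (1 - s)) \<le> (1 + s) * 1" using True by (intro mult_left_mono) auto
  then have "exp s - 1 - s \<le> s\<^sup>2 * exp s" by (simp add: power2_eq_square algebra_simps)
  moreover have "0 \<le> exp s - 1 - s" using exp_ge_add_one_self[of s] by linarith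
  ultimately show ?thesis by (simp add: distrib_left add_increasing)
next
  case False
  note exp_mult_one_minus_le[of s]
  then have "exp s - 1 - s \<le> (- s) * (1 - exp s)" by (simp add: algebra_simps)
  also have "\<dots> \<le> (- s) * (- s)"
    using False exp_ge_add_one_self[of s] by (intro mult_left_mono) linarith+
  finally have "exp s - 1 - s \<le> s\<^sup>2" by (simp add: power2_eq_square)
  moreover have "0 \<le> exp s - 1 - s" using exp_ge_add_one_self[of s] by linarith
  ultimately show ?thesis by (simp add: distrib_left add_increasing2)
qed

text \<open>The Hermite-type remainder of the Gaussian tilt is quadratic in the tilting vector.\<close>

lemma gauss_tilt_remainder:
  assumes w: "w \<in> carrier_vec n" and small: "w \<bullet> w \<le> 1"
  shows "integrable (std_gauss n) (\<lambda>x. \<bar>exp (w \<bullet> x - (w \<bullet> w) / 2) - 1 - w \<bullet> x\<bar>)"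
    and "(\<integral>x. \<bar>exp (w \<bullet> x - (w \<bullet> w) / 2) - 1 - w \<bullet> x\<bar> \<partial>std_gauss n) \<le>
      (5 * gauss_second_moment n + 5) * (w \<bullet> w)"
proof -
  define q where "q = (w \<bullet> w) / 2"
  have q: "0 \<le> q" "q \<le> 1 / 2" using small scalar_prod_self_nonneg[of w] by (auto simp: q_def)
  have ww: "w \<bullet> w = 2 * q" by (simp add: q_def)
  note exp_mult_one_minus_le[of q]
  moreover have "exp q * (1 / 2) \<le> exp q * (1 - q)" using q by (intro mult_left_mono) auto
  ultimately have eq: "exp q \<le> 2" by linarith
  note wm = measurable_scalar_prod_const[OF w]
  let ?T = "\<lambda>x. exp (w \<bullet> x - q)"
  let ?W = "\<lambda>x. \<bar>exp (w \<bullet> x - q) - 1 - w \<bullet> x\<bar>"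
  have iT: "has_bochner_integral (std_gauss n) ?T 1" using gauss_exp[OF w] by (simp add: q_def)
  have isq: "integrable (std_gauss n) (\<lambda>x. 2 * (w \<bullet> x)\<^sup>2 + 2 * (2 * q)\<^sup>2)"
    using gauss_linear_sq[OF w]
    by simp
  have bsq: "(w \<bullet> (x + w))\<^sup>2 \<le> 2 * (w \<bullet> x)\<^sup>2 + 2 * (2 * q)\<^sup>2" if "x \<in> carrier_vec n" for x
  proof -
    have e: "w \<bullet> (x + w) = w \<bullet> x + 2 * q" using w that by (simp add: scalar_prod_add_distrib ww)
    have "(w \<bullet> x + 2 * q)\<^sup>2 + (w \<bullet> x - 2 * q)\<^sup>2 = 2 * (w \<bullet> x)\<^sup>2 + 2 * (2 * q)\<^sup>2"
      by (simp add: power2_eq_square algebra_simps)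
    then show ?thesis unfolding e using zero_le_power2[of "w \<bullet> x - 2 * q"] by linarith
  qed
  have ish: "integrable (std_gauss n) (\<lambda>x. (w \<bullet> (x + w))\<^sup>2)"
    using bsq measurable_compose_translate[OF w wm] by (intro integrable_std_gauss_dominated[OF isq]) auto
  have iTs: "has_bochner_integral (std_gauss n) (\<lambda>x. ?T x * (w \<bullet> x)\<^sup>2) (\<integral>x. (w \<bullet> (x + w))\<^sup>2 \<partial>std_gauss n)"
    using gauss_tilt[OF ish w] by (simp add: q_def)
  have sh: "(\<integral>x. (w \<bullet> (x + w))\<^sup>2 \<partial>std_gauss n) \<le> 2 * (2 * q * gauss_second_moment n) + 2 * (2 * q)\<^sup>2"
  proof -
    have "(\<integral>x. (w \<bullet> (x + w))\<^sup>2 \<partial>std_gauss n) \<le> (\<integral>x. 2 * (w \<bullet> x)\<^sup>2 + 2 * (2 * q)\<^sup>2 \<partial>std_gauss n)"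
      using ish isq bsq by (rule integral_std_gauss_mono)
    also have "\<dots> = 2 * (\<integral>x. (w \<bullet> x)\<^sup>2 \<partial>std_gauss n) + 2 * (2 * q)\<^sup>2"
      using gauss_linear_sq[OF w]
      by simp
    finally show ?thesis using gauss_linear_sq(2)[OF w] by (simp add: ww)
  qed
  define B where "B = (\<lambda>x. (q * exp q) * ?T x + (w \<bullet> x)\<^sup>2 + exp q * (?T x * (w \<bullet> x)\<^sup>2))"
  have iB: "integrable (std_gauss n) B"
    unfolding B_def using iT iTs gauss_linear_sq[OF w]
    by (intro Bochner_Integration.integrable_add integrable_mult_right) (auto simp: has_bochner_integral_iff)
  have bound: "?W x \<le> B x" for x
  proof -
    define s where "s = w \<bullet> x"
    have es: "exp s = exp q * exp (s - q)" by (simp add: exp_diff)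
    have "exp s * (1 - exp (- q)) \<le> exp s * q"
      using exp_ge_add_one_self[of "- q"] by (intro mult_left_mono) auto
    moreover have "exp (s - q) = exp s * exp (- q)" by (simp add: exp_diff exp_minus divide_inverse)
    ultimately have "\<bar>exp (s - q) - exp s\<bar> \<le> q * exp s"
      using q by (simp add: algebra_simps abs_le_iff)
    then have "\<bar>exp (s - q) - 1 - s\<bar> \<le> q * exp s + s\<^sup>2 * (1 + exp s)"
      using exp_remainder_bound[of s] by linarith
    then show ?thesis by (simp add: B_def es algebra_simps flip: s_def)
  qed
  have iW: "integrable (std_gauss n) ?W"
    using bound wm by (intro integrable_std_gauss_dominated[OF iB]) auto
  then show "integrable (std_gauss n) (\<lambda>x. \<bar>exp (w \<bullet> x - (w \<bullet> w) / 2) - 1 - w \<bullet> x\<bar>)"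
    by (simp add: q_def)
  have "(\<integral>x. ?W x \<partial>std_gauss n) \<le> (\<integral>x. B x \<partial>std_gauss n)"
    using iW iB bound by (rule integral_std_gauss_mono)
  also have "\<dots> = (q * exp q) * 1 + (\<integral>x. (w \<bullet> x)\<^sup>2 \<partial>std_gauss n) +
      exp q * (\<integral>x. (w \<bullet> (x + w))\<^sup>2 \<partial>std_gauss n)"
    unfolding B_def using iT iTs gauss_linear_sq[OF w] by (auto simp: has_bochner_integral_iff)
  also have "\<dots> \<le> q * 2 + 2 * q * gauss_second_moment n +
      2 * (2 * (2 * q * gauss_second_moment n) + 2 * (2 * q)\<^sup>2)"
  proof -
    have "q * exp q \<le> q * 2" using q eq by (intro mult_left_mono)
    moreover have "exp q * (\<integral>x. (w \<bullet> (x + w))\<^sup>2 \<partial>std_gauss n) \<le>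
        2 * (2 * (2 * q * gauss_second_moment n) + 2 * (2 * q)\<^sup>2)"
      using eq sh by (rule mult_mono) (auto intro!: integral_nonneg_AE)
    ultimately show ?thesis using gauss_linear_sq(2)[OF w] by (simp add: ww)
  qed
  also have "\<dots> \<le> (5 * gauss_second_moment n + 5) * (2 * q)"
  proof -
    have "(2 * q)\<^sup>2 \<le> 2 * q" using q mult_right_mono[of "2 * q" 1 "2 * q"] by (simp add: power2_eq_square)
    then show ?thesis using q gauss_second_moment_nonneg[of n] by (simp add: algebra_simps)
  qed
  finally show "(\<integral>x. \<bar>exp (w \<bullet> x - (w \<bullet> w) / 2) - 1 - w \<bullet> x\<bar> \<partial>std_gauss n) \<le>
      (5 * gauss_second_moment n + 5) * (w \<bullet> w)"
    by (simp add: q_def)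
qed

lemma gauss_abs_linear:
  assumes w: "w \<in> carrier_vec n"
  shows "integrable (std_gauss n) (\<lambda>x. w \<bullet> x)"
    and "(\<integral>x. \<bar>w \<bullet> x\<bar> \<partial>std_gauss n) \<le> (1 + gauss_second_moment n) * vnorm w"
proof -
  note wm = measurable_scalar_prod_const[OF w]
  have i2: "integrable (std_gauss n) (\<lambda>x. vnorm w * (1 + x \<bullet> x))"
    using integrable_second_moment by simp
  have b: "\<bar>w \<bullet> x\<bar> \<le> vnorm w * (1 + x \<bullet> x)" if x: "x \<in> carrier_vec n" for x
  proof -
    have "2 * vnorm x \<le> (vnorm x)\<^sup>2 + 1"
      using zero_le_power2[of "vnorm x - 1"] unfolding power2_diff by simp
    then have "vnorm x \<le> 1 + (vnorm x)\<^sup>2" using vnorm_nonneg[of x] by linarith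
    then have "vnorm w * vnorm x \<le> vnorm w * (1 + x \<bullet> x)" by (intro mult_left_mono) (auto simp: vnorm_sq)
    then show ?thesis using abs_scalar_prod_le_vnorm[OF w x] by simp
  qed
  show i: "integrable (std_gauss n) (\<lambda>x. w \<bullet> x)"
    using b wm by (intro integrable_std_gauss_dominated[OF i2]) auto
  have "(\<integral>x. \<bar>w \<bullet> x\<bar> \<partial>std_gauss n) \<le> (\<integral>x. vnorm w * (1 + x \<bullet> x) \<partial>std_gauss n)"
    using i i2 b by (intro integral_std_gauss_mono) auto
  also have "\<dots> = vnorm w * (1 + gauss_second_moment n)"
    using integrable_second_moment by (simp add: gauss_second_moment_def)
  finally show "(\<integral>x. \<bar>w \<bullet> x\<bar> \<partial>std_gauss n) \<le> (1 + gauss_second_moment n) * vnorm w"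
    by (simp add: mult.commute)
qed

section \<open>The heat semigroup on bounded functions\<close>

definition heat_real :: "nat \<Rightarrow> real \<Rightarrow> (real vec \<Rightarrow> real) \<Rightarrow> real vec \<Rightarrow> real" where
  "heat_real n t g x = (\<integral>\<xi>. g (x + sqrt t \<cdot>\<^sub>v \<xi>) \<partial>std_gauss n)"

definition bounded_measurable :: "nat \<Rightarrow> real \<Rightarrow> real \<Rightarrow> (real vec \<Rightarrow> real) \<Rightarrow> bool" where
  "bounded_measurable n a b g \<longleftrightarrow>
    g \<in> borel_measurable (lborel_vec n) \<and> (\<forall>x\<in>carrier_vec n. a \<le> g x \<and> g x \<le> b)"

lemma bounded_measurableD:
  assumes "bounded_measurable n a b g"
  shows "g \<in> borel_measurable (lborel_vec n)"
    and "x \<in> carrier_vec n \<Longrightarrow> a \<le> g x" and "x \<in> carrier_vec n \<Longrightarrow> g x \<le> b"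
  using assms by (auto simp: bounded_measurable_def)

lemma integrable_heat_real:
  assumes g: "bounded_measurable n a b g" and x: "x \<in> carrier_vec n"
  shows "integrable (std_gauss n) (\<lambda>\<xi>. g (x + r \<cdot>\<^sub>v \<xi>))"
proof (rule integrable_std_gauss_bounded)
  show "(\<lambda>\<xi>. g (x + r \<cdot>\<^sub>v \<xi>)) \<in> borel_measurable (lborel_vec n)"
    by (rule measurable_compose[OF _ bounded_measurableD(1)[OF g]])
      (use x in \<open>intro measurable_add_vec measurable_smult_vec; simp\<close>)
  show "\<bar>g (x + r \<cdot>\<^sub>v \<xi>)\<bar> \<le> \<bar>a\<bar> + \<bar>b\<bar>" if "\<xi> \<in> carrier_vec n" for \<xi>
    using bounded_measurableD(2,3)[OF g, of "x + r \<cdot>\<^sub>v \<xi>"] x that by (simp add: abs_if split: if_splits)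
qed

lemma ennreal_heat_real:
  assumes g: "bounded_measurable n a b g" and x: "x \<in> carrier_vec n" and a: "0 \<le> a"
  shows "ennreal (heat_real n t g x) = heat n t (\<lambda>x. ennreal (g x)) x"
  unfolding heat_def heat_real_def
proof (rule nn_integral_eq_integral[OF integrable_heat_real[OF g x], symmetric], rule AE_I2)
  fix \<xi> assume "\<xi> \<in> space (std_gauss n)"
  then have "x + sqrt t \<cdot>\<^sub>v \<xi> \<in> carrier_vec n" using x by simp
  from bounded_measurableD(2)[OF g this] a show "0 \<le> g (x + sqrt t \<cdot>\<^sub>v \<xi>)" by simp
qed

lemma heat_real_bounds:
  assumes g: "bounded_measurable n a b g" and x: "x \<in> carrier_vec n"
  shows "a \<le> heat_real n t g x" and "heat_real n t g x \<le> b"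
proof -
  note i = integrable_heat_real[OF g x, of "sqrt t"]
  have *: "x + sqrt t \<cdot>\<^sub>v \<xi> \<in> carrier_vec n" if "\<xi> \<in> carrier_vec n" for \<xi> using x that by simp
  have "(\<integral>\<xi>. a \<partial>std_gauss n) \<le> heat_real n t g x"
    unfolding heat_real_def using * bounded_measurableD(2)[OF g] by (intro integral_std_gauss_mono i) simp_all
  then show "a \<le> heat_real n t g x" by simp
  have "heat_real n t g x \<le> (\<integral>\<xi>. b \<partial>std_gauss n)"
    unfolding heat_real_def using * bounded_measurableD(3)[OF g] by (intro integral_std_gauss_mono i) simp_all
  then show "heat_real n t g x \<le> b" by simp
qed

lemma bounded_measurable_heat_real:
  assumes g: "bounded_measurable n a b g" and a: "0 \<le> a"
  shows "bounded_measurable n a b (heat_real n t g)"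
proof -
  have "(\<lambda>x. enn2real (heat n t (\<lambda>x. ennreal (g x)) x)) \<in> borel_measurable (lborel_vec n)"
    by (intro borel_measurable_enn2real measurable_heat measurable_compose[OF _ measurable_ennreal]
        bounded_measurableD(1)[OF g])
  moreover have "enn2real (heat n t (\<lambda>x. ennreal (g x)) x) = heat_real n t g x" if "x \<in> carrier_vec n" for x
  proof -
    have "0 \<le> heat_real n t g x" using heat_real_bounds(1)[OF g that, of t] a by linarith
    then show ?thesis by (simp flip: ennreal_heat_real[OF g that a])
  qed
  ultimately have "heat_real n t g \<in> borel_measurable (lborel_vec n)"
    by (rule measurable_cong[THEN iffD1, rotated]) simp
  then show ?thesis using heat_real_bounds[OF g] by (auto simp: bounded_measurable_def)
qed

lemma heat_real_heat_real:
  assumes g: "bounded_measurable n 0 b g" and x: "x \<in> carrier_vec n" and st: "0 < s" "0 < t"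
  shows "heat_real n s (heat_real n t g) x = heat_real n (s + t) g x"
proof -
  have gm: "(\<lambda>x. ennreal (g x)) \<in> borel_measurable (lborel_vec n)"
    by (intro measurable_compose[OF _ measurable_ennreal] bounded_measurableD(1)[OF g])
  have "ennreal (heat_real n s (heat_real n t g) x) = heat n s (\<lambda>x. ennreal (heat_real n t g x)) x"
    by (rule ennreal_heat_real[OF bounded_measurable_heat_real[OF g] x]) simp_all
  also have "\<dots> = heat n s (heat n t (\<lambda>x. ennreal (g x))) x"
    unfolding heat_def[of n s]
  proof (rule nn_integral_cong)
    fix \<xi> assume "\<xi> \<in> space (std_gauss n)"
    then have "x + sqrt s \<cdot>\<^sub>v \<xi> \<in> carrier_vec n" using x by simp
    then show "ennreal (heat_real n t g (x + sqrt s \<cdot>\<^sub>v \<xi>)) = heat n t (\<lambda>x. ennreal (g x)) (x + sqrt s \<cdot>\<^sub>v \<xi>)"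
      by (rule ennreal_heat_real[OF g]) simp
  qed
  also have "\<dots> = heat n (s + t) (\<lambda>x. ennreal (g x)) x" by (rule heat_heat[OF gm x st])
  also have "\<dots> = ennreal (heat_real n (s + t) g x)" by (rule ennreal_heat_real[OF g x, symmetric]) simp
  finally show ?thesis
    using heat_real_bounds(1)[OF g x] heat_real_bounds(1)[OF bounded_measurable_heat_real[OF g] x]
    by (subst (asm) ennreal_inj) auto
qed

lemma heat_real_add_const:
  assumes g: "bounded_measurable n a b g" and x: "x \<in> carrier_vec n"
  shows "heat_real n t (\<lambda>x. \<tau> + g x) x = \<tau> + heat_real n t g x"
  unfolding heat_real_def using integrable_heat_real[OF g x, of "sqrt t"] by simp

definition taylor_const :: "nat \<Rightarrow> real" where
  "taylor_const n = 5 * gauss_second_moment n + 6"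

lemma taylor_const_ge: "1 \<le> taylor_const n" "1 + gauss_second_moment n \<le> taylor_const n"
  "5 * gauss_second_moment n + 5 \<le> taylor_const n" "2 + gauss_second_moment n \<le> taylor_const n"
  using gauss_second_moment_nonneg[of n] by (auto simp: taylor_const_def)

text \<open>After any positive time the heat semigroup has a quadratic Taylor remainder that is controlled
  by the bound on the initial function alone: a shift of the base point is a tilt of the Gaussian
  measure, whose remainder is quadratic.\<close>

lemma heat_real_taylor:
  assumes g: "bounded_measurable n 0 b g" and t: "0 < t" and x: "x \<in> carrier_vec n"
  obtains G where "G \<in> carrier_vec n"
    and "\<And>z. z \<in> carrier_vec n \<Longrightarrow> \<bar>heat_real n t g (x + z) - heat_real n t g x - G \<bullet> z\<bar> \<le>
      b * taylor_const n / t * (z \<bullet> z)"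
    and "\<And>z. z \<in> carrier_vec n \<Longrightarrow> (heat_real n t g (x + z) - heat_real n t g x)\<^sup>2 \<le>
      (2 * b * taylor_const n)\<^sup>2 / t * (z \<bullet> z)"
proof -
  define f where "f = (\<lambda>\<xi>. g (x + sqrt t \<cdot>\<^sub>v \<xi>))"
  have carr: "x + sqrt t \<cdot>\<^sub>v \<xi> \<in> carrier_vec n" if "\<xi> \<in> carrier_vec n" for \<xi> using x that by simp
  have fi: "integrable (std_gauss n) f"
    unfolding f_def by (rule integrable_heat_real[OF g x])
  have fm: "f \<in> borel_measurable (lborel_vec n)" using borel_measurable_integrable[OF fi] by simp
  have fb: "0 \<le> f \<xi>" "f \<xi> \<le> b" if "\<xi> \<in> carrier_vec n" for \<xi>
    unfolding f_def using carr[OF that] bounded_measurableD(2,3)[OF g] by auto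
  have b0: "0 \<le> b" using fb[of "0\<^sub>v n"] by simp
  have prod_i: "integrable (std_gauss n) (\<lambda>\<xi>. f \<xi> * h \<xi>)"
    if "integrable (std_gauss n) h" for h :: "real vec \<Rightarrow> real"
  proof (rule integrable_std_gauss_dominated[where g = "\<lambda>\<xi>. b * \<bar>h \<xi>\<bar>"])
    show "integrable (std_gauss n) (\<lambda>\<xi>. b * \<bar>h \<xi>\<bar>)" using that by simp
    show "(\<lambda>\<xi>. f \<xi> * h \<xi>) \<in> borel_measurable (lborel_vec n)"
      using fm borel_measurable_integrable[OF that] by simp
    show "\<bar>f \<xi> * h \<xi>\<bar> \<le> b * \<bar>h \<xi>\<bar>" if "\<xi> \<in> carrier_vec n" for \<xi>
      unfolding abs_mult using fb[OF that] by (intro mult_right_mono) auto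
  qed
  have prod_b: "\<bar>\<integral>\<xi>. f \<xi> * h \<xi> \<partial>std_gauss n\<bar> \<le> b * (\<integral>\<xi>. \<bar>h \<xi>\<bar> \<partial>std_gauss n)"
    if h: "integrable (std_gauss n) h" for h :: "real vec \<Rightarrow> real"
  proof -
    have "\<bar>\<integral>\<xi>. f \<xi> * h \<xi> \<partial>std_gauss n\<bar> \<le> (\<integral>\<xi>. \<bar>f \<xi> * h \<xi>\<bar> \<partial>std_gauss n)"
      using integral_norm_bound[of "std_gauss n" "\<lambda>\<xi>. f \<xi> * h \<xi>"] by simp
    also have "\<dots> \<le> (\<integral>\<xi>. b * \<bar>h \<xi>\<bar> \<partial>std_gauss n)"
    proof (rule integral_std_gauss_mono)
      show "integrable (std_gauss n) (\<lambda>\<xi>. \<bar>f \<xi> * h \<xi>\<bar>)" using prod_i[OF h] by simp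
      show "integrable (std_gauss n) (\<lambda>\<xi>. b * \<bar>h \<xi>\<bar>)" using h by simp
      show "\<bar>f \<xi> * h \<xi>\<bar> \<le> b * \<bar>h \<xi>\<bar>" if "\<xi> \<in> carrier_vec n" for \<xi>
        unfolding abs_mult using fb[OF that] by (intro mult_right_mono) auto
    qed
    finally show ?thesis by simp
  qed
  define G where "G = vec n (\<lambda>j. (\<integral>\<xi>. f \<xi> * \<xi> $ j \<partial>std_gauss n) / sqrt t)"
  have G: "G \<in> carrier_vec n" by (simp add: G_def)
  have coord_i: "integrable (std_gauss n) (\<lambda>\<xi>. \<xi> $ j)" if j: "j < n" for j
  proof -
    have "integrable (std_gauss n) (\<lambda>\<xi>. unit_vec n j \<bullet> \<xi>)" by (rule gauss_abs_linear) simp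
    then show ?thesis
      by (subst Bochner_Integration.integrable_cong[where g = "\<lambda>\<xi>. unit_vec n j \<bullet> \<xi>"]) (use j in auto)
  qed
  define \<zeta> where "\<zeta> = (\<lambda>z :: real vec. (1 / sqrt t) \<cdot>\<^sub>v z)"
  have \<zeta>: "\<zeta> z \<in> carrier_vec n" "z = sqrt t \<cdot>\<^sub>v \<zeta> z" "\<zeta> z \<bullet> \<zeta> z = (z \<bullet> z) / t" if "z \<in> carrier_vec n" for z
    using that t by (auto simp: \<zeta>_def)
  have Gz: "G \<bullet> z = (\<integral>\<xi>. f \<xi> * (\<zeta> z \<bullet> \<xi>) \<partial>std_gauss n)" if z: "z \<in> carrier_vec n" for z
  proof -
    have "(\<integral>\<xi>. f \<xi> * (\<zeta> z \<bullet> \<xi>) \<partial>std_gauss n) = (\<integral>\<xi>. (\<Sum>j<n. z $ j / sqrt t * (f \<xi> * \<xi> $ j)) \<partial>std_gauss n)"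
      using z by (intro Bochner_Integration.integral_cong refl)
        (simp add: \<zeta>_def scalar_prod_real[where n = n] sum_distrib_left mult_ac)
    also have "\<dots> = (\<Sum>j<n. z $ j / sqrt t * (\<integral>\<xi>. f \<xi> * \<xi> $ j \<partial>std_gauss n))"
      by (subst Bochner_Integration.integral_sum) (auto intro!: prod_i coord_i)
    also have "\<dots> = G \<bullet> z"
      using z by (simp add: G_def scalar_prod_real[where n = n] mult_ac)
    finally show ?thesis by simp
  qed
  have shift: "has_bochner_integral (std_gauss n) (\<lambda>\<xi>. exp (\<zeta> z \<bullet> \<xi> - (\<zeta> z \<bullet> \<zeta> z) / 2) * f \<xi>)
      (heat_real n t g (x + z))" if z: "z \<in> carrier_vec n" for z
  proof -
    have eq: "f (\<xi> + \<zeta> z) = g ((x + z) + sqrt t \<cdot>\<^sub>v \<xi>)" if \<xi>: "\<xi> \<in> carrier_vec n" for \<xi>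
    proof -
      have "x + sqrt t \<cdot>\<^sub>v (\<xi> + \<zeta> z) = (x + z) + sqrt t \<cdot>\<^sub>v \<xi>"
      proof (rule eq_vecI)
        fix j assume "j < dim_vec ((x + z) + sqrt t \<cdot>\<^sub>v \<xi>)"
        then have j: "j < n" using \<xi> by simp
        have "z $ j = sqrt t * \<zeta> z $ j" using j z t by (simp add: \<zeta>_def)
        then show "(x + sqrt t \<cdot>\<^sub>v (\<xi> + \<zeta> z)) $ j = ((x + z) + sqrt t \<cdot>\<^sub>v \<xi>) $ j"
          using j x z \<xi> \<zeta>(1)[OF z] by (simp add: algebra_simps)
      qed (use x z \<xi> \<zeta>(1)[OF z] in auto)
      then show ?thesis by (simp add: f_def)
    qed
    have "heat_real n t g (x + z) = (\<integral>\<xi>. f (\<xi> + \<zeta> z) \<partial>std_gauss n)"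
      unfolding heat_real_def by (intro Bochner_Integration.integral_cong refl) (simp add: eq)
    moreover have "integrable (std_gauss n) (\<lambda>\<xi>. f (\<xi> + \<zeta> z))"
      using measurable_compose_translate[OF \<zeta>(1)[OF z] fm] fb[OF add_carrier_vec[OF _ \<zeta>(1)[OF z]]]
      by (intro integrable_std_gauss_bounded[where B = b]) simp_all
    ultimately show ?thesis using gauss_tilt[of n f "\<zeta> z"] \<zeta>(1)[OF z] fb by simp
  qed
  have heat_x: "heat_real n t g x = (\<integral>\<xi>. f \<xi> \<partial>std_gauss n)" by (simp add: heat_real_def f_def)
  have lin: "\<bar>G \<bullet> z\<bar> \<le> b * (taylor_const n * vnorm (\<zeta> z))" if z: "z \<in> carrier_vec n" for z
  proof -
    have "\<bar>G \<bullet> z\<bar> \<le> b * (\<integral>\<xi>. \<bar>\<zeta> z \<bullet> \<xi>\<bar> \<partial>std_gauss n)"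
      unfolding Gz[OF z] by (rule prod_b) (rule gauss_abs_linear[OF \<zeta>(1)[OF z]])
    also have "\<dots> \<le> b * ((1 + gauss_second_moment n) * vnorm (\<zeta> z))"
      using b0 gauss_abs_linear(2)[OF \<zeta>(1)[OF z]] by (intro mult_left_mono)
    also have "\<dots> \<le> b * (taylor_const n * vnorm (\<zeta> z))"
      using b0 taylor_const_ge(2) by (intro mult_left_mono mult_right_mono) auto
    finally show ?thesis .
  qed
  have diff_b: "\<bar>heat_real n t g (x + z) - heat_real n t g x\<bar> \<le> b" if z: "z \<in> carrier_vec n" for z
    using heat_real_bounds[OF g x, of t] heat_real_bounds[OF g, of "x + z" t] x z by (simp add: abs_le_iff)
  have T: "\<bar>heat_real n t g (x + z) - heat_real n t g x - G \<bullet> z\<bar> \<le> b * taylor_const n * (\<zeta> z \<bullet> \<zeta> z)"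
    if z: "z \<in> carrier_vec n" for z
  proof (cases "\<zeta> z \<bullet> \<zeta> z \<le> 1")
    case True
    note R = gauss_tilt_remainder[OF \<zeta>(1)[OF z] True]
    let ?r = "\<lambda>\<xi>. exp (\<zeta> z \<bullet> \<xi> - (\<zeta> z \<bullet> \<zeta> z) / 2) - 1 - \<zeta> z \<bullet> \<xi>"
    have ri: "integrable (std_gauss n) ?r"
      using gauss_exp[OF \<zeta>(1)[OF z]] gauss_abs_linear(1)[OF \<zeta>(1)[OF z]]
      by (auto simp: has_bochner_integral_iff)
    have li: "integrable (std_gauss n) (\<lambda>\<xi>. f \<xi> * (\<zeta> z \<bullet> \<xi>))"
      by (rule prod_i) (rule gauss_abs_linear(1)[OF \<zeta>(1)[OF z]])
    have "(\<integral>\<xi>. f \<xi> * ?r \<xi> \<partial>std_gauss n) = (\<integral>\<xi>. exp (\<zeta> z \<bullet> \<xi> - (\<zeta> z \<bullet> \<zeta> z) / 2) * f \<xi> - f \<xi> - f \<xi> * (\<zeta> z \<bullet> \<xi>) \<partial>std_gauss n)"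
      by (simp add: algebra_simps)
    also have "\<dots> = heat_real n t g (x + z) - heat_real n t g x - G \<bullet> z"
      using shift[OF z] fi li by (simp add: has_bochner_integral_iff Gz[OF z] heat_x)
    finally have "\<bar>heat_real n t g (x + z) - heat_real n t g x - G \<bullet> z\<bar> \<le> b * (\<integral>\<xi>. \<bar>?r \<xi>\<bar> \<partial>std_gauss n)"
      using prod_b[OF ri] by simp
    also have "\<dots> \<le> b * ((5 * gauss_second_moment n + 5) * (\<zeta> z \<bullet> \<zeta> z))"
      using b0 R(2) by (intro mult_left_mono)
    also have "\<dots> \<le> b * (taylor_const n * (\<zeta> z \<bullet> \<zeta> z))"
      using b0 taylor_const_ge(3) scalar_prod_self_nonneg by (intro mult_left_mono mult_right_mono) auto
    finally show ?thesis by (simp add: mult.assoc)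
  next
    case False
    then have v1: "1 \<le> vnorm (\<zeta> z)" by (simp add: vnorm_def)
    then have v2: "vnorm (\<zeta> z) \<le> \<zeta> z \<bullet> \<zeta> z"
      using mult_right_mono[OF v1, of "vnorm (\<zeta> z)"] by (simp flip: vnorm_sq add: power2_eq_square)
    have "\<bar>G \<bullet> z\<bar> \<le> b * (\<integral>\<xi>. \<bar>\<zeta> z \<bullet> \<xi>\<bar> \<partial>std_gauss n)"
      unfolding Gz[OF z] by (rule prod_b) (rule gauss_abs_linear[OF \<zeta>(1)[OF z]])
    also have "\<dots> \<le> b * ((1 + gauss_second_moment n) * (\<zeta> z \<bullet> \<zeta> z))"
      using b0 gauss_abs_linear(2)[OF \<zeta>(1)[OF z]] v2 gauss_second_moment_nonneg[of n]
      by (intro mult_left_mono) (auto intro: order_trans mult_left_mono)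
    finally have "\<bar>G \<bullet> z\<bar> \<le> b * ((1 + gauss_second_moment n) * (\<zeta> z \<bullet> \<zeta> z))" .
    moreover have "b * 1 \<le> b * (\<zeta> z \<bullet> \<zeta> z)" using b0 False by (intro mult_left_mono) auto
    ultimately have "\<bar>heat_real n t g (x + z) - heat_real n t g x - G \<bullet> z\<bar> \<le>
        b * (\<zeta> z \<bullet> \<zeta> z) + b * ((1 + gauss_second_moment n) * (\<zeta> z \<bullet> \<zeta> z))"
      using diff_b[OF z] by linarith
    also have "\<dots> = b * ((2 + gauss_second_moment n) * (\<zeta> z \<bullet> \<zeta> z))" by (simp add: algebra_simps)
    also have "\<dots> \<le> b * (taylor_const n * (\<zeta> z \<bullet> \<zeta> z))"
      using b0 taylor_const_ge(4) scalar_prod_self_nonneg by (intro mult_left_mono mult_right_mono) auto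
    finally show ?thesis by (simp add: mult.assoc)
  qed
  have D: "\<bar>heat_real n t g (x + z) - heat_real n t g x\<bar> \<le> 2 * b * taylor_const n * vnorm (\<zeta> z)"
    if z: "z \<in> carrier_vec n" for z
  proof (cases "\<zeta> z \<bullet> \<zeta> z \<le> 1")
    case True
    then have "vnorm (\<zeta> z) \<le> 1" by (simp add: vnorm_def)
    then have "\<zeta> z \<bullet> \<zeta> z \<le> vnorm (\<zeta> z)"
      using mult_right_mono[of "vnorm (\<zeta> z)" 1 "vnorm (\<zeta> z)"] by (simp flip: vnorm_sq add: power2_eq_square)
    then have "b * taylor_const n * (\<zeta> z \<bullet> \<zeta> z) \<le> b * taylor_const n * vnorm (\<zeta> z)"
      using b0 taylor_const_ge(1)[of n] by (intro mult_left_mono) auto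
    then show ?thesis using T[OF z] lin[OF z] by (simp add: mult.assoc)
  next
    case False
    then have v1: "1 \<le> vnorm (\<zeta> z)" by (simp add: vnorm_def)
    have "b * 1 * 1 \<le> b * taylor_const n * vnorm (\<zeta> z)"
      using b0 taylor_const_ge(1)[of n] v1 by (intro mult_mono mult_nonneg_nonneg) auto
    then show ?thesis using diff_b[OF z] b0 by simp
  qed
  show ?thesis
  proof (rule that[OF G])
    fix z :: "real vec" assume z: "z \<in> carrier_vec n"
    show "\<bar>heat_real n t g (x + z) - heat_real n t g x - G \<bullet> z\<bar> \<le> b * taylor_const n / t * (z \<bullet> z)"
      using T[OF z] by (simp add: \<zeta>(3)[OF z])
    have "(heat_real n t g (x + z) - heat_real n t g x)\<^sup>2 \<le> (2 * b * taylor_const n * vnorm (\<zeta> z))\<^sup>2"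
      using order_trans[OF D[OF z] abs_ge_self] by (rule abs_le_square_iff[THEN iffD1])
    also have "\<dots> = (2 * b * taylor_const n)\<^sup>2 / t * (z \<bullet> z)"
      by (simp add: power_mult_distrib vnorm_sq \<zeta>(3)[OF z])
    finally show "(heat_real n t g (x + z) - heat_real n t g x)\<^sup>2 \<le> (2 * b * taylor_const n)\<^sup>2 / t * (z \<bullet> z)" .
  qed
qed

text \<open>A second order bound on \<open>ln \<psi>\<close> without derivatives: \<open>v\<close> is the gradient at \<open>x\<close>, and the
  remainder is quadratic uniformly in \<open>x\<close> and for all increments \<open>z\<close>.\<close>

definition log_smooth :: "nat \<Rightarrow> real \<Rightarrow> (real vec \<Rightarrow> real) \<Rightarrow> bool" where
  "log_smooth n L \<psi> \<longleftrightarrow> (\<forall>x\<in>carrier_vec n. \<exists>v\<in>carrier_vec n. \<forall>z\<in>carrier_vec n.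
     \<bar>ln (\<psi> (x + z)) - ln (\<psi> x) - v \<bullet> z\<bar> \<le> L * (z \<bullet> z))"

text \<open>The added constant \<open>\<tau>\<close> keeps the argument of the logarithm away from zero.  The bound is
  the same for all times from \<open>\<delta>\<close> on, which is what makes the errors of many steps summable.\<close>

lemma heat_real_log_smooth:
  assumes g: "bounded_measurable n 0 b g" and \<tau>: "0 < \<tau>" and \<delta>: "0 < \<delta>" "\<delta> \<le> t"
  shows "log_smooth n (b * taylor_const n / (\<delta> * \<tau>) + (2 * b * taylor_const n)\<^sup>2 / (\<delta> * \<tau>\<^sup>2))
    (\<lambda>x. \<tau> + heat_real n t g x)"
  unfolding log_smooth_def
proof
  fix x :: "real vec" assume x: "x \<in> carrier_vec n"
  have t: "0 < t" using \<delta> by simp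
  let ?c = "b * taylor_const n" and ?k = "(2 * b * taylor_const n)\<^sup>2"
  obtain G where G: "G \<in> carrier_vec n"
    and G1: "\<And>z. z \<in> carrier_vec n \<Longrightarrow> \<bar>heat_real n t g (x + z) - heat_real n t g x - G \<bullet> z\<bar> \<le> ?c / t * (z \<bullet> z)"
    and G2: "\<And>z. z \<in> carrier_vec n \<Longrightarrow> (heat_real n t g (x + z) - heat_real n t g x)\<^sup>2 \<le> ?k / t * (z \<bullet> z)"
    using heat_real_taylor[OF g t x] by metis
  have b0: "0 \<le> b" using heat_real_bounds[OF g x, of t] by linarith
  have c0: "0 \<le> ?c" using b0 taylor_const_ge(1)[of n] by simp
  define p where "p = \<tau> + heat_real n t g x"
  have p: "\<tau> \<le> p" using heat_real_bounds(1)[OF g x, of t] by (simp add: p_def)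
  show "\<exists>v\<in>carrier_vec n. \<forall>z\<in>carrier_vec n.
      \<bar>ln (\<tau> + heat_real n t g (x + z)) - ln (\<tau> + heat_real n t g x) - v \<bullet> z\<bar> \<le>
      (?c / (\<delta> * \<tau>) + ?k / (\<delta> * \<tau>\<^sup>2)) * (z \<bullet> z)"
  proof (intro bexI[of _ "(1 / p) \<cdot>\<^sub>v G"] ballI)
    fix z :: "real vec" assume z: "z \<in> carrier_vec n"
    define r where "r = \<tau> + heat_real n t g (x + z)"
    have r: "\<tau> \<le> r" using heat_real_bounds(1)[OF g, of "x + z" t] x z by (simp add: r_def)
    have zz: "0 \<le> z \<bullet> z" by (rule scalar_prod_self_nonneg)
    have v: "((1 / p) \<cdot>\<^sub>v G) \<bullet> z = (G \<bullet> z) / p" using G z by simp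
    have pr: "0 < p" "0 < r" using p r \<tau> by auto
    have a1: "\<bar>(r - p) - G \<bullet> z\<bar> / p \<le> ?c / (\<delta> * \<tau>) * (z \<bullet> z)"
    proof -
      have "\<bar>(r - p) - G \<bullet> z\<bar> \<le> ?c / t * (z \<bullet> z)" using G1[OF z] by (simp add: r_def p_def)
      also have "\<dots> \<le> ?c / \<delta> * (z \<bullet> z)"
        using c0 \<delta> zz by (intro mult_right_mono divide_left_mono) auto
      finally have "\<bar>(r - p) - G \<bullet> z\<bar> / p \<le> (?c / \<delta> * (z \<bullet> z)) / \<tau>"
        using p pr \<tau> by (intro frac_le) auto
      then show ?thesis by simp
    qed
    have a2: "(r - p)\<^sup>2 / (p * r) \<le> ?k / (\<delta> * \<tau>\<^sup>2) * (z \<bullet> z)"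
    proof -
      have "(r - p)\<^sup>2 \<le> ?k / t * (z \<bullet> z)" using G2[OF z] by (simp add: r_def p_def)
      also have "\<dots> \<le> ?k / \<delta> * (z \<bullet> z)"
        using \<delta> zz by (intro mult_right_mono divide_left_mono) auto
      finally have *: "(r - p)\<^sup>2 \<le> ?k / \<delta> * (z \<bullet> z)" .
      have "(r - p)\<^sup>2 / (p * r) \<le> (?k / \<delta> * (z \<bullet> z)) / (\<tau> * \<tau>)"
        using \<tau> \<delta> zz pr by (intro frac_le * mult_mono p r) auto
      then show ?thesis by (simp add: power2_eq_square)
    qed
    have upper: "ln r - ln p \<le> (r - p) / p"
    proof -
      have "ln (r / p) \<le> r / p - 1" using pr by (intro ln_le_minus_one) auto
      then show ?thesis using pr by (simp add: ln_div diff_divide_distrib)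
    qed
    have lower: "(r - p) / p - (r - p)\<^sup>2 / (p * r) \<le> ln r - ln p"
    proof -
      have "ln (p / r) \<le> p / r - 1" using pr by (intro ln_le_minus_one) auto
      then have "1 - p / r \<le> ln r - ln p" using pr by (simp add: ln_div)
      moreover have "1 - p / r = (r - p) / p - (r - p)\<^sup>2 / (p * r)"
        using pr by (simp add: field_simps power2_eq_square)
      ultimately show ?thesis by simp
    qed
    have "\<bar>ln r - ln p - (G \<bullet> z) / p\<bar> \<le> \<bar>(r - p) - G \<bullet> z\<bar> / p + (r - p)\<^sup>2 / (p * r)"
    proof -
      have "0 \<le> (r - p)\<^sup>2 / (p * r)" using pr by simp
      moreover have "\<bar>(r - p) - G \<bullet> z\<bar> / p = \<bar>(r - p) / p - (G \<bullet> z) / p\<bar>"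
        using pr by (simp flip: diff_divide_distrib add: abs_divide)
      ultimately show ?thesis using upper lower by linarith
    qed
    then show "\<bar>ln (\<tau> + heat_real n t g (x + z)) - ln (\<tau> + heat_real n t g x) - ((1 / p) \<cdot>\<^sub>v G) \<bullet> z\<bar> \<le>
        (?c / (\<delta> * \<tau>) + ?k / (\<delta> * \<tau>\<^sup>2)) * (z \<bullet> z)"
      unfolding v r_def[symmetric] p_def[symmetric] using a1 a2 by (simp add: distrib_right)
  qed (use G in simp)
qed

section \<open>One step of the heat flow\<close>

text \<open>The coefficient of \<open>h\<^sup>2\<close> in the error of one step.  It bounds the second moment of the remainder \<open>\<rho>\<close>:
  \<open>L (z \<bullet> z)\<close> squared is a fourth moment, \<open>ln b - ln a + L\<close> bounds the gradient, and \<open>b / a\<close> is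
  the oscillation of the function.\<close>

definition step_const :: "nat \<Rightarrow> real \<Rightarrow> real \<Rightarrow> real \<Rightarrow> real" where
  "step_const n a b L = L\<^sup>2 * (8 * gauss_fourth_moment n + 8 * (ln b - ln a + L) ^ 4 + b / a * gauss_fourth_moment n)"

lemma sq_norm_add_le:
  fixes x u :: "real vec"
  assumes "x \<in> carrier_vec n" "u \<in> carrier_vec n"
  shows "(x + u) \<bullet> (x + u) \<le> 2 * (x \<bullet> x) + 2 * (u \<bullet> u)"
proof -
  have "(x + u) \<bullet> (x + u) = x \<bullet> x + 2 * (x \<bullet> u) + u \<bullet> u"
    using assms by (simp add: scalar_prod_add_distrib[of _ n] add_scalar_prod_distrib[of _ n] comm_scalar_prod[of u n x])
  moreover have "0 \<le> (x + (-1) \<cdot>\<^sub>v u) \<bullet> (x + (-1) \<cdot>\<^sub>v u)" by (rule scalar_prod_self_nonneg)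
  then have "0 \<le> x \<bullet> x - 2 * (x \<bullet> u) + u \<bullet> u"
    using assms by (simp add: scalar_prod_add_distrib[of _ n] add_scalar_prod_distrib[of _ n] comm_scalar_prod[of u n x])
  ultimately show ?thesis by linarith
qed

lemma sq_norm_add_sq_le:
  fixes x u :: "real vec"
  assumes "x \<in> carrier_vec n" "u \<in> carrier_vec n"
  shows "((x + u) \<bullet> (x + u))\<^sup>2 \<le> 8 * (x \<bullet> x)\<^sup>2 + 8 * (u \<bullet> u)\<^sup>2"
proof -
  have "((x + u) \<bullet> (x + u))\<^sup>2 \<le> (2 * (x \<bullet> x) + 2 * (u \<bullet> u))\<^sup>2"
    using sq_norm_add_le[OF assms] by (intro power_mono scalar_prod_self_nonneg)
  also have "\<dots> \<le> 8 * (x \<bullet> x)\<^sup>2 + 8 * (u \<bullet> u)\<^sup>2"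
    using zero_le_power2[of "x \<bullet> x - u \<bullet> u"] by (simp add: power2_eq_square algebra_simps)
  finally show ?thesis .
qed

text \<open>A positive function with values in \<open>[a, b]\<close> cannot increase by more than the factor \<open>b / a\<close> along
  the unit vector in the direction of its logarithmic gradient.\<close>

lemma log_gradient_bound:
  assumes \<psi>: "bounded_measurable n a b \<psi>" and a: "0 < a" and x: "x \<in> carrier_vec n" and v: "v \<in> carrier_vec n"
    and L: "0 \<le> L" and exp: "\<And>z. z \<in> carrier_vec n \<Longrightarrow> \<bar>ln (\<psi> (x + z)) - ln (\<psi> x) - v \<bullet> z\<bar> \<le> L * (z \<bullet> z)"
  shows "v \<bullet> v \<le> (ln b - ln a + L)\<^sup>2"
proof (cases "v \<bullet> v = 0")
  case True
  then show ?thesis by simp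
next
  case False
  then have nv: "0 < vnorm v" using scalar_prod_self_nonneg[of v] by (simp add: vnorm_def)
  define z where "z = (1 / vnorm v) \<cdot>\<^sub>v v"
  have z: "z \<in> carrier_vec n" using v by (simp add: z_def)
  have "vnorm z = 1" using nv by (simp add: z_def vnorm_smult)
  then have "z \<bullet> z = 1" using vnorm_sq[of z] by simp
  moreover have "v \<bullet> z = vnorm v"
    using v nv vnorm_sq[of v] by (simp add: z_def power2_eq_square field_simps)
  moreover have xz: "x + z \<in> carrier_vec n" using x z by simp
  then have "ln (\<psi> (x + z)) \<le> ln b" "ln a \<le> ln (\<psi> x)"
    using bounded_measurableD(2,3)[OF \<psi> xz] bounded_measurableD(2)[OF \<psi> x] a by auto
  ultimately have "vnorm v \<le> ln b - ln a + L" using exp[OF z] by simp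
  then have "(vnorm v)\<^sup>2 \<le> (ln b - ln a + L)\<^sup>2" by (intro power_mono) auto
  then show ?thesis by (simp add: vnorm_sq)
qed

text \<open>Over a short time \<open>h\<close> the logarithm of a smooth function is replaced by its first order
  expansion.  The linear part is absorbed by the translation \<open>u = sqrt h v\<close> of the noise, and what is
  left is the expectation of \<open>exp \<rho>\<close> with \<open>\<rho> = O (h)\<close>, which equals \<open>exp (E \<rho>)\<close> up to a factor
  \<open>exp (O (h\<^sup>2))\<close>.\<close>

lemma heat_real_step_upper:
  assumes \<psi>: "bounded_measurable n a b \<psi>" and a: "0 < a" and x: "x \<in> carrier_vec n" and v: "v \<in> carrier_vec n"
    and L: "0 \<le> L" and taylor: "\<And>z. z \<in> carrier_vec n \<Longrightarrow> \<bar>ln (\<psi> (x + z)) - ln (\<psi> x) - v \<bullet> z\<bar> \<le> L * (z \<bullet> z)"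
    and h: "0 < h" "h \<le> 1"
  defines "u \<equiv> sqrt h \<cdot>\<^sub>v v"
  defines "\<rho> \<equiv> (\<lambda>\<xi>. ln (\<psi> (x + sqrt h \<cdot>\<^sub>v (\<xi> + u))) - ln (\<psi> x) - u \<bullet> (\<xi> + u))"
  shows "integrable (std_gauss n) \<rho>"
    and "heat_real n h \<psi> x \<le> \<psi> x * exp ((u \<bullet> u) / 2 + (\<integral>\<xi>. \<rho> \<xi> \<partial>std_gauss n) + step_const n a b L * h\<^sup>2)"
proof -
  have u: "u \<in> carrier_vec n" using v by (simp add: u_def)
  have \<psi>m: "\<psi> \<in> borel_measurable (lborel_vec n)" by (rule bounded_measurableD(1)[OF \<psi>])
  have \<psi>pos: "0 < \<psi> y" if "y \<in> carrier_vec n" for y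
    using bounded_measurableD(2)[OF \<psi> that] a by simp
  have b: "0 < b" using \<psi>pos[OF x] bounded_measurableD(3)[OF \<psi> x] by simp
  have carr: "x + sqrt h \<cdot>\<^sub>v (\<xi> + u) \<in> carrier_vec n" if "\<xi> \<in> carrier_vec n" for \<xi> using x u that by simp
  define F where "F = (\<lambda>\<xi>. \<psi> (x + sqrt h \<cdot>\<^sub>v \<xi>))"
  have Fi: "integrable (std_gauss n) F" unfolding F_def by (rule integrable_heat_real[OF \<psi> x])
  then have Fm: "F \<in> borel_measurable (lborel_vec n)" using borel_measurable_integrable[of "std_gauss n" F] by simp
  have Fum: "(\<lambda>\<xi>. F (\<xi> + u)) \<in> borel_measurable (lborel_vec n)" by (rule measurable_compose_translate[OF u Fm])
  have um: "(\<lambda>\<xi>. u \<bullet> (\<xi> + u)) \<in> borel_measurable (lborel_vec n)"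
    by (rule measurable_compose_translate[OF u measurable_scalar_prod_const[OF u]])
  have \<rho>m: "\<rho> \<in> borel_measurable (lborel_vec n)"
    unfolding \<rho>_def using Fum um by (simp add: F_def)
  have sqm: "(\<lambda>\<xi>. (\<xi> + u) \<bullet> (\<xi> + u)) \<in> borel_measurable (lborel_vec n)"
    by (rule measurable_compose_translate[OF u measurable_sq_vec])
  have \<rho>b: "\<bar>\<rho> \<xi>\<bar> \<le> L * h * ((\<xi> + u) \<bullet> (\<xi> + u))" if \<xi>: "\<xi> \<in> carrier_vec n" for \<xi>
  proof -
    have e1: "v \<bullet> (sqrt h \<cdot>\<^sub>v (\<xi> + u)) = u \<bullet> (\<xi> + u)" using u v \<xi> by (simp add: u_def)
    have e2: "(sqrt h \<cdot>\<^sub>v (\<xi> + u)) \<bullet> (sqrt h \<cdot>\<^sub>v (\<xi> + u)) = h * ((\<xi> + u) \<bullet> (\<xi> + u))"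
      using u \<xi> h by (simp flip: mult.assoc)
    have "sqrt h \<cdot>\<^sub>v (\<xi> + u) \<in> carrier_vec n" using u \<xi> by simp
    from taylor[OF this] show ?thesis unfolding \<rho>_def e1 e2 by (simp only: mult.assoc)
  qed
  have sqi: "integrable (std_gauss n) (\<lambda>\<xi>. L * h * (2 * (\<xi> \<bullet> \<xi>) + 2 * (u \<bullet> u)))"
    using integrable_second_moment by simp
  have Lh: "0 \<le> L * h" using L h by simp
  have "\<bar>\<rho> \<xi>\<bar> \<le> L * h * (2 * (\<xi> \<bullet> \<xi>) + 2 * (u \<bullet> u))" if \<xi>: "\<xi> \<in> carrier_vec n" for \<xi>
    using \<rho>b[OF \<xi>] mult_left_mono[OF sq_norm_add_le[OF \<xi> u] Lh] by linarith
  then show \<rho>i: "integrable (std_gauss n) \<rho>"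
    using \<rho>m by (intro integrable_std_gauss_dominated[OF sqi])
  have weight: "exp (- (u \<bullet> \<xi>) - (u \<bullet> u) / 2) * F (\<xi> + u) = \<psi> x * exp ((u \<bullet> u) / 2) * exp (\<rho> \<xi>)"
    if \<xi>: "\<xi> \<in> carrier_vec n" for \<xi>
  proof -
    have "F (\<xi> + u) = exp (ln (\<psi> (x + sqrt h \<cdot>\<^sub>v (\<xi> + u))))" using \<psi>pos[OF carr[OF \<xi>]] by (simp add: F_def)
    also have "\<dots> = exp (ln (\<psi> x) + (u \<bullet> \<xi> + u \<bullet> u) + \<rho> \<xi>)"
      using u \<xi> by (simp add: \<rho>_def scalar_prod_add_distrib[of _ n])
    also have "\<dots> = \<psi> x * exp (u \<bullet> \<xi> + u \<bullet> u + \<rho> \<xi>)" using \<psi>pos[OF x] by (simp add: exp_add)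
    finally have "exp (- (u \<bullet> \<xi>) - (u \<bullet> u) / 2) * F (\<xi> + u) =
        \<psi> x * (exp (- (u \<bullet> \<xi>) - (u \<bullet> u) / 2) * exp (u \<bullet> \<xi> + u \<bullet> u + \<rho> \<xi>))" by simp
    also have "exp (- (u \<bullet> \<xi>) - (u \<bullet> u) / 2) * exp (u \<bullet> \<xi> + u \<bullet> u + \<rho> \<xi>) = exp ((u \<bullet> u) / 2) * exp (\<rho> \<xi>)"
      unfolding mult_exp_exp by (rule arg_cong[where f = exp]) simp
    finally show ?thesis by simp
  qed
  have Fpos: "0 \<le> F \<xi>" if "\<xi> \<in> carrier_vec n" for \<xi>
    using \<psi>pos[of "x + sqrt h \<cdot>\<^sub>v \<xi>"] x that by (simp add: F_def less_imp_le)
  define k where "k = \<psi> x * exp ((u \<bullet> u) / 2)"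
  have k: "0 < k" using \<psi>pos[OF x] by (simp add: k_def)
  have CM: "has_bochner_integral (std_gauss n) (\<lambda>\<xi>. exp (- (u \<bullet> \<xi>) - (u \<bullet> u) / 2) * F (\<xi> + u)) (heat_real n h \<psi> x)"
    using gauss_translate[OF Fi u Fpos] by (simp add: heat_real_def F_def)
  have "has_bochner_integral (std_gauss n) (\<lambda>\<xi>. exp (- (u \<bullet> \<xi>) - (u \<bullet> u) / 2) * F (\<xi> + u)) (heat_real n h \<psi> x) =
      has_bochner_integral (std_gauss n) (\<lambda>\<xi>. k * exp (\<rho> \<xi>)) (heat_real n h \<psi> x)"
    by (rule has_bochner_integral_cong) (simp_all add: weight k_def)
  then have kexp: "has_bochner_integral (std_gauss n) (\<lambda>\<xi>. k * exp (\<rho> \<xi>)) (heat_real n h \<psi> x)"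
    using CM by blast
  then have ei: "integrable (std_gauss n) (\<lambda>\<xi>. exp (\<rho> \<xi>))"
    using k by (simp add: has_bochner_integral_iff)
  have heat: "heat_real n h \<psi> x = k * (\<integral>\<xi>. exp (\<rho> \<xi>) \<partial>std_gauss n)"
    using kexp by (simp add: has_bochner_integral_iff)
  define Q where "Q = (\<lambda>\<xi>. exp (- (u \<bullet> \<xi>) - (u \<bullet> u) / 2) * ((\<xi> + u) \<bullet> (\<xi> + u))\<^sup>2)"
  have Qi: "has_bochner_integral (std_gauss n) Q (gauss_fourth_moment n)"
    unfolding Q_def gauss_fourth_moment_def
    by (rule gauss_translate[OF integrable_fourth_moment u]) simp
  define B where "B = (\<lambda>\<xi>. 1 + \<rho> \<xi> + (L * h)\<^sup>2 * (8 * (\<xi> \<bullet> \<xi>)\<^sup>2 + 8 * (u \<bullet> u)\<^sup>2) + (L * h)\<^sup>2 * (b / a) * Q \<xi>)"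
  have Bi: "integrable (std_gauss n) B"
    unfolding B_def using \<rho>i integrable_fourth_moment Qi by (simp add: has_bochner_integral_iff)
  have eB: "exp (\<rho> \<xi>) \<le> B \<xi>" if \<xi>: "\<xi> \<in> carrier_vec n" for \<xi>
  proof -
    let ?N = "(\<xi> + u) \<bullet> (\<xi> + u)"
    have r2: "(\<rho> \<xi>)\<^sup>2 \<le> (L * h)\<^sup>2 * ?N\<^sup>2"
      using order_trans[OF \<rho>b[OF \<xi>] abs_ge_self] unfolding power_mult_distrib[symmetric]
      by (rule abs_le_square_iff[THEN iffD1])
    have "F (\<xi> + u) \<le> b" using bounded_measurableD(3)[OF \<psi> carr[OF \<xi>]] by (simp add: F_def)
    then have "\<psi> x * exp ((u \<bullet> u) / 2) * exp (\<rho> \<xi>) \<le> exp (- (u \<bullet> \<xi>) - (u \<bullet> u) / 2) * b"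
      unfolding weight[OF \<xi>, symmetric] by (intro mult_left_mono) auto
    moreover have "a * exp (\<rho> \<xi>) \<le> \<psi> x * exp ((u \<bullet> u) / 2) * exp (\<rho> \<xi>)"
    proof (intro mult_right_mono)
      have "a * 1 \<le> \<psi> x * exp ((u \<bullet> u) / 2)"
        using bounded_measurableD(2)[OF \<psi> x] \<psi>pos[OF x] scalar_prod_self_nonneg[of u] a
        by (intro mult_mono) auto
      then show "a \<le> \<psi> x * exp ((u \<bullet> u) / 2)" by simp
    qed simp
    ultimately have "a * exp (\<rho> \<xi>) \<le> exp (- (u \<bullet> \<xi>) - (u \<bullet> u) / 2) * b" by linarith
    then have e: "exp (\<rho> \<xi>) \<le> (b / a) * exp (- (u \<bullet> \<xi>) - (u \<bullet> u) / 2)"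
      using a by (simp add: pos_le_divide_eq mult.commute)
    have "(\<rho> \<xi>)\<^sup>2 * exp (\<rho> \<xi>) \<le> ((L * h)\<^sup>2 * ?N\<^sup>2) * ((b / a) * exp (- (u \<bullet> \<xi>) - (u \<bullet> u) / 2))"
      using r2 e by (intro mult_mono) auto
    also have "\<dots> = (L * h)\<^sup>2 * (b / a) * Q \<xi>" by (simp add: Q_def)
    finally have t1: "(\<rho> \<xi>)\<^sup>2 * exp (\<rho> \<xi>) \<le> (L * h)\<^sup>2 * (b / a) * Q \<xi>" .
    have t2: "(\<rho> \<xi>)\<^sup>2 \<le> (L * h)\<^sup>2 * (8 * (\<xi> \<bullet> \<xi>)\<^sup>2 + 8 * (u \<bullet> u)\<^sup>2)"
      by (rule order_trans[OF r2 mult_left_mono[OF sq_norm_add_sq_le[OF \<xi> u]]]) simp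
    have "exp (\<rho> \<xi>) - 1 - \<rho> \<xi> \<le> (\<rho> \<xi>)\<^sup>2 + (\<rho> \<xi>)\<^sup>2 * exp (\<rho> \<xi>)"
      using exp_remainder_bound[of "\<rho> \<xi>"] by (simp add: distrib_left abs_le_iff)
    then show ?thesis unfolding B_def using t1 t2 by linarith
  qed
  have "(\<integral>\<xi>. exp (\<rho> \<xi>) \<partial>std_gauss n) \<le> (\<integral>\<xi>. B \<xi> \<partial>std_gauss n)"
    using ei Bi eB by (rule integral_std_gauss_mono)
  also have "\<dots> = 1 + (\<integral>\<xi>. \<rho> \<xi> \<partial>std_gauss n) + (L * h)\<^sup>2 * (8 * gauss_fourth_moment n + 8 * (u \<bullet> u)\<^sup>2) +
      (L * h)\<^sup>2 * (b / a) * gauss_fourth_moment n"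
    unfolding B_def using \<rho>i integrable_fourth_moment Qi
    by (simp add: has_bochner_integral_iff gauss_fourth_moment_def)
  also have "\<dots> \<le> 1 + (\<integral>\<xi>. \<rho> \<xi> \<partial>std_gauss n) + step_const n a b L * h\<^sup>2"
  proof -
    have "u \<bullet> u = h * (v \<bullet> v)" using v h by (simp add: u_def flip: mult.assoc)
    also have "\<dots> \<le> 1 * (v \<bullet> v)" using h scalar_prod_self_nonneg by (intro mult_right_mono) auto
    also have "1 * (v \<bullet> v) \<le> (ln b - ln a + L)\<^sup>2"
      using log_gradient_bound[OF \<psi> a x v L taylor] by simp
    finally have "(u \<bullet> u)\<^sup>2 \<le> ((ln b - ln a + L)\<^sup>2)\<^sup>2" by (intro power_mono scalar_prod_self_nonneg)
    then have "(u \<bullet> u)\<^sup>2 \<le> (ln b - ln a + L) ^ 4" by simp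
    then have "(L * h)\<^sup>2 * (8 * gauss_fourth_moment n + 8 * (u \<bullet> u)\<^sup>2) \<le>
        (L * h)\<^sup>2 * (8 * gauss_fourth_moment n + 8 * (ln b - ln a + L) ^ 4)"
      by (intro mult_left_mono) auto
    then show ?thesis by (simp add: step_const_def power_mult_distrib algebra_simps)
  qed
  also have "\<dots> \<le> exp ((\<integral>\<xi>. \<rho> \<xi> \<partial>std_gauss n) + step_const n a b L * h\<^sup>2)"
    using exp_ge_add_one_self[of "(\<integral>\<xi>. \<rho> \<xi> \<partial>std_gauss n) + step_const n a b L * h\<^sup>2"] by linarith
  finally have "k * (\<integral>\<xi>. exp (\<rho> \<xi>) \<partial>std_gauss n) \<le>
      k * exp ((\<integral>\<xi>. \<rho> \<xi> \<partial>std_gauss n) + step_const n a b L * h\<^sup>2)"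
    using k by (intro mult_left_mono) auto
  then show "heat_real n h \<psi> x \<le> \<psi> x * exp ((u \<bullet> u) / 2 + (\<integral>\<xi>. \<rho> \<xi> \<partial>std_gauss n) + step_const n a b L * h\<^sup>2)"
    unfolding heat k_def by (simp add: exp_add mult.assoc)
qed

text \<open>Jensen's inequality, from the tangent of the exponential at the mean.\<close>

lemma exp_integral_le_nn_integral:
  assumes Y: "integrable (std_gauss n) Y"
  shows "ennreal (exp (\<integral>\<xi>. Y \<xi> \<partial>std_gauss n)) \<le> (\<integral>\<^sup>+\<xi>. ennreal (exp (Y \<xi>)) \<partial>std_gauss n)"
proof -
  define m where "m = (\<integral>\<xi>. Y \<xi> \<partial>std_gauss n)"
  define f where "f = (\<lambda>\<xi>. exp m * (1 + (Y \<xi> - m)))"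
  have fi: "integrable (std_gauss n) f" unfolding f_def using Y by simp
  have "exp m = (\<integral>\<xi>. f \<xi> \<partial>std_gauss n)" unfolding f_def using Y by (simp add: m_def)
  also have "\<dots> \<le> (\<integral>\<xi>. max 0 (f \<xi>) \<partial>std_gauss n)" using fi by (intro integral_mono) auto
  finally have "ennreal (exp m) \<le> ennreal (\<integral>\<xi>. max 0 (f \<xi>) \<partial>std_gauss n)" by (rule ennreal_leI)
  also have "\<dots> = (\<integral>\<^sup>+\<xi>. ennreal (max 0 (f \<xi>)) \<partial>std_gauss n)"
    using fi by (intro nn_integral_eq_integral[symmetric]) auto
  also have "\<dots> \<le> (\<integral>\<^sup>+\<xi>. ennreal (exp (Y \<xi>)) \<partial>std_gauss n)"
  proof (intro nn_integral_mono ennreal_leI)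
    fix \<xi>
    have "exp m * (1 + (Y \<xi> - m)) \<le> exp m * exp (Y \<xi> - m)"
      using exp_ge_add_one_self[of "Y \<xi> - m"] by (intro mult_left_mono) auto
    then show "max 0 (f \<xi>) \<le> exp (Y \<xi>)" by (simp add: f_def exp_diff)
  qed
  finally show ?thesis by (simp add: m_def)
qed

section \<open>The heat flow along a frame of projections\<close>

lemma symmetric_mat_scalar_prod:
  fixes M :: "real mat"
  assumes "M \<in> carrier_mat n n" "M\<^sup>T = M" "x \<in> carrier_vec n" "y \<in> carrier_vec n"
  shows "(M *\<^sub>v x) \<bullet> y = x \<bullet> (M *\<^sub>v y)"
  using transpose_vec_mult_scalar[OF assms(1,4,3)] assms(2) by simp

lemma scalar_prod_vec_sum:
  fixes Y :: "nat \<Rightarrow> real vec"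
  assumes "y \<in> carrier_vec n" "\<And>i. i < m \<Longrightarrow> Y i \<in> carrier_vec n"
  shows "vec n (\<lambda>j. \<Sum>i<m. c i * Y i $ j) \<bullet> y = (\<Sum>i<m. c i * (Y i \<bullet> y))"
proof -
  have "vec n (\<lambda>j. \<Sum>i<m. c i * Y i $ j) \<bullet> y = (\<Sum>j<n. \<Sum>i<m. c i * Y i $ j * y $ j)"
    using assms by (simp add: scalar_prod_real[where n = n] sum_distrib_right)
  also have "\<dots> = (\<Sum>i<m. \<Sum>j<n. c i * Y i $ j * y $ j)" by (rule sum.swap)
  also have "\<dots> = (\<Sum>i<m. c i * (Y i \<bullet> y))"
    using assms by (simp add: scalar_prod_real[where n = n] sum_distrib_left mult.assoc)
  finally show ?thesis .
qed

text \<open>A resolution of the identity by weighted orthogonal projections, the normal form of a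
  Brascamp-Lieb datum with an extremising Gaussian.\<close>

locale projection_frame =
  fixes n m :: nat and c :: "nat \<Rightarrow> real" and E :: "nat \<Rightarrow> real mat"
  assumes E_carrier: "\<And>i. i < m \<Longrightarrow> E i \<in> carrier_mat n n"
    and E_sym: "\<And>i. i < m \<Longrightarrow> (E i)\<^sup>T = E i"
    and E_idem: "\<And>i. i < m \<Longrightarrow> E i * E i = E i"
    and c_pos: "\<And>i. i < m \<Longrightarrow> 0 < c i"
    and resolution: "\<And>x j. x \<in> carrier_vec n \<Longrightarrow> j < n \<Longrightarrow> (\<Sum>i<m. c i * (E i *\<^sub>v x) $ j) = x $ j"
begin

definition combine :: "(nat \<Rightarrow> real vec) \<Rightarrow> real vec" where
  "combine X = vec n (\<lambda>j. \<Sum>i<m. c i * (E i *\<^sub>v X i) $ j)"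

lemma combine_carrier [simp]: "combine X \<in> carrier_vec n"
  by (simp add: combine_def)

lemma E_vec_carrier [simp]: "i < m \<Longrightarrow> x \<in> carrier_vec n \<Longrightarrow> E i *\<^sub>v x \<in> carrier_vec n"
  using E_carrier by (rule mult_mat_vec_carrier)

lemma E_E_vec: "i < m \<Longrightarrow> x \<in> carrier_vec n \<Longrightarrow> E i *\<^sub>v (E i *\<^sub>v x) = E i *\<^sub>v x"
  using assoc_mult_mat_vec[OF E_carrier E_carrier, of i i x] E_idem by simp

lemma combine_const: "x \<in> carrier_vec n \<Longrightarrow> combine (\<lambda>_. x) = x"
  by (intro eq_vecI) (auto simp: combine_def resolution)

lemma combine_scalar_prod:
  assumes "y \<in> carrier_vec n" "\<And>i. i < m \<Longrightarrow> X i \<in> carrier_vec n"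
  shows "combine X \<bullet> y = (\<Sum>i<m. c i * (X i \<bullet> (E i *\<^sub>v y)))"
  unfolding combine_def using assms
  by (subst scalar_prod_vec_sum) (auto simp: symmetric_mat_scalar_prod[OF E_carrier E_sym])

text \<open>Orthogonal projections and the resolution of the identity make \<open>combine\<close> a contraction from the
  weighted direct sum.\<close>

lemma combine_contraction:
  assumes X: "\<And>i. i < m \<Longrightarrow> X i \<in> carrier_vec n"
  shows "combine X \<bullet> combine X \<le> (\<Sum>i<m. c i * (X i \<bullet> X i))"
proof -
  define w where "w = combine X"
  have w: "w \<in> carrier_vec n" by (simp add: w_def)
  have "0 \<le> c i * (X i \<bullet> X i - 2 * (X i \<bullet> (E i *\<^sub>v w)) + w \<bullet> (E i *\<^sub>v w))" if i: "i < m" for i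
  proof -
    let ?e = "E i *\<^sub>v w"
    have e: "?e \<in> carrier_vec n" using i w by simp
    have "0 \<le> (X i + (-1) \<cdot>\<^sub>v ?e) \<bullet> (X i + (-1) \<cdot>\<^sub>v ?e)" by (rule scalar_prod_self_nonneg)
    also have "\<dots> = X i \<bullet> X i - 2 * (X i \<bullet> ?e) + ?e \<bullet> ?e"
      using X[OF i] e
      by (simp add: scalar_prod_add_distrib[of _ n] add_scalar_prod_distrib[of _ n] comm_scalar_prod[of ?e n "X i"])
    also have "?e \<bullet> ?e = w \<bullet> ?e"
      using symmetric_mat_scalar_prod[OF E_carrier[OF i] E_sym[OF i] w e] E_E_vec[OF i w] by simp
    finally show ?thesis using c_pos[OF i] by simp
  qed
  then have "0 \<le> (\<Sum>i<m. c i * (X i \<bullet> X i - 2 * (X i \<bullet> (E i *\<^sub>v w)) + w \<bullet> (E i *\<^sub>v w)))"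
    by (intro sum_nonneg) auto
  also have "\<dots> = (\<Sum>i<m. c i * (X i \<bullet> X i)) - 2 * (\<Sum>i<m. c i * (X i \<bullet> (E i *\<^sub>v w))) + (\<Sum>i<m. c i * (w \<bullet> (E i *\<^sub>v w)))"
    by (simp add: sum.distrib sum_subtractf sum_distrib_left algebra_simps)
  also have "(\<Sum>i<m. c i * (X i \<bullet> (E i *\<^sub>v w))) = w \<bullet> w"
    using combine_scalar_prod[OF w X] by (simp add: w_def)
  also have "(\<Sum>i<m. c i * (w \<bullet> (E i *\<^sub>v w))) = w \<bullet> w"
    using combine_scalar_prod[OF w, of "\<lambda>_. w"] w by (simp add: combine_const)
  finally show ?thesis by (simp add: w_def)
qed

lemma combine_affine:
  assumes X: "\<And>i. i < m \<Longrightarrow> X i \<in> carrier_vec n" and U: "\<And>i. i < m \<Longrightarrow> U i \<in> carrier_vec n"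
    and \<xi>: "\<xi> \<in> carrier_vec n"
  shows "combine (\<lambda>i. X i + s \<cdot>\<^sub>v (\<xi> + U i)) = combine X + s \<cdot>\<^sub>v (\<xi> + combine U)"
proof (rule eq_vecI)
  fix j assume "j < dim_vec (combine X + s \<cdot>\<^sub>v (\<xi> + combine U))"
  then have j: "j < n" by (simp add: combine_def)
  have "(E i *\<^sub>v (X i + s \<cdot>\<^sub>v (\<xi> + U i))) $ j = (E i *\<^sub>v X i) $ j + s * ((E i *\<^sub>v \<xi>) $ j + (E i *\<^sub>v U i) $ j)"
    if i: "i < m" for i
  proof -
    have "E i *\<^sub>v (X i + s \<cdot>\<^sub>v (\<xi> + U i)) = E i *\<^sub>v X i + s \<cdot>\<^sub>v (E i *\<^sub>v \<xi> + E i *\<^sub>v U i)"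
      using X[OF i] U[OF i] \<xi> E_carrier[OF i]
      by (simp add: mult_add_distrib_mat_vec[of _ n n] mult_mat_vec[of _ n n])
    then show ?thesis using E_carrier[OF i] U[OF i] j by simp
  qed
  then have "combine (\<lambda>i. X i + s \<cdot>\<^sub>v (\<xi> + U i)) $ j =
      (\<Sum>i<m. c i * ((E i *\<^sub>v X i) $ j + s * ((E i *\<^sub>v \<xi>) $ j + (E i *\<^sub>v U i) $ j)))"
    using j by (simp add: combine_def)
  also have "\<dots> = (\<Sum>i<m. c i * (E i *\<^sub>v X i) $ j) + s * ((\<Sum>i<m. c i * (E i *\<^sub>v \<xi>) $ j) + (\<Sum>i<m. c i * (E i *\<^sub>v U i) $ j))"
    by (simp add: sum.distrib sum_distrib_left algebra_simps)
  also have "\<dots> = (combine X + s \<cdot>\<^sub>v (\<xi> + combine U)) $ j"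
    using j \<xi> by (simp add: resolution[OF \<xi> j]) (simp add: combine_def)
  finally show "combine (\<lambda>i. X i + s \<cdot>\<^sub>v (\<xi> + U i)) $ j = (combine X + s \<cdot>\<^sub>v (\<xi> + combine U)) $ j" .
qed (simp add: combine_def)

text \<open>The logarithm of an \<open>E i\<close>-invariant function does not vary along the kernel of \<open>E i\<close>, so that its
  gradient can be projected to the range of \<open>E i\<close>.  The projected gradients are the ones for which the
  translations of the noise combine to the right translation of \<open>\<phi>\<close>.\<close>

lemma log_smooth_projected:
  assumes L: "0 \<le> L" and smooth: "log_smooth n L \<psi>" and i: "i < m"
    and inv: "\<And>y. y \<in> carrier_vec n \<Longrightarrow> \<psi> (E i *\<^sub>v y) = \<psi> y" and x: "x \<in> carrier_vec n"
  obtains v where "v \<in> carrier_vec n" "E i *\<^sub>v v = v"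
    "\<And>z. z \<in> carrier_vec n \<Longrightarrow> \<bar>ln (\<psi> (x + z)) - ln (\<psi> x) - v \<bullet> z\<bar> \<le> L * (z \<bullet> z)"
proof -
  obtain v where v: "v \<in> carrier_vec n"
    and vz: "\<And>z. z \<in> carrier_vec n \<Longrightarrow> \<bar>ln (\<psi> (x + z)) - ln (\<psi> x) - v \<bullet> z\<bar> \<le> L * (z \<bullet> z)"
    using smooth x unfolding log_smooth_def by blast
  note Ei = E_carrier[OF i]
  show ?thesis
  proof (rule that[of "E i *\<^sub>v v"])
    fix z :: "real vec" assume z: "z \<in> carrier_vec n"
    have Ez: "E i *\<^sub>v z \<in> carrier_vec n" using i z by simp
    have "\<psi> (x + E i *\<^sub>v z) = \<psi> (E i *\<^sub>v (x + E i *\<^sub>v z))" using x Ez inv[of "x + E i *\<^sub>v z"] by simp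
    also have "E i *\<^sub>v (x + E i *\<^sub>v z) = E i *\<^sub>v (x + z)"
      using x z Ez Ei by (simp add: mult_add_distrib_mat_vec[of _ n n] E_E_vec[OF i])
    also have "\<psi> (E i *\<^sub>v (x + z)) = \<psi> (x + z)" using x z inv[of "x + z"] by simp
    finally have eq: "\<psi> (x + E i *\<^sub>v z) = \<psi> (x + z)" .
    have "(E i *\<^sub>v z) \<bullet> (E i *\<^sub>v z) \<le> z \<bullet> z"
    proof -
      have e: "(E i *\<^sub>v z) \<bullet> (E i *\<^sub>v z) = z \<bullet> (E i *\<^sub>v z)"
        using symmetric_mat_scalar_prod[OF Ei E_sym[OF i] z Ez] by (simp add: E_E_vec[OF i z])
      have "0 \<le> (z + (-1) \<cdot>\<^sub>v (E i *\<^sub>v z)) \<bullet> (z + (-1) \<cdot>\<^sub>v (E i *\<^sub>v z))" by (rule scalar_prod_self_nonneg)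
      also have "\<dots> = z \<bullet> z - 2 * (z \<bullet> (E i *\<^sub>v z)) + (E i *\<^sub>v z) \<bullet> (E i *\<^sub>v z)"
        using z Ez
        by (simp add: scalar_prod_add_distrib[of _ n] add_scalar_prod_distrib[of _ n] comm_scalar_prod[of "E i *\<^sub>v z" n z])
      finally show ?thesis using e by simp
    qed
    then have "L * ((E i *\<^sub>v z) \<bullet> (E i *\<^sub>v z)) \<le> L * (z \<bullet> z)" using L by (rule mult_left_mono)
    moreover have "(E i *\<^sub>v v) \<bullet> z = v \<bullet> (E i *\<^sub>v z)"
      by (rule symmetric_mat_scalar_prod[OF Ei E_sym[OF i] v z])
    ultimately show "\<bar>ln (\<psi> (x + z)) - ln (\<psi> x) - (E i *\<^sub>v v) \<bullet> z\<bar> \<le> L * (z \<bullet> z)"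
      using vz[OF Ez] by (simp add: eq)
  qed (use i v E_E_vec in auto)
qed

text \<open>One step of length \<open>h\<close> preserves the constraint up to a factor \<open>exp (O (h\<^sup>2))\<close>: the noise of \<open>\<phi>\<close>
  is translated by the combination \<open>w\<close> of the individual translations \<open>u i\<close>, and the cost \<open>w \<bullet> w\<close>
  of this translation is at most the weighted sum of the costs \<open>u i \<bullet> u i\<close>.\<close>

lemma constraint_step:
  assumes \<psi>: "\<And>i. i < m \<Longrightarrow> bounded_measurable n a b (\<psi> i)" and a: "0 < a" and L: "0 \<le> L"
    and smooth: "\<And>i. i < m \<Longrightarrow> log_smooth n L (\<psi> i)"
    and inv: "\<And>i y. i < m \<Longrightarrow> y \<in> carrier_vec n \<Longrightarrow> \<psi> i (E i *\<^sub>v y) = \<psi> i y"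
    and h: "0 < h" "h \<le> 1" and \<kappa>: "0 \<le> \<kappa>"
    and \<phi>: "\<phi> \<in> borel_measurable (lborel_vec n)"
    and constr: "\<And>X. (\<And>i. i < m \<Longrightarrow> X i \<in> carrier_vec n) \<Longrightarrow>
      ennreal (\<kappa> * (\<Prod>i<m. \<psi> i (X i) powr c i)) \<le> \<phi> (combine X)"
    and X: "\<And>i. i < m \<Longrightarrow> X i \<in> carrier_vec n"
  shows "ennreal (\<kappa> * exp (- ((\<Sum>i<m. c i) * step_const n a b L * h\<^sup>2)) *
    (\<Prod>i<m. heat_real n h (\<psi> i) (X i) powr c i)) \<le> heat n h \<phi> (combine X)"
proof -
  let ?C = "step_const n a b L"
  have "\<exists>v. v \<in> carrier_vec n \<and> E i *\<^sub>v v = v \<and>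
      (\<forall>z\<in>carrier_vec n. \<bar>ln (\<psi> i (X i + z)) - ln (\<psi> i (X i)) - v \<bullet> z\<bar> \<le> L * (z \<bullet> z))" if i: "i < m" for i
    using log_smooth_projected[OF L smooth[OF i] i inv[OF i] X[OF i]] by metis
  then obtain v where v: "\<And>i. i < m \<Longrightarrow> v i \<in> carrier_vec n" and Ev: "\<And>i. i < m \<Longrightarrow> E i *\<^sub>v v i = v i"
    and taylor: "\<And>i z. i < m \<Longrightarrow> z \<in> carrier_vec n \<Longrightarrow>
      \<bar>ln (\<psi> i (X i + z)) - ln (\<psi> i (X i)) - v i \<bullet> z\<bar> \<le> L * (z \<bullet> z)"
    by metis
  define u where "u = (\<lambda>i. sqrt h \<cdot>\<^sub>v v i)"
  have u: "u i \<in> carrier_vec n" if "i < m" for i using v[OF that] by (simp add: u_def)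
  have Eu: "E i *\<^sub>v u i = u i" if "i < m" for i
    using that E_carrier v by (simp add: u_def mult_mat_vec[of _ n n] Ev)
  define \<rho> where "\<rho> = (\<lambda>i \<xi>. ln (\<psi> i (X i + sqrt h \<cdot>\<^sub>v (\<xi> + u i))) - ln (\<psi> i (X i)) - u i \<bullet> (\<xi> + u i))"
  have \<rho>i: "integrable (std_gauss n) (\<rho> i)"
    and up: "heat_real n h (\<psi> i) (X i) \<le> \<psi> i (X i) * exp ((u i \<bullet> u i) / 2 + (\<integral>\<xi>. \<rho> i \<xi> \<partial>std_gauss n) + ?C * h\<^sup>2)"
    if i: "i < m" for i
    using heat_real_step_upper[OF \<psi>[OF i] a X[OF i] v[OF i] L taylor[OF i] h]
    by (simp_all add: \<rho>_def u_def)
  have \<psi>pos: "0 < \<psi> i y" if "i < m" "y \<in> carrier_vec n" for i y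
    using bounded_measurableD(2)[OF \<psi>[OF that(1)] that(2)] a by simp
  have hpos: "0 < heat_real n h (\<psi> i) (X i)" if "i < m" for i
    using heat_real_bounds(1)[OF \<psi>[OF that] X[OF that], of h] a by simp
  define w where "w = combine u"
  have w: "w \<in> carrier_vec n" by (simp add: w_def)
  define U where "U = (\<Sum>i<m. c i * (u i \<bullet> u i))"
  have wU: "w \<bullet> w \<le> U" unfolding w_def U_def by (rule combine_contraction[OF u])
  have w\<xi>: "w \<bullet> \<xi> = (\<Sum>i<m. c i * (u i \<bullet> \<xi>))" if \<xi>: "\<xi> \<in> carrier_vec n" for \<xi>
  proof -
    have "w \<bullet> \<xi> = (\<Sum>i<m. c i * (u i \<bullet> (E i *\<^sub>v \<xi>)))"
      unfolding w_def by (rule combine_scalar_prod[OF \<xi> u])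
    also have "\<dots> = (\<Sum>i<m. c i * (u i \<bullet> \<xi>))"
    proof (intro sum.cong refl)
      fix i assume "i \<in> {..<m}"
      then have i: "i < m" by simp
      show "c i * (u i \<bullet> (E i *\<^sub>v \<xi>)) = c i * (u i \<bullet> \<xi>)"
        using symmetric_mat_scalar_prod[OF E_carrier[OF i] E_sym[OF i] u[OF i] \<xi>] by (simp add: Eu[OF i])
    qed
    finally show ?thesis .
  qed
  define Y where "Y = (\<lambda>\<xi>. \<Sum>i<m. c i * \<rho> i \<xi>)"
  define J where "J = (\<Sum>i<m. c i * (\<integral>\<xi>. \<rho> i \<xi> \<partial>std_gauss n))"
  have Yi: "integrable (std_gauss n) Y" unfolding Y_def using \<rho>i by (intro Bochner_Integration.integrable_sum) auto
  have YJ: "(\<integral>\<xi>. Y \<xi> \<partial>std_gauss n) = J"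
    unfolding Y_def J_def using \<rho>i by (subst Bochner_Integration.integral_sum) auto
  define l where "l = (\<Sum>i<m. c i * ln (\<psi> i (X i)))"
  define k where "k = \<kappa> * exp (l + U / 2)"
  have k: "0 \<le> k" using \<kappa> by (simp add: k_def)
  have lower: "ennreal k * ennreal (exp (Y \<xi>)) \<le>
      ennreal (exp (- (w \<bullet> \<xi>) - (w \<bullet> w) / 2)) * \<phi> (combine X + sqrt h \<cdot>\<^sub>v (\<xi> + w))"
    if \<xi>: "\<xi> \<in> carrier_vec n" for \<xi>
  proof -
    define Z where "Z = (\<lambda>i. X i + sqrt h \<cdot>\<^sub>v (\<xi> + u i))"
    have Z: "Z i \<in> carrier_vec n" if "i < m" for i using X[OF that] u[OF that] \<xi> by (simp add: Z_def)
    have "(\<Prod>i<m. \<psi> i (Z i) powr c i) = (\<Prod>i<m. exp (c i * ln (\<psi> i (Z i))))"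
      using \<psi>pos[OF _ Z] by (intro prod.cong refl) (force simp: powr_def)
    also have "\<dots> = exp (\<Sum>i<m. c i * ln (\<psi> i (Z i)))" by (simp add: exp_sum)
    also have "(\<Sum>i<m. c i * ln (\<psi> i (Z i))) =
        (\<Sum>i<m. c i * ln (\<psi> i (X i)) + c i * (u i \<bullet> \<xi>) + c i * (u i \<bullet> u i) + c i * \<rho> i \<xi>)"
      using u \<xi> by (intro sum.cong refl)
        (simp add: \<rho>_def Z_def scalar_prod_add_distrib[of _ n] algebra_simps)
    also have "\<dots> = l + w \<bullet> \<xi> + U + Y \<xi>"
      by (simp add: sum.distrib l_def w\<xi>[OF \<xi>] U_def Y_def)
    finally have prodZ: "(\<Prod>i<m. \<psi> i (Z i) powr c i) = exp (l + w \<bullet> \<xi> + U + Y \<xi>)" .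
    have "k * exp (Y \<xi>) = \<kappa> * exp (l + U / 2 + Y \<xi>)" by (simp add: k_def exp_add)
    also have "\<dots> \<le> \<kappa> * exp (- (w \<bullet> \<xi>) - (w \<bullet> w) / 2 + (l + w \<bullet> \<xi> + U + Y \<xi>))"
      using \<kappa> wU by (intro mult_left_mono) (auto simp: field_simps)
    also have "\<dots> = exp (- (w \<bullet> \<xi>) - (w \<bullet> w) / 2) * (\<kappa> * (\<Prod>i<m. \<psi> i (Z i) powr c i))"
      unfolding prodZ exp_add[of "- (w \<bullet> \<xi>) - (w \<bullet> w) / 2"] by simp
    finally have "ennreal (k * exp (Y \<xi>)) \<le>
        ennreal (exp (- (w \<bullet> \<xi>) - (w \<bullet> w) / 2) * (\<kappa> * (\<Prod>i<m. \<psi> i (Z i) powr c i)))"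
      by (rule ennreal_leI)
    also have "\<dots> = ennreal (exp (- (w \<bullet> \<xi>) - (w \<bullet> w) / 2)) * ennreal (\<kappa> * (\<Prod>i<m. \<psi> i (Z i) powr c i))"
      by (rule ennreal_mult') simp
    also have "\<dots> \<le> ennreal (exp (- (w \<bullet> \<xi>) - (w \<bullet> w) / 2)) * \<phi> (combine Z)"
      by (intro mult_left_mono constr Z) auto
    also have "combine Z = combine X + sqrt h \<cdot>\<^sub>v (\<xi> + w)"
      unfolding Z_def w_def by (rule combine_affine[OF X u \<xi>])
    finally show ?thesis using k by (simp add: ennreal_mult)
  qed
  have "\<kappa> * exp (- ((\<Sum>i<m. c i) * ?C * h\<^sup>2)) * (\<Prod>i<m. heat_real n h (\<psi> i) (X i) powr c i) \<le> k * exp J"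
  proof -
    have "(\<Prod>i<m. heat_real n h (\<psi> i) (X i) powr c i) \<le>
        (\<Prod>i<m. exp (c i * (ln (\<psi> i (X i)) + (u i \<bullet> u i) / 2 + (\<integral>\<xi>. \<rho> i \<xi> \<partial>std_gauss n) + ?C * h\<^sup>2)))"
    proof (intro prod_mono conjI)
      fix i assume "i \<in> {..<m}"
      then have i: "i < m" by simp
      let ?y = "\<psi> i (X i) * exp ((u i \<bullet> u i) / 2 + (\<integral>\<xi>. \<rho> i \<xi> \<partial>std_gauss n) + ?C * h\<^sup>2)"
      have "heat_real n h (\<psi> i) (X i) powr c i \<le> ?y powr c i"
        using up[OF i] hpos[OF i] c_pos[OF i] by (intro powr_mono2) auto
      also have "?y powr c i = exp (c i * ln ?y)" using \<psi>pos[OF i X[OF i]] by (simp add: powr_def)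
      also have "ln ?y = ln (\<psi> i (X i)) + (u i \<bullet> u i) / 2 + (\<integral>\<xi>. \<rho> i \<xi> \<partial>std_gauss n) + ?C * h\<^sup>2"
        using \<psi>pos[OF i X[OF i]] by (simp add: ln_mult)
      finally show "heat_real n h (\<psi> i) (X i) powr c i \<le>
          exp (c i * (ln (\<psi> i (X i)) + (u i \<bullet> u i) / 2 + (\<integral>\<xi>. \<rho> i \<xi> \<partial>std_gauss n) + ?C * h\<^sup>2))" .
    qed simp
    also have "\<dots> = exp (\<Sum>i<m. c i * (ln (\<psi> i (X i)) + (u i \<bullet> u i) / 2 + (\<integral>\<xi>. \<rho> i \<xi> \<partial>std_gauss n) + ?C * h\<^sup>2))"
      by (simp add: exp_sum)
    also have "(\<Sum>i<m. c i * (ln (\<psi> i (X i)) + (u i \<bullet> u i) / 2 + (\<integral>\<xi>. \<rho> i \<xi> \<partial>std_gauss n) + ?C * h\<^sup>2)) =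
        l + U / 2 + J + (\<Sum>i<m. c i) * ?C * h\<^sup>2"
      by (simp add: l_def U_def J_def sum.distrib sum_distrib_left sum_distrib_right sum_divide_distrib algebra_simps)
    finally have "\<kappa> * exp (- ((\<Sum>i<m. c i) * ?C * h\<^sup>2)) * (\<Prod>i<m. heat_real n h (\<psi> i) (X i) powr c i) \<le>
        \<kappa> * exp (- ((\<Sum>i<m. c i) * ?C * h\<^sup>2)) * exp (l + U / 2 + J + (\<Sum>i<m. c i) * ?C * h\<^sup>2)"
      using \<kappa> by (intro mult_left_mono) auto
    also have "\<dots> = \<kappa> * exp (- ((\<Sum>i<m. c i) * ?C * h\<^sup>2) + (l + U / 2 + J + (\<Sum>i<m. c i) * ?C * h\<^sup>2))"
      by (simp only: mult_exp_exp mult.assoc)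
    also have "\<dots> = k * exp J" by (simp add: k_def exp_add)
    finally show ?thesis .
  qed
  then have "ennreal (\<kappa> * exp (- ((\<Sum>i<m. c i) * ?C * h\<^sup>2)) * (\<Prod>i<m. heat_real n h (\<psi> i) (X i) powr c i)) \<le>
      ennreal k * ennreal (exp J)"
    using k by (simp add: ennreal_leI flip: ennreal_mult)
  also have "\<dots> \<le> ennreal k * (\<integral>\<^sup>+\<xi>. ennreal (exp (Y \<xi>)) \<partial>std_gauss n)"
    using exp_integral_le_nn_integral[OF Yi] by (intro mult_left_mono) (auto simp: YJ)
  also have "\<dots> = (\<integral>\<^sup>+\<xi>. ennreal k * ennreal (exp (Y \<xi>)) \<partial>std_gauss n)"
    using borel_measurable_integrable[OF Yi] by (intro nn_integral_cmult[symmetric]) simp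
  also have "\<dots> \<le> (\<integral>\<^sup>+\<xi>. ennreal (exp (- (w \<bullet> \<xi>) - (w \<bullet> w) / 2)) * \<phi> (combine X + sqrt h \<cdot>\<^sub>v (\<xi> + w)) \<partial>std_gauss n)"
    using lower by (intro nn_integral_mono) simp
  also have "\<dots> = heat n h \<phi> (combine X)"
    unfolding heat_def
    by (rule nn_integral_std_gauss_translate[where F = "\<lambda>\<xi>. \<phi> (combine X + sqrt h \<cdot>\<^sub>v \<xi>)", symmetric])
      (use w measurable_compose_affine[OF combine_carrier \<phi>] in simp_all)
  finally show ?thesis .
qed

lemma heat_real_E:
  assumes i: "i < m" and inv: "\<And>y. y \<in> carrier_vec n \<Longrightarrow> g (E i *\<^sub>v y) = g y" and y: "y \<in> carrier_vec n"
  shows "heat_real n t g (E i *\<^sub>v y) = heat_real n t g y"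
  unfolding heat_real_def
proof (rule Bochner_Integration.integral_cong[OF refl])
  fix \<xi> assume "\<xi> \<in> space (std_gauss n)"
  then have \<xi>: "\<xi> \<in> carrier_vec n" by simp
  have Ey: "E i *\<^sub>v y \<in> carrier_vec n" using i y by simp
  have "g (E i *\<^sub>v y + sqrt t \<cdot>\<^sub>v \<xi>) = g (E i *\<^sub>v (E i *\<^sub>v y + sqrt t \<cdot>\<^sub>v \<xi>))"
    using Ey \<xi> by (simp add: inv)
  also have "E i *\<^sub>v (E i *\<^sub>v y + sqrt t \<cdot>\<^sub>v \<xi>) = E i *\<^sub>v (y + sqrt t \<cdot>\<^sub>v \<xi>)"
    using y \<xi> Ey E_carrier[OF i] by (simp add: mult_add_distrib_mat_vec[of _ n n] E_E_vec[OF i])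
  also have "g (E i *\<^sub>v (y + sqrt t \<cdot>\<^sub>v \<xi>)) = g (y + sqrt t \<cdot>\<^sub>v \<xi>)" using y \<xi> by (simp add: inv)
  finally show "g (E i *\<^sub>v y + sqrt t \<cdot>\<^sub>v \<xi>) = g (y + sqrt t \<cdot>\<^sub>v \<xi>)" .
qed

text \<open>The constraint is carried along the heat flow up to time \<open>T\<close>: in \<open>N\<close> steps of length \<open>T / N\<close> the
  total loss is a factor \<open>exp (O (1 / N))\<close>, because the smoothness constants of the evolved functions
  are uniform in time.\<close>

theorem constraint_heat_flow:
  assumes g: "\<And>i. i < m \<Longrightarrow> bounded_measurable n 0 b (g i)" and b: "0 \<le> b"
    and inv: "\<And>i y. i < m \<Longrightarrow> y \<in> carrier_vec n \<Longrightarrow> g i (E i *\<^sub>v y) = g i y"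
    and \<tau>: "0 < \<tau>" and \<delta>: "0 < \<delta>" and T: "0 < T"
    and \<phi>: "\<phi> \<in> borel_measurable (lborel_vec n)"
    and constr: "\<And>X. (\<And>i. i < m \<Longrightarrow> X i \<in> carrier_vec n) \<Longrightarrow>
      ennreal (\<Prod>i<m. (\<tau> + heat_real n \<delta> (g i) (X i)) powr c i) \<le> \<phi> (combine X)"
    and X: "\<And>i. i < m \<Longrightarrow> X i \<in> carrier_vec n"
  shows "ennreal (\<Prod>i<m. (\<tau> + heat_real n (\<delta> + T) (g i) (X i)) powr c i) \<le> heat n T \<phi> (combine X)"
proof -
  define L where "L = b * taylor_const n / (\<delta> * \<tau>) + (2 * b * taylor_const n)\<^sup>2 / (\<delta> * \<tau>\<^sup>2)"
  have L: "0 \<le> L" using b \<delta> \<tau> taylor_const_ge(1)[of n] by (simp add: L_def)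
  define C where "C = (\<Sum>i<m. c i) * step_const n \<tau> (\<tau> + b) L"
  define \<psi> where "\<psi> = (\<lambda>t i x. \<tau> + heat_real n t (g i) x)"
  define P where "P = (\<Prod>i<m. \<psi> (\<delta> + T) i (X i) powr c i)"
  have bnd: "bounded_measurable n \<tau> (\<tau> + b) (\<psi> t i)" if i: "i < m" for t i
    using bounded_measurable_heat_real[OF g[OF i], of t]
    by (auto simp: \<psi>_def bounded_measurable_def intro!: borel_measurable_add)
  have \<psi>heat: "heat_real n h (\<psi> t i) x = \<psi> (h + t) i x"
    if "i < m" "x \<in> carrier_vec n" "0 < h" "0 < t" for h t i x
  proof -
    have "heat_real n h (\<psi> t i) x = \<tau> + heat_real n h (heat_real n t (g i)) x"
      unfolding \<psi>_def by (rule heat_real_add_const[OF bounded_measurable_heat_real[OF g[OF that(1)]] that(2)]) simp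
    then show ?thesis using heat_real_heat_real[OF g[OF that(1)] that(2,3,4)] by (simp add: \<psi>_def)
  qed
  have main: "ennreal (exp (- (C * T\<^sup>2 / real N)) * P) \<le> heat n T \<phi> (combine X)" if N: "0 < N" "T \<le> real N" for N :: nat
  proof -
    \<comment> \<open>\<open>\<Phi> k\<close> is \<open>\<phi>\<close> after \<open>k\<close> steps; time zero is separate because the semigroup law \<open>heat_heat\<close> is for positive times\<close>
    define h where "h = T / real N"
    have h: "0 < h" "h \<le> 1" using T N by (auto simp: h_def)
    define \<Phi> where "\<Phi> = (\<lambda>k :: nat. if k = 0 then \<phi> else heat n (real k * h) \<phi>)"
    have \<Phi>m: "\<Phi> k \<in> borel_measurable (lborel_vec n)" for k
      using \<phi> measurable_heat[OF \<phi>] by (simp add: \<Phi>_def)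
    have \<Phi>heat: "heat n h (\<Phi> k) x = \<Phi> (Suc k) x" if "x \<in> carrier_vec n" for k x
    proof (cases "k = 0")
      case False
      then show ?thesis using heat_heat[OF \<phi> that h(1), of "real k * h"] h by (simp add: \<Phi>_def algebra_simps)
    qed (simp add: \<Phi>_def)
    define \<kappa> where "\<kappa> = exp (- (C * h\<^sup>2))"
    have step: "ennreal (\<kappa> ^ k * (\<Prod>i<m. \<psi> (\<delta> + real k * h) i (Z i) powr c i)) \<le> \<Phi> k (combine Z)"
      if "\<And>i. i < m \<Longrightarrow> Z i \<in> carrier_vec n" for k Z
      using that
    proof (induction k arbitrary: Z)
      case 0
      then show ?case using constr[of Z] by (simp add: \<Phi>_def \<psi>_def)
    next
      case (Suc k)
      let ?t = "\<delta> + real k * h"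
      have t: "0 < ?t" "\<delta> \<le> ?t" using \<delta> h by (auto intro: add_pos_nonneg)
      have "ennreal (\<kappa> ^ k * exp (- ((\<Sum>i<m. c i) * step_const n \<tau> (\<tau> + b) L * h\<^sup>2)) *
          (\<Prod>i<m. heat_real n h (\<psi> ?t i) (Z i) powr c i)) \<le> heat n h (\<Phi> k) (combine Z)"
      proof (rule constraint_step[OF bnd \<tau> L _ _ h _ \<Phi>m Suc.IH Suc.prems])
        show "log_smooth n L (\<psi> ?t i)" if "i < m" for i
          unfolding L_def \<psi>_def by (rule heat_real_log_smooth[OF g[OF that] \<tau> \<delta> t(2)])
        show "\<psi> ?t i (E i *\<^sub>v y) = \<psi> ?t i y" if "i < m" "y \<in> carrier_vec n" for i y
          using heat_real_E[of i "g i"] inv that by (simp add: \<psi>_def)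
        show "0 \<le> \<kappa> ^ k" by (simp add: \<kappa>_def)
      qed
      also have "heat n h (\<Phi> k) (combine Z) = \<Phi> (Suc k) (combine Z)" by (rule \<Phi>heat) simp
      also have "(\<Prod>i<m. heat_real n h (\<psi> ?t i) (Z i) powr c i) = (\<Prod>i<m. \<psi> (\<delta> + real (Suc k) * h) i (Z i) powr c i)"
      proof (intro prod.cong refl)
        fix i assume "i \<in> {..<m}"
        then show "heat_real n h (\<psi> ?t i) (Z i) powr c i = \<psi> (\<delta> + real (Suc k) * h) i (Z i) powr c i"
          using \<psi>heat[OF _ Suc.prems h(1) t(1), of i i] by (simp add: algebra_simps)
      qed
      finally show ?case by (simp add: C_def \<kappa>_def mult_ac)
    qed
    have "\<kappa> ^ N = exp (real N * (- (C * h\<^sup>2)))" unfolding \<kappa>_def by (rule exp_of_nat_mult[symmetric])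
    also have "real N * (- (C * h\<^sup>2)) = - (C * T\<^sup>2 / real N)"
      using N by (simp add: h_def power2_eq_square)
    finally have "\<kappa> ^ N = exp (- (C * T\<^sup>2 / real N))" .
    moreover have "real N * h = T" using N by (simp add: h_def)
    ultimately show ?thesis using step[where k = N and Z = X, OF X] N by (simp add: P_def \<Phi>_def)
  qed
  have "(\<lambda>N. exp (- (C * T\<^sup>2 / real N)) * P) \<longlonglongrightarrow> exp (- 0) * P"
    by (intro tendsto_mult tendsto_exp tendsto_minus tendsto_const lim_const_over_n)
  then have "(\<lambda>N. ennreal (exp (- (C * T\<^sup>2 / real N)) * P)) \<longlonglongrightarrow> ennreal (exp (- 0) * P)"
    by (rule tendsto_ennrealI)
  moreover have "\<forall>\<^sub>F N in sequentially. ennreal (exp (- (C * T\<^sup>2 / real N)) * P) \<le> heat n T \<phi> (combine X)"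
    using eventually_ge_at_top[of "nat \<lceil>T\<rceil> + 1"]
  proof eventually_elim
    case (elim N)
    then have "T \<le> real N" by linarith
    then show ?case using elim by (intro main) auto
  qed
  ultimately have "ennreal (exp (- 0) * P) \<le> heat n T \<phi> (combine X)"
    by (rule tendsto_upperbound) simp
  then show ?thesis by (simp add: P_def \<psi>_def)
qed

end

section \<open>Upper semicontinuous functions\<close>

definition vec_tendsto :: "nat \<Rightarrow> (nat \<Rightarrow> real vec) \<Rightarrow> real vec \<Rightarrow> bool" where
  "vec_tendsto n Z x \<longleftrightarrow> (\<forall>j<n. (\<lambda>k. Z k $ j) \<longlonglongrightarrow> x $ j)"

definition usc_vec :: "nat \<Rightarrow> (real vec \<Rightarrow> real) \<Rightarrow> bool" where
  "usc_vec n g \<longleftrightarrow> (\<forall>x\<in>carrier_vec n. \<forall>Z. (\<forall>k. Z k \<in> carrier_vec n) \<longrightarrow> vec_tendsto n Z x \<longrightarrow>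
     (\<forall>e>0. \<forall>\<^sub>F k in sequentially. g (Z k) < g x + e))"

lemma vnorm_diff_triangle:
  assumes "x \<in> carrier_vec n" "y \<in> carrier_vec n" "z \<in> carrier_vec n"
  shows "vnorm (x - z) \<le> vnorm (x - y) + vnorm (y - z)"
proof -
  have "x - z = (x - y) + (y - z)" using assms by (intro eq_vecI) auto
  then show ?thesis using vnorm_triangle[of "x - y" n "y - z"] assms by simp
qed

lemma vnorm_minus_commute:
  assumes "x \<in> carrier_vec n" "y \<in> carrier_vec n" shows "vnorm (x - y) = vnorm (y - x)"
proof -
  have "x - y = (-1) \<cdot>\<^sub>v (y - x)" using assms by (intro eq_vecI) auto
  then show ?thesis by (simp add: vnorm_smult)
qed

lemma vnorm_diff_self: "x \<in> carrier_vec n \<Longrightarrow> vnorm (x - x) = 0"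
  by (simp add: vnorm_def scalar_prod_real[where n = n])

lemma abs_index_le_vnorm:
  assumes "x \<in> carrier_vec n" "j < n" shows "\<bar>x $ j\<bar> \<le> vnorm x"
proof -
  have "(x $ j)\<^sup>2 \<le> (\<Sum>l<n. (x $ l)\<^sup>2)"
    using assms(2) by (intro member_le_sum) auto
  then show ?thesis
    using assms(1) real_le_rsqrt[of "\<bar>x $ j\<bar>"] by (simp add: vnorm_def scalar_prod_real[where n = n] power2_eq_square)
qed

lemma vec_tendsto_near:
  assumes X: "vec_tendsto n X x" and c: "\<And>k. X k \<in> carrier_vec n" "\<And>k. Z k \<in> carrier_vec n"
    and near: "(\<lambda>k. vnorm (X k - Z k)) \<longlonglongrightarrow> 0"
  shows "vec_tendsto n Z x"
  unfolding vec_tendsto_def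
proof (intro allI impI)
  fix j assume j: "j < n"
  have "(\<lambda>k. (X k - Z k) $ j) \<longlonglongrightarrow> 0"
    using abs_index_le_vnorm[OF minus_carrier_vec[OF c] j]
    by (intro Lim_null_comparison[OF _ near] always_eventually) simp
  then have "(\<lambda>k. X k $ j - (X k - Z k) $ j) \<longlonglongrightarrow> x $ j - 0"
    using X j by (intro tendsto_diff) (auto simp: vec_tendsto_def)
  moreover have "X k $ j - (X k - Z k) $ j = Z k $ j" for k
    using carrier_vecD[OF c(2), of k] j by simp
  ultimately show "(\<lambda>k. Z k $ j) \<longlonglongrightarrow> x $ j" by simp
qed

text \<open>Bolzano-Weierstrass for finitely many bounded coordinate sequences.\<close>

lemma bounded_coordinates_convergent_subsequence:
  fixes a :: "nat \<Rightarrow> nat \<Rightarrow> real"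
  assumes "\<And>k p. p < N \<Longrightarrow> \<bar>a k p\<bar> \<le> B"
  shows "\<exists>r l. strict_mono r \<and> (\<forall>p<N. (\<lambda>k. a (r k) p) \<longlonglongrightarrow> l p)"
  using assms
proof (induction N)
  case 0
  show ?case by (intro exI[of _ id]) (auto simp: strict_mono_def)
next
  case (Suc N)
  then obtain r l where r: "strict_mono r" "\<forall>p<N. (\<lambda>k. a (r k) p) \<longlonglongrightarrow> l p" by auto
  have "bounded (range (\<lambda>k. a (r k) N))"
    using Suc.prems by (intro boundedI[where B = B]) auto
  then obtain y q where q: "strict_mono q" "((\<lambda>k. a (r k) N) \<circ> q) \<longlonglongrightarrow> y"
    using bounded_imp_convergent_subsequence by blast
  show ?case
  proof (intro exI conjI allI impI)
    show "strict_mono (r \<circ> q)" using r(1) q(1) by (rule strict_mono_o)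
    fix p assume "p < Suc N"
    then show "(\<lambda>k. a ((r \<circ> q) k) p) \<longlonglongrightarrow> (if p = N then y else l p)"
      using q(2) LIMSEQ_subseq_LIMSEQ[OF _ q(1), of "\<lambda>k. a (r k) p" "l p"] r(2)
      by (auto simp: o_def less_Suc_eq)
  qed
qed

text \<open>Borel sets of vectors can be tested in the Polish space of all real sequences, of which the
  vectors of length \<open>n\<close> are the first \<open>n\<close> coordinates.\<close>

lemma measurable_extend_vec:
  "(\<lambda>x j. if j < n then x $ j else 0) \<in> borel_measurable (lborel_vec n)"
proof (rule measurable_coordinatewise_then_product)
  fix j show "(\<lambda>x. if j < n then x $ j else 0) \<in> borel_measurable (lborel_vec n)"
    by (cases "j < n") simp_all
qed

lemma borel_measurable_lborel_vecI:
  assumes "(\<lambda>\<omega> :: nat \<Rightarrow> real. F (vec n \<omega>)) \<in> borel_measurable borel"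
  shows "F \<in> borel_measurable (lborel_vec n)"
proof -
  have "(\<lambda>x. F (vec n (\<lambda>j. if j < n then x $ j else 0))) \<in> borel_measurable (lborel_vec n)"
    using measurable_compose[OF measurable_extend_vec assms] by simp
  moreover have "vec n (\<lambda>j. if j < n then x $ j else 0) = x" if "x \<in> carrier_vec n" for x :: "real vec"
    using that by auto
  ultimately show ?thesis by (subst measurable_cong[where g = "\<lambda>x. F (vec n (\<lambda>j. if j < n then x $ j else 0))"]) simp_all
qed

definition vec_lipschitz :: "nat \<Rightarrow> real \<Rightarrow> (real vec \<Rightarrow> real) \<Rightarrow> bool" where
  "vec_lipschitz n K F \<longleftrightarrow> (\<forall>x\<in>carrier_vec n. \<forall>y\<in>carrier_vec n. F x \<le> F y + K * vnorm (x - y))"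

lemma vec_lipschitz_abs:
  assumes "vec_lipschitz n K F" "x \<in> carrier_vec n" "y \<in> carrier_vec n"
  shows "\<bar>F x - F y\<bar> \<le> K * vnorm (x - y)"
proof -
  have "F x \<le> F y + K * vnorm (x - y)" "F y \<le> F x + K * vnorm (y - x)"
    using assms unfolding vec_lipschitz_def by blast+
  then show ?thesis using vnorm_minus_commute[OF assms(2,3)] by (simp add: abs_le_iff)
qed

lemma continuous_on_vec_lipschitz:
  assumes F: "vec_lipschitz n K F"
  shows "continuous_on UNIV (\<lambda>\<omega> :: nat \<Rightarrow> real. F (vec n \<omega>))"
proof (rule continuous_at_imp_continuous_on, rule ballI)
  fix \<omega> :: "nat \<Rightarrow> real"
  have dist_eq: "vnorm (vec n \<eta> - vec n \<omega>) = sqrt (\<Sum>j<n. (\<eta> j - \<omega> j)\<^sup>2)" for \<eta>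
    by (simp add: vnorm_def scalar_prod_real[where n = n] power2_eq_square)
  have "continuous_on UNIV (\<lambda>\<eta> :: nat \<Rightarrow> real. K * sqrt (\<Sum>j<n. (\<eta> j - \<omega> j)\<^sup>2))"
    by (intro continuous_intros continuous_on_product_coordinates)
  then have "((\<lambda>\<eta>. K * sqrt (\<Sum>j<n. (\<eta> j - \<omega> j)\<^sup>2)) \<longlongrightarrow> K * sqrt (\<Sum>j<n. (\<omega> j - \<omega> j)\<^sup>2)) (at \<omega>)"
    unfolding continuous_on_def by (rule bspec) simp
  then have lim: "((\<lambda>\<eta>. K * sqrt (\<Sum>j<n. (\<eta> j - \<omega> j)\<^sup>2)) \<longlongrightarrow> 0) (at \<omega>)" by simp
  have "((\<lambda>\<eta>. F (vec n \<eta>) - F (vec n \<omega>)) \<longlongrightarrow> 0) (at \<omega>)"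
    using vec_lipschitz_abs[OF F] by (intro Lim_null_comparison[OF _ lim] always_eventually) (simp flip: dist_eq)
  then show "isCont (\<lambda>\<omega>. F (vec n \<omega>)) \<omega>"
    unfolding isCont_def by (rule LIM_zero_cancel)
qed

lemma borel_measurable_vec_lipschitz:
  assumes "vec_lipschitz n K F" shows "F \<in> borel_measurable (lborel_vec n)"
  by (intro borel_measurable_lborel_vecI borel_measurable_continuous_onI continuous_on_vec_lipschitz[OF assms])

text \<open>The index set may be uncountable: a supremum of continuous functions is lower semicontinuous.\<close>

lemma borel_measurable_SUP_continuous:
  fixes F :: "'i \<Rightarrow> real vec \<Rightarrow> ennreal"
  assumes "\<And>i. i \<in> I \<Longrightarrow> continuous_on UNIV (\<lambda>\<omega> :: nat \<Rightarrow> real. F i (vec n \<omega>))"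
  shows "(\<lambda>x. SUP i\<in>I. F i x) \<in> borel_measurable (lborel_vec n)"
proof (intro borel_measurable_lborel_vecI borel_measurableI_greater)
  fix y
  have "{\<omega> \<in> space borel. y < (SUP i\<in>I. F i (vec n \<omega>))} = (\<Union>i\<in>I. {\<omega>. y < F i (vec n \<omega>)})"
    by (auto simp: less_SUP_iff)
  moreover have "open (\<Union>i\<in>I. {\<omega>. y < F i (vec n \<omega>)})"
    using assms by (intro open_UN ballI open_Collect_less) (auto intro: continuous_on_const)
  ultimately show "{\<omega> \<in> space borel. y < (SUP i\<in>I. F i (vec n \<omega>))} \<in> sets borel" by simp
qed

lemma carrier_vec_nonempty: "(carrier_vec n :: real vec set) \<noteq> {}"
  using zero_carrier_vec[of n] by blast

text \<open>The smallest \<open>K\<close>-Lipschitz function above \<open>g\<close>.  As \<open>K\<close> grows it decreases to \<open>g\<close> when \<open>g\<close> is bounded and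
  upper semicontinuous; what is used of this is that a near-maximiser \<open>z\<close> lies within \<open>O (1 / K)\<close> of \<open>x\<close>.\<close>

definition lip_env :: "nat \<Rightarrow> real \<Rightarrow> (real vec \<Rightarrow> real) \<Rightarrow> real vec \<Rightarrow> real" where
  "lip_env n K g x = (SUP z\<in>carrier_vec n. g z - K * vnorm (x - z))"

context
  fixes n :: nat and K M :: real and g :: "real vec \<Rightarrow> real"
  assumes K: "0 \<le> K" and g_le: "\<And>z. z \<in> carrier_vec n \<Longrightarrow> g z \<le> M"
begin

lemma lip_env_term_le: "z \<in> carrier_vec n \<Longrightarrow> g z - K * vnorm (x - z) \<le> M"
  using g_le[of z] K mult_nonneg_nonneg[OF K vnorm_nonneg[of "x - z"]] by linarith

lemma lip_env_bdd: "bdd_above ((\<lambda>z. g z - K * vnorm (x - z)) ` carrier_vec n)"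
  using lip_env_term_le by (intro bdd_aboveI2)

lemma lip_env_ge_term: "z \<in> carrier_vec n \<Longrightarrow> g z - K * vnorm (x - z) \<le> lip_env n K g x"
  unfolding lip_env_def by (rule cSUP_upper[OF _ lip_env_bdd])

lemma lip_env_ge: "x \<in> carrier_vec n \<Longrightarrow> g x \<le> lip_env n K g x"
  using lip_env_ge_term[of x x] vnorm_diff_self[of x n] by (simp only: mult_zero_right diff_zero)

lemma lip_env_leI: "(\<And>z. z \<in> carrier_vec n \<Longrightarrow> g z - K * vnorm (x - z) \<le> B) \<Longrightarrow> lip_env n K g x \<le> B"
  unfolding lip_env_def by (intro cSUP_least carrier_vec_nonempty)

lemma lip_env_near:
  assumes "0 < e" obtains z where "z \<in> carrier_vec n" "lip_env n K g x - e < g z - K * vnorm (x - z)"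
proof -
  have "\<exists>z\<in>carrier_vec n. lip_env n K g x - e < g z - K * vnorm (x - z)"
    using assms carrier_vec_nonempty[of n]
    by (subst less_cSUP_iff[OF _ lip_env_bdd, symmetric]) (auto simp: lip_env_def[symmetric])
  then show ?thesis using that by blast
qed

lemma lip_env_lipschitz: "vec_lipschitz n K (lip_env n K g)"
  unfolding vec_lipschitz_def
proof (intro ballI)
  fix x y :: "real vec" assume x: "x \<in> carrier_vec n" and y: "y \<in> carrier_vec n"
  show "lip_env n K g x \<le> lip_env n K g y + K * vnorm (x - y)"
  proof (rule lip_env_leI)
    fix z :: "real vec" assume z: "z \<in> carrier_vec n"
    have "K * vnorm (y - z) \<le> K * (vnorm (x - y) + vnorm (x - z))"
      using vnorm_diff_triangle[OF y x z] vnorm_minus_commute[OF x y] K by (intro mult_left_mono) auto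
    then show "g z - K * vnorm (x - z) \<le> lip_env n K g y + K * vnorm (x - y)"
      using lip_env_ge_term[OF z, of y] by (simp add: distrib_left)
  qed
qed

end

section \<open>The Gaussian inequality for upper semicontinuous functions\<close>

lemma heat_real_lipschitz:
  assumes F: "vec_lipschitz n K F" and b: "bounded_measurable n a b F"
  shows "vec_lipschitz n K (heat_real n t F)"
  unfolding vec_lipschitz_def
proof (intro ballI)
  fix x y :: "real vec" assume x: "x \<in> carrier_vec n" and y: "y \<in> carrier_vec n"
  have "heat_real n t F x \<le> (\<integral>\<xi>. F (y + sqrt t \<cdot>\<^sub>v \<xi>) + K * vnorm (x - y) \<partial>std_gauss n)"
    unfolding heat_real_def
  proof (rule integral_std_gauss_mono)
    fix \<xi> :: "real vec" assume \<xi>: "\<xi> \<in> carrier_vec n"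
    have "(x + sqrt t \<cdot>\<^sub>v \<xi>) - (y + sqrt t \<cdot>\<^sub>v \<xi>) = x - y" using x y \<xi> by (intro eq_vecI) auto
    then show "F (x + sqrt t \<cdot>\<^sub>v \<xi>) \<le> F (y + sqrt t \<cdot>\<^sub>v \<xi>) + K * vnorm (x - y)"
      using F x y \<xi> unfolding vec_lipschitz_def by (metis add_carrier_vec smult_carrier_vec)
  qed (use integrable_heat_real[OF b x] integrable_heat_real[OF b y] in auto)
  also have "\<dots> = heat_real n t F y + K * vnorm (x - y)"
    using integrable_heat_real[OF b y, of "sqrt t"] by (simp add: heat_real_def)
  finally show "heat_real n t F x \<le> heat_real n t F y + K * vnorm (x - y)" .
qed

lemma heat_real_close:
  assumes F: "vec_lipschitz n K F" and b: "bounded_measurable n a b F" and K: "0 \<le> K" and x: "x \<in> carrier_vec n"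
    and t: "0 \<le> t"
  shows "\<bar>heat_real n t F x - F x\<bar> \<le> K * sqrt t * (1 + gauss_second_moment n)"
proof -
  have i: "integrable (std_gauss n) (\<lambda>\<xi>. F (x + sqrt t \<cdot>\<^sub>v \<xi>) - F x)"
    using integrable_heat_real[OF b x, of "sqrt t"] by simp
  have "heat_real n t F x - F x = (\<integral>\<xi>. F (x + sqrt t \<cdot>\<^sub>v \<xi>) - F x \<partial>std_gauss n)"
    using integrable_heat_real[OF b x, of "sqrt t"] by (simp add: heat_real_def)
  then have "\<bar>heat_real n t F x - F x\<bar> \<le> (\<integral>\<xi>. \<bar>F (x + sqrt t \<cdot>\<^sub>v \<xi>) - F x\<bar> \<partial>std_gauss n)"
    using integral_norm_bound[of "std_gauss n" "\<lambda>\<xi>. F (x + sqrt t \<cdot>\<^sub>v \<xi>) - F x"] by simp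
  also have "\<dots> \<le> (\<integral>\<xi>. K * sqrt t * (1 + \<xi> \<bullet> \<xi>) \<partial>std_gauss n)"
  proof (rule integral_std_gauss_mono)
    fix \<xi> :: "real vec" assume \<xi>: "\<xi> \<in> carrier_vec n"
    have "(x + sqrt t \<cdot>\<^sub>v \<xi>) - x = sqrt t \<cdot>\<^sub>v \<xi>" using x \<xi> by (intro eq_vecI) auto
    then have "\<bar>F (x + sqrt t \<cdot>\<^sub>v \<xi>) - F x\<bar> \<le> K * (sqrt t * vnorm \<xi>)"
      using vec_lipschitz_abs[OF F, of "x + sqrt t \<cdot>\<^sub>v \<xi>" x] x \<xi> t by (simp add: vnorm_smult)
    also have "\<dots> \<le> K * (sqrt t * (1 + \<xi> \<bullet> \<xi>))"
    proof (intro mult_left_mono)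
      have "2 * vnorm \<xi> \<le> (vnorm \<xi>)\<^sup>2 + 1"
        using zero_le_power2[of "vnorm \<xi> - 1"] unfolding power2_diff by simp
      then show "vnorm \<xi> \<le> 1 + \<xi> \<bullet> \<xi>" unfolding vnorm_sq using vnorm_nonneg[of \<xi>] by linarith
    qed (use K t in auto)
    finally show "\<bar>F (x + sqrt t \<cdot>\<^sub>v \<xi>) - F x\<bar> \<le> K * sqrt t * (1 + \<xi> \<bullet> \<xi>)" by (simp add: mult.assoc)
  qed (use i integrable_second_moment in auto)
  also have "\<dots> = K * sqrt t * (1 + gauss_second_moment n)"
    using integrable_second_moment by (simp add: gauss_second_moment_def)
  finally show ?thesis .
qed

lemma heat_real_mono:
  assumes "bounded_measurable n a b F" "bounded_measurable n a' b' G" "x \<in> carrier_vec n"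
    and "\<And>y. y \<in> carrier_vec n \<Longrightarrow> F y \<le> G y"
  shows "heat_real n t F x \<le> heat_real n t G x"
  unfolding heat_real_def using assms
  by (intro integral_std_gauss_mono integrable_heat_real) auto

lemma mult_mat_vec_index:
  fixes M :: "real mat"
  assumes "M \<in> carrier_mat d n" "x \<in> carrier_vec n" "j < d"
  shows "(M *\<^sub>v x) $ j = (\<Sum>l<n. M $$ (j, l) * x $ l)"
  using assms by (auto simp: scalar_prod_real[where n = n] intro!: sum.cong)

lemma add_diff_cancel_vec:
  fixes a b :: "real vec"
  assumes "a \<in> carrier_vec n" "b \<in> carrier_vec n" shows "a + (b - a) = b"
  using assms by (intro eq_vecI) auto

context projection_frame
begin

lemma vnorm_E_le:
  assumes i: "i < m" and x: "x \<in> carrier_vec n" shows "vnorm (E i *\<^sub>v x) \<le> vnorm x"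
proof -
  let ?e = "E i *\<^sub>v x"
  have e: "?e \<in> carrier_vec n" using i x by simp
  have ee: "?e \<bullet> ?e = x \<bullet> ?e"
    using symmetric_mat_scalar_prod[OF E_carrier[OF i] E_sym[OF i] x e] E_E_vec[OF i x] by simp
  have "vnorm ?e * vnorm ?e \<le> vnorm x * vnorm ?e"
    using abs_scalar_prod_le_vnorm[OF x e] ee vnorm_sq[of ?e] by (simp add: power2_eq_square)
  then show ?thesis using vnorm_nonneg[of ?e] vnorm_nonneg[of x] by (cases "vnorm ?e = 0") (auto simp: mult_le_cancel_right)
qed

lemma lip_env_E:
  assumes i: "i < m" and g: "bounded_measurable n 0 M g" and K: "0 \<le> K"
    and inv: "\<And>y. y \<in> carrier_vec n \<Longrightarrow> g (E i *\<^sub>v y) = g y" and x: "x \<in> carrier_vec n"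
  shows "lip_env n K g (E i *\<^sub>v x) = lip_env n K g x"
proof -
  note le = bounded_measurableD(3)[OF g]
  \<comment> \<open>\<open>g\<close> does not change under translation by vectors in the kernel of \<open>E i\<close>\<close>
  have shift: "lip_env n K g y \<le> lip_env n K g y'"
    if y: "y \<in> carrier_vec n" and y': "y' \<in> carrier_vec n" and eq: "E i *\<^sub>v y = E i *\<^sub>v y'" for y y'
  proof (rule lip_env_leI[OF K le])
    fix z :: "real vec" assume z: "z \<in> carrier_vec n"
    define z' where "z' = z + (y' - y)"
    have z': "z' \<in> carrier_vec n" using y y' z by (simp add: z'_def)
    have "y' - z' = y - z" using y y' z by (intro eq_vecI) (auto simp: z'_def)
    moreover have Ey: "E i *\<^sub>v z + (E i *\<^sub>v y' - E i *\<^sub>v y') = E i *\<^sub>v z"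
    proof -
      define p q where "p = E i *\<^sub>v z" and "q = E i *\<^sub>v y'"
      have "p \<in> carrier_vec n" "q \<in> carrier_vec n" using i y' z by (auto simp: p_def q_def)
      then have "p + (q - q) = p" by (intro eq_vecI) auto
      then show ?thesis by (simp add: p_def q_def)
    qed
    have "E i *\<^sub>v z' = E i *\<^sub>v z"
      using E_carrier[OF i] y y' z eq Ey
      by (simp add: z'_def mult_add_distrib_mat_vec[of _ n n] mult_minus_distrib_mat_vec[of _ n n])
    then have "g z' = g z" using inv[OF z] inv[OF z'] by simp
    ultimately show "g z - K * vnorm (y - z) \<le> lip_env n K g y'"
      using lip_env_ge_term[where g = g and x = y', OF K le z'] by simp
  qed
  have "E i *\<^sub>v (E i *\<^sub>v x) = E i *\<^sub>v x" by (rule E_E_vec[OF i x])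
  then show ?thesis using shift[of x "E i *\<^sub>v x"] shift[of "E i *\<^sub>v x" x] i x by (intro antisym) auto
qed

text \<open>The limiting argument behind the constraint: near-optimal points of the regularised problems stay
  in a compact set because the functions have bounded support modulo the kernels of the \<open>E i\<close>, and
  semicontinuity controls the values at their limit.\<close>

lemma constraint_limit:
  assumes g: "\<And>i x. i < m \<Longrightarrow> x \<in> carrier_vec n \<Longrightarrow> 0 \<le> g i x \<and> g i x \<le> M"
    and usc: "\<And>i. i < m \<Longrightarrow> usc_vec n (g i)"
    and supp: "\<And>i x. i < m \<Longrightarrow> x \<in> carrier_vec n \<Longrightarrow> g i x \<noteq> 0 \<Longrightarrow> vnorm (E i *\<^sub>v x) \<le> R"
    and constr: "\<And>X. (\<And>i. i < m \<Longrightarrow> X i \<in> carrier_vec n) \<Longrightarrow> ennreal (\<Prod>i<m. g i (X i) powr c i) \<le> f (combine X)"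
    and X: "\<And>k i. i < m \<Longrightarrow> X k i \<in> carrier_vec n" and EX: "\<And>k i. i < m \<Longrightarrow> E i *\<^sub>v X k i = X k i"
    and Xy: "\<And>k. combine (X k) = y"
    and Z: "\<And>k i. i < m \<Longrightarrow> Z k i \<in> carrier_vec n"
    and near: "\<And>k i. i < m \<Longrightarrow> vnorm (X k i - Z k i) \<le> \<epsilon> k"
    and \<epsilon>: "\<epsilon> \<longlonglongrightarrow> 0" and s: "0 < s"
    and big: "\<And>k. s \<le> (\<Prod>i<m. (g i (Z k i) + \<epsilon> k) powr c i)"
  shows "ennreal s \<le> f y"
proof -
  have M: "0 \<le> M" if "i < m" for i using g[OF that zero_carrier_vec] by linarith
  have ev1: "\<forall>\<^sub>F k in sequentially. \<epsilon> k < 1" using \<epsilon> by (rule order_tendstoD) simp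
  have "vnorm (X k i - Z k i) \<ge> 0" for k i by simp
  then have \<epsilon>0: "0 \<le> \<epsilon> k" if "i < m" for i k using near[OF that, of k] by (meson order_trans)
  have nz: "\<forall>\<^sub>F k in sequentially. g i (Z k i) \<noteq> 0" if i: "i < m" for i
  proof -
    define B where "B = (\<Prod>l\<in>{..<m} - {i}. (M + 1) powr c l)"
    have "(\<lambda>k. \<epsilon> k powr c i * B) \<longlonglongrightarrow> 0 powr c i * B"
      using \<epsilon> c_pos[OF i] \<epsilon>0[OF i] by (intro tendsto_mult tendsto_powr2 tendsto_const) auto
    then have "\<forall>\<^sub>F k in sequentially. \<epsilon> k powr c i * B < s"
      using s by (intro order_tendstoD(2)[where y = "0 powr c i * B"]) auto
    with ev1 show ?thesis
    proof eventually_elim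
      case (elim k)
      show ?case
      proof
        assume 0: "g i (Z k i) = 0"
        have "s \<le> (g i (Z k i) + \<epsilon> k) powr c i * (\<Prod>l\<in>{..<m} - {i}. (g l (Z k l) + \<epsilon> k) powr c l)"
          using big[of k] i by (subst (asm) prod.remove[of _ i]) auto
        also have "(\<Prod>l\<in>{..<m} - {i}. (g l (Z k l) + \<epsilon> k) powr c l) \<le> B"
          unfolding B_def
        proof (intro prod_mono conjI powr_mono2)
          fix l assume "l \<in> {..<m} - {i}"
          then have l: "l < m" by simp
          show "0 \<le> c l" using c_pos[OF l] by simp
          show "0 \<le> g l (Z k l) + \<epsilon> k" "g l (Z k l) + \<epsilon> k \<le> M + 1"
            using g[OF l Z[OF l, of k]] \<epsilon>0[OF l, of k] elim(1) by auto
        qed simp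
        finally show False using 0 elim(2) by (simp add: mult_left_mono)
      qed
    qed
  qed
  have "\<forall>\<^sub>F k in sequentially. \<forall>i\<in>{..<m}. g i (Z k i) \<noteq> 0" using nz by (intro eventually_ball_finite) auto
  with ev1 have "\<forall>\<^sub>F k in sequentially. \<epsilon> k < 1 \<and> (\<forall>i<m. g i (Z k i) \<noteq> 0)"
    by eventually_elim auto
  then obtain k0 where k0: "\<And>k. k0 \<le> k \<Longrightarrow> \<epsilon> k < 1" "\<And>k i. k0 \<le> k \<Longrightarrow> i < m \<Longrightarrow> g i (Z k i) \<noteq> 0"
    unfolding eventually_sequentially by blast
  have bnd: "\<bar>X (k + k0) i $ j\<bar> \<le> 1 + R" if i: "i < m" and j: "j < n" for k i j
  proof -
    let ?k = "k + k0"
    have "\<bar>X ?k i $ j\<bar> \<le> vnorm (X ?k i)" by (rule abs_index_le_vnorm[OF X[OF i] j])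
    also have "vnorm (X ?k i) \<le> vnorm (E i *\<^sub>v (X ?k i - Z ?k i)) + vnorm (E i *\<^sub>v Z ?k i)"
    proof -
      define p q where "p = X ?k i" and "q = E i *\<^sub>v Z ?k i"
      have pq: "p \<in> carrier_vec n" "q \<in> carrier_vec n" using X[OF i] Z[OF i] i by (auto simp: p_def q_def)
      have "E i *\<^sub>v (X ?k i - Z ?k i) = p - q"
        using X[OF i] Z[OF i] E_carrier[OF i] EX[OF i]
        by (simp add: p_def q_def mult_minus_distrib_mat_vec[of _ n n])
      moreover have "p = (p - q) + q" using pq by (intro eq_vecI) auto
      then have "vnorm p \<le> vnorm (p - q) + vnorm q"
        using vnorm_triangle[of "p - q" n q] pq by simp
      ultimately show ?thesis by (simp add: p_def q_def)
    qed
    also have "\<dots> \<le> 1 + R"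
    proof (rule add_mono)
      have "vnorm (E i *\<^sub>v (X ?k i - Z ?k i)) \<le> vnorm (X ?k i - Z ?k i)"
        using X[OF i] Z[OF i] i by (intro vnorm_E_le) auto
      then show "vnorm (E i *\<^sub>v (X ?k i - Z ?k i)) \<le> 1" using near[OF i, of ?k] k0(1)[of ?k] by simp
      show "vnorm (E i *\<^sub>v Z ?k i) \<le> R" using k0(2)[of ?k i] i by (intro supp Z) auto
    qed
    finally show ?thesis .
  qed
  have "\<exists>r l. strict_mono r \<and> (\<forall>p<m * n. (\<lambda>k. X (r k + k0) (p div n) $ (p mod n)) \<longlonglongrightarrow> l p)"
  proof (rule bounded_coordinates_convergent_subsequence[where B = "1 + R"])
    fix k p assume p: "p < m * n"
    then have "0 < n" by (cases n) auto
    then show "\<bar>X (k + k0) (p div n) $ (p mod n)\<bar> \<le> 1 + R"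
      using p by (intro bnd) (auto simp: less_mult_imp_div_less)
  qed
  then obtain r l where r: "strict_mono r"
    and l: "\<And>p. p < m * n \<Longrightarrow> (\<lambda>k. X (r k + k0) (p div n) $ (p mod n)) \<longlonglongrightarrow> l p" by blast
  define q where "q = (\<lambda>k. r k + k0)"
  have q: "filterlim q sequentially sequentially"
    unfolding q_def by (rule filterlim_subseq) (use r in \<open>auto simp: strict_mono_def\<close>)
  define x where "x = (\<lambda>i. vec n (\<lambda>j. l (i * n + j)))"
  have x: "x i \<in> carrier_vec n" for i by (simp add: x_def)
  have Xlim: "vec_tendsto n (\<lambda>k. X (q k) i) (x i)" if i: "i < m" for i
    unfolding vec_tendsto_def
  proof (intro allI impI)
    fix j assume j: "j < n"
    have "i * n + j < Suc i * n" using j by simp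
    also have "\<dots> \<le> m * n" using i by (intro mult_right_mono) auto
    finally have "(\<lambda>k. X (r k + k0) ((i * n + j) div n) $ ((i * n + j) mod n)) \<longlonglongrightarrow> l (i * n + j)" by (rule l)
    then show "(\<lambda>k. X (q k) i $ j) \<longlonglongrightarrow> x i $ j" using j by (simp add: x_def q_def)
  qed
  have \<epsilon>q: "(\<lambda>k. \<epsilon> (q k)) \<longlonglongrightarrow> 0" using \<epsilon> q by (rule filterlim_compose)
  have Zlim: "vec_tendsto n (\<lambda>k. Z (q k) i) (x i)" if i: "i < m" for i
    using near[OF i]
    by (intro vec_tendsto_near[OF Xlim[OF i] X[OF i] Z[OF i]] Lim_null_comparison[OF _ \<epsilon>q] always_eventually) simp
  have "combine x = y"
  proof (rule eq_vecI)
    have ny: "y \<in> carrier_vec n" using Xy[of 0] combine_carrier by metis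
    fix j assume "j < dim_vec y"
    then have j: "j < n" using ny by simp
    have "(\<lambda>k. \<Sum>i<m. c i * (\<Sum>l<n. E i $$ (j, l) * X (q k) i $ l)) \<longlonglongrightarrow> (\<Sum>i<m. c i * (\<Sum>l<n. E i $$ (j, l) * x i $ l))"
      using Xlim by (intro tendsto_intros) (auto simp: vec_tendsto_def)
    moreover have "combine W $ j = (\<Sum>i<m. c i * (\<Sum>l<n. E i $$ (j, l) * W i $ l))"
      if "\<And>i. i < m \<Longrightarrow> W i \<in> carrier_vec n" for W
      unfolding combine_def using j that mult_mat_vec_index[OF E_carrier] by simp
    ultimately have "(\<lambda>k. combine (X (q k)) $ j) \<longlonglongrightarrow> combine x $ j" using X x by simp
    then show "combine x $ j = y $ j" by (simp add: Xy LIMSEQ_const_iff)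
  qed (use Xy[of 0] combine_carrier in \<open>metis carrier_vecD\<close>)
  have le: "s \<le> (\<Prod>i<m. (g i (x i) + 2 * e) powr c i)" if e: "0 < e" for e
  proof -
    have "\<forall>\<^sub>F k in sequentially. \<forall>i\<in>{..<m}. g i (Z (q k) i) < g i (x i) + e"
      using usc Zlim x Z e unfolding usc_vec_def by (intro eventually_ball_finite) auto
    moreover have "\<forall>\<^sub>F k in sequentially. \<epsilon> (q k) < e" using \<epsilon>q e by (rule order_tendstoD)
    ultimately have "\<forall>\<^sub>F k in sequentially. s \<le> (\<Prod>i<m. (g i (x i) + 2 * e) powr c i)"
    proof eventually_elim
      case (elim k)
      have "s \<le> (\<Prod>i<m. (g i (Z (q k) i) + \<epsilon> (q k)) powr c i)" by (rule big)
      also have "\<dots> \<le> (\<Prod>i<m. (g i (x i) + 2 * e) powr c i)"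
      proof (intro prod_mono conjI powr_mono2)
        fix i assume i: "i \<in> {..<m}"
        then show "0 \<le> c i" using c_pos[of i] by simp
        show "0 \<le> g i (Z (q k) i) + \<epsilon> (q k)" using g[OF _ Z, of i i "q k"] \<epsilon>0[of i "q k"] i by simp
        show "g i (Z (q k) i) + \<epsilon> (q k) \<le> g i (x i) + 2 * e" using bspec[OF elim(1) i] elim(2) by linarith
      qed simp
      finally show ?case .
    qed
    then show ?thesis by (simp add: eventually_const_iff)
  qed
  have "(\<lambda>N. \<Prod>i<m. (g i (x i) + 2 * (1 / real (Suc N))) powr c i) \<longlonglongrightarrow> (\<Prod>i<m. (g i (x i) + 2 * 0) powr c i)"
  proof (intro tendsto_prod tendsto_powr2 tendsto_add tendsto_mult tendsto_const)
    show "(\<lambda>N. 1 / real (Suc N)) \<longlonglongrightarrow> 0" by (rule LIMSEQ_Suc[OF lim_const_over_n])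
    fix i assume "i \<in> {..<m}"
    then show "0 < c i" "\<forall>\<^sub>F N in sequentially. 0 \<le> g i (x i) + 2 * (1 / real (Suc N))"
      using c_pos[of i] g[OF _ x, of i i] by (auto intro!: always_eventually add_nonneg_nonneg)
  qed
  then have "s \<le> (\<Prod>i<m. (g i (x i) + 2 * 0) powr c i)"
    by (rule LIMSEQ_le_const) (intro exI[of _ 0] allI impI le, simp)
  then have "ennreal s \<le> ennreal (\<Prod>i<m. g i (x i) powr c i)" by (intro ennreal_leI) simp
  also have "\<dots> \<le> f (combine x)" by (rule constr) (rule x)
  finally show ?thesis by (simp add: \<open>combine x = y\<close>)
qed

text \<open>The heat evolution on the right is that of a Borel function \<open>\<Phi> \<le> f\<close>, the upper limit of the smallest functions \<open>W k\<close> that satisfy the constraint together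
  with the \<open>k\<close>-th regularisations \<open>\<psi> k i\<close> of \<open>g i\<close>.\<close>

theorem gaussian_inequality_usc:
  assumes g: "\<And>i. i < m \<Longrightarrow> bounded_measurable n 0 M (g i)" and M: "0 \<le> M"
    and inv: "\<And>i y. i < m \<Longrightarrow> y \<in> carrier_vec n \<Longrightarrow> g i (E i *\<^sub>v y) = g i y"
    and usc: "\<And>i. i < m \<Longrightarrow> usc_vec n (g i)"
    and supp: "\<And>i x. i < m \<Longrightarrow> x \<in> carrier_vec n \<Longrightarrow> g i x \<noteq> 0 \<Longrightarrow> vnorm (E i *\<^sub>v x) \<le> R"
    and constr: "\<And>X. (\<And>i. i < m \<Longrightarrow> X i \<in> carrier_vec n) \<Longrightarrow> ennreal (\<Prod>i<m. g i (X i) powr c i) \<le> f (combine X)"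
  obtains \<Phi> where "\<Phi> \<in> borel_measurable (lborel_vec n)" "\<And>y. y \<in> carrier_vec n \<Longrightarrow> \<Phi> y \<le> f y"
    "\<And>T. 0 < T \<Longrightarrow> ennreal (\<Prod>i<m. heat_real n T (g i) (0\<^sub>v n) powr c i) \<le> heat n T \<Phi> (0\<^sub>v n)"
proof -
  define \<mu> where "\<mu> = 1 + gauss_second_moment n"
  have \<mu>: "1 \<le> \<mu>" using gauss_second_moment_nonneg[of n] by (simp add: \<mu>_def)
  \<comment> \<open>regularisation at scale \<open>1 / K\<close>; the time \<open>1 / K^4\<close> moves a \<open>K\<close>-Lipschitz function by at most \<open>\<mu> / K\<close>\<close>
  define K where "K = (\<lambda>k. real (Suc k))"
  have K: "1 \<le> K k" for k by (simp add: K_def)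
  define \<delta> where "\<delta> = (\<lambda>k. 1 / K k ^ 4)"
  define \<tau> where "\<tau> = (\<lambda>k. \<mu> / K k)"
  have K0: "0 < K k" "0 \<le> K k" for k using K[of k] by linarith+
  have \<delta>: "0 < \<delta> k" for k using K0[of k] by (simp add: \<delta>_def)
  have \<tau>: "0 < \<tau> k" "\<tau> k \<le> \<mu>" for k using K[of k] K0[of k] \<mu> by (auto simp: \<tau>_def divide_le_eq mult_le_cancel_left1)
  have sqrt\<delta>: "K k * sqrt (\<delta> k) * \<mu> = \<tau> k" for k
  proof -
    have "sqrt (\<delta> k) = 1 / (K k)\<^sup>2"
      using K0[of k] by (intro real_sqrt_unique) (auto simp: \<delta>_def power_divide simp flip: power_mult)
    then show ?thesis using K0[of k] by (simp add: \<tau>_def power2_eq_square)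
  qed
  define G where "G = (\<lambda>k i. lip_env n (K k) (g i))"
  define \<psi> where "\<psi> = (\<lambda>k i x. \<tau> k + heat_real n (\<delta> k) (G k i) x)"
  note gD = bounded_measurableD[OF g]
  have Glip: "vec_lipschitz n (K k) (G k i)" if "i < m" for k i
    unfolding G_def by (rule lip_env_lipschitz[OF K0(2) gD(3)[OF that]])
  have Gge: "g i x \<le> G k i x" if "i < m" "x \<in> carrier_vec n" for k i x
    unfolding G_def by (rule lip_env_ge[OF K0(2) gD(3)[OF that(1)] that(2)])
  have Gle: "G k i x \<le> M" if "i < m" "x \<in> carrier_vec n" for k i x
    unfolding G_def by (intro lip_env_leI[OF K0(2) gD(3)[OF that(1)]] lip_env_term_le[OF K0(2) gD(3)[OF that(1)]])
  have Gb: "bounded_measurable n 0 M (G k i)" if "i < m" for k i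
    unfolding bounded_measurable_def
    using borel_measurable_vec_lipschitz[OF Glip[OF that]] Gle[OF that] order_trans[OF gD(2)[OF that] Gge[OF that]]
    by blast
  have GE: "G k i (E i *\<^sub>v x) = G k i x" if "i < m" "x \<in> carrier_vec n" for k i x
    unfolding G_def by (rule lip_env_E[OF that(1) g[OF that(1)] K0(2) inv[OF that(1)] that(2)])
  have close: "\<bar>heat_real n (\<delta> k) (G k i) x - G k i x\<bar> \<le> \<tau> k" if "i < m" "x \<in> carrier_vec n" for k i x
    using heat_real_close[OF Glip[OF that(1)] Gb[OF that(1)] K0(2) that(2), of "\<delta> k" k] \<delta>[of k] sqrt\<delta>[of k]
    by (simp add: \<mu>_def)
  have \<psi>ge: "g i x \<le> \<psi> k i x" if "i < m" "x \<in> carrier_vec n" for k i x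
    using close[OF that, of k] Gge[OF that, of k] by (simp add: \<psi>_def abs_le_iff)
  have \<psi>b: "bounded_measurable n 0 (\<mu> + M) (\<psi> k i)" if i: "i < m" for k i
    using bounded_measurable_heat_real[OF Gb[OF i], of "\<delta> k" k] \<tau>[of k]
    by (auto simp: \<psi>_def bounded_measurable_def intro!: borel_measurable_add add_mono)
  have \<psi>E: "\<psi> k i (E i *\<^sub>v x) = \<psi> k i x" if "i < m" "x \<in> carrier_vec n" for k i x
    using heat_real_E[of i "G k i" x "\<delta> k"] GE that by (simp add: \<psi>_def)
  have \<psi>pos: "0 < \<psi> k i x" if "i < m" "x \<in> carrier_vec n" for k i x
    using heat_real_bounds(1)[OF Gb[OF that(1)] that(2), of "\<delta> k" k] \<tau>[of k] by (simp add: \<psi>_def)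
  \<comment> \<open>families \<open>x\<close> with \<open>combine x = y\<close> are the translates of \<open>Ker\<close> by the constant family \<open>y\<close>\<close>
  define Ker where "Ker = {\<kappa> :: nat \<Rightarrow> real vec. (\<forall>i. \<kappa> i \<in> carrier_vec n) \<and> combine \<kappa> = 0\<^sub>v n}"
  define W where "W = (\<lambda>k y. SUP \<kappa>\<in>Ker. ennreal (\<Prod>i<m. \<psi> k i (y + \<kappa> i) powr c i))"
  have Wm: "W k \<in> borel_measurable (lborel_vec n)" for k
    unfolding W_def
  proof (rule borel_measurable_SUP_continuous)
    fix \<kappa> assume \<kappa>: "\<kappa> \<in> Ker"
    have "continuous_on UNIV (\<lambda>\<omega> :: nat \<Rightarrow> real. \<psi> k i (vec n \<omega> + \<kappa> i))" if i: "i < m" for i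
    proof (rule continuous_on_vec_lipschitz)
      have h: "vec_lipschitz n (K k) (heat_real n (\<delta> k) (G k i))"
        by (rule heat_real_lipschitz[OF Glip[OF i] Gb[OF i]])
      show "vec_lipschitz n (K k) (\<lambda>x. \<psi> k i (x + \<kappa> i))"
        unfolding vec_lipschitz_def
      proof (intro ballI)
        fix x y :: "real vec" assume xy: "x \<in> carrier_vec n" "y \<in> carrier_vec n"
        have ki: "\<kappa> i \<in> carrier_vec n" using \<kappa> by (simp add: Ker_def)
        have "(x + \<kappa> i) - (y + \<kappa> i) = x - y" using xy ki by (intro eq_vecI) auto
        then show "\<psi> k i (x + \<kappa> i) \<le> \<psi> k i (y + \<kappa> i) + K k * vnorm (x - y)"
          using h xy ki unfolding vec_lipschitz_def \<psi>_def by (metis add_carrier_vec add.assoc add_left_mono)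
      qed
    qed
    then show "continuous_on UNIV (\<lambda>\<omega> :: nat \<Rightarrow> real. ennreal (\<Prod>i<m. \<psi> k i (vec n \<omega> + \<kappa> i) powr c i))"
      using \<kappa> \<psi>pos
      by (intro continuous_on_ennreal continuous_on_prod continuous_on_powr continuous_on_const)
        (auto simp: Ker_def less_imp_neq[symmetric])
  qed
  have Wconstr: "ennreal (\<Prod>i<m. \<psi> k i (X i) powr c i) \<le> W k (combine X)"
    if X: "\<And>i. i < m \<Longrightarrow> X i \<in> carrier_vec n" for k X
  proof -
    define \<kappa> where "\<kappa> = (\<lambda>i. if i < m then X i - combine X else 0\<^sub>v n)"
    have "combine \<kappa> = 0\<^sub>v n"
    proof (rule eq_vecI)
      fix j assume "j < dim_vec (0\<^sub>v n :: real vec)"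
      then have j: "j < n" by simp
      have "combine \<kappa> $ j = (\<Sum>i<m. c i * (E i *\<^sub>v X i) $ j - c i * (E i *\<^sub>v combine X) $ j)"
      proof -
        have "(E i *\<^sub>v \<kappa> i) $ j = (E i *\<^sub>v X i) $ j - (E i *\<^sub>v combine X) $ j" if i: "i < m" for i
          using i j mult_minus_distrib_mat_vec[OF E_carrier[OF i] X[OF i] combine_carrier[of X]]
            index_minus_vec(1)[of j "E i *\<^sub>v combine X" "E i *\<^sub>v X i"] carrier_matD(1)[OF E_carrier[OF i]]
          by (simp add: \<kappa>_def)
        then show ?thesis unfolding combine_def[of \<kappa>] using j by (simp add: right_diff_distrib)
      qed
      also have "\<dots> = combine X $ j - combine X $ j"
        unfolding sum_subtractf resolution[OF combine_carrier j] using j by (simp add: combine_def)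
      finally show "combine \<kappa> $ j = 0\<^sub>v n $ j" using j by simp
    qed (simp add: combine_def)
    moreover have "\<kappa> i \<in> carrier_vec n" for i using X by (simp add: \<kappa>_def)
    ultimately have "\<kappa> \<in> Ker" by (simp add: Ker_def)
    moreover have "combine X + \<kappa> i = X i" if "i < m" for i
      using add_diff_cancel_vec[OF combine_carrier X[OF that]] that by (simp add: \<kappa>_def)
    ultimately show ?thesis unfolding W_def by (intro SUP_upper2[of \<kappa>]) auto
  qed
  have Wle: "W k y \<le> ennreal (\<Prod>i<m. (\<mu> + M) powr c i)" if y: "y \<in> carrier_vec n" for k y
    unfolding W_def
  proof (intro SUP_least ennreal_leI prod_mono conjI powr_mono2)
    fix \<kappa> i assume "\<kappa> \<in> Ker" and "i \<in> {..<m}"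
    then have *: "i < m" "y + \<kappa> i \<in> carrier_vec n" using y by (auto simp: Ker_def)
    show "0 \<le> c i" using c_pos[OF *(1)] by simp
    show "0 \<le> \<psi> k i (y + \<kappa> i)" using \<psi>pos[OF *, of k] by simp
    show "\<psi> k i (y + \<kappa> i) \<le> \<mu> + M" by (rule bounded_measurableD(3)[OF \<psi>b[OF *(1)] *(2)])
  qed simp
  have flow: "ennreal (\<Prod>i<m. heat_real n T (g i) (0\<^sub>v n) powr c i) \<le> heat n T (W k) (0\<^sub>v n)" if T: "0 < T" for T k
  proof -
    have "(\<Prod>i<m. heat_real n T (g i) (0\<^sub>v n) powr c i) \<le> (\<Prod>i<m. (\<tau> k + heat_real n (\<delta> k + T) (G k i) (0\<^sub>v n)) powr c i)"
    proof (intro prod_mono conjI powr_mono2)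
      fix i assume "i \<in> {..<m}"
      then have i: "i < m" by simp
      show "0 \<le> c i" using c_pos[OF i] by simp
      show "0 \<le> heat_real n T (g i) (0\<^sub>v n)" by (rule heat_real_bounds(1)[OF g[OF i]]) simp
      have "heat_real n T (g i) (0\<^sub>v n) \<le> heat_real n T (\<psi> k i) (0\<^sub>v n)"
        by (rule heat_real_mono[OF g[OF i] \<psi>b[OF i]]) (auto intro: \<psi>ge[OF i])
      also have "\<dots> = \<tau> k + heat_real n T (heat_real n (\<delta> k) (G k i)) (0\<^sub>v n)"
        unfolding \<psi>_def by (rule heat_real_add_const[OF bounded_measurable_heat_real[OF Gb[OF i]]]) simp_all
      also have "heat_real n T (heat_real n (\<delta> k) (G k i)) (0\<^sub>v n) = heat_real n (T + \<delta> k) (G k i) (0\<^sub>v n)"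
        by (rule heat_real_heat_real[OF Gb[OF i] _ T \<delta>]) simp
      finally show "heat_real n T (g i) (0\<^sub>v n) \<le> \<tau> k + heat_real n (\<delta> k + T) (G k i) (0\<^sub>v n)"
        by (simp add: add.commute)
    qed simp
    then have "ennreal (\<Prod>i<m. heat_real n T (g i) (0\<^sub>v n) powr c i) \<le>
        ennreal (\<Prod>i<m. (\<tau> k + heat_real n (\<delta> k + T) (G k i) (0\<^sub>v n)) powr c i)" by (rule ennreal_leI)
    also have "\<dots> \<le> heat n T (W k) (combine (\<lambda>_. 0\<^sub>v n))"
      by (rule constraint_heat_flow[OF Gb M GE \<tau>(1) \<delta> T Wm])
        (use Wconstr in \<open>auto simp: \<psi>_def\<close>)
    finally show ?thesis by (simp add: combine_const)
  qed
  define \<Phi> where "\<Phi> = (\<lambda>y. limsup (\<lambda>k. W k y))"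
  have \<Phi>m: "\<Phi> \<in> borel_measurable (lborel_vec n)" unfolding \<Phi>_def using Wm by measurable
  \<comment> \<open>otherwise, near-optimal families for infinitely many \<open>W k\<close> would accumulate at a violation of the constraint\<close>
  have \<Phi>f: "\<Phi> y \<le> f y" if y: "y \<in> carrier_vec n" for y
  proof (rule ccontr)
    assume "\<not> \<Phi> y \<le> f y"
    then have "f y < \<Phi> y" by (simp add: not_le)
    then obtain s where s: "f y < s" "s < \<Phi> y" using dense by blast
    have "0 < s" using s(1) by (rule le_less_trans[OF zero_le])
    moreover have "s < \<infinity>" using s(2) by (rule less_le_trans) simp
    ultimately obtain s' where s': "s = ennreal s'" "0 < s'" by (cases s) auto
    have "\<exists>\<^sub>F k in sequentially. s < W k y"
      using s(2) Limsup_bounded[of "\<lambda>k. W k y" s sequentially]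
      unfolding \<Phi>_def frequently_def by (auto simp: not_less)
    then have "infinite {k. s < W k y}"
      by (simp add: frequently_cofinite flip: cofinite_eq_sequentially)
    then obtain r :: "nat \<Rightarrow> nat" where r: "strict_mono r" "\<And>k. s < W (r k) y"
      using infinite_enumerate[of "{k. s < W k y}"] by auto
    have "\<exists>\<kappa>\<in>Ker. s < ennreal (\<Prod>i<m. \<psi> (r k) i (y + \<kappa> i) powr c i)" for k
      using r(2)[of k] unfolding W_def less_SUP_iff .
    then obtain \<kappa> where \<kappa>: "\<And>k. \<kappa> k \<in> Ker" and big: "\<And>k. s < ennreal (\<Prod>i<m. \<psi> (r k) i (y + \<kappa> k i) powr c i)"
      by metis
    have yk: "y + \<kappa> k i \<in> carrier_vec n" for k i using \<kappa>[of k] y by (auto simp: Ker_def)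
    define X where "X = (\<lambda>k i. E i *\<^sub>v (y + \<kappa> k i))"
    have X: "X k i \<in> carrier_vec n" if "i < m" for k i unfolding X_def using that yk by simp
    have EX: "E i *\<^sub>v X k i = X k i" if "i < m" for k i unfolding X_def by (rule E_E_vec[OF that yk])
    have Xy: "combine (X k) = y" for k
    proof -
      have "combine (X k) = combine (\<lambda>i. y + \<kappa> k i)"
        unfolding combine_def X_def using E_E_vec[OF _ yk] by (intro arg_cong[where f = "vec n"] ext sum.cong refl) simp
      also have "\<dots> = combine (\<lambda>i. 0\<^sub>v n + 1 \<cdot>\<^sub>v (y + \<kappa> k i))"
        using yk by simp
      also have "\<dots> = combine (\<lambda>i. 0\<^sub>v n) + 1 \<cdot>\<^sub>v (y + combine (\<kappa> k))"
        using \<kappa>[of k] y by (intro combine_affine) (auto simp: Ker_def)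
      also have "\<dots> = y" using \<kappa>[of k] y by (simp add: combine_const Ker_def)
      finally show ?thesis .
    qed
    \<comment> \<open>the regularised value at \<open>X k i\<close> is almost attained by \<open>g i\<close> at a nearby point; \<open>M + 1\<close> bounds the distance and \<open>2 * \<mu> + 1\<close> the loss in value, both up to \<open>K (r k)\<close>\<close>
    define \<epsilon> where "\<epsilon> = (\<lambda>k. (2 * \<mu> + M + 1) / K (r k))"
    have "\<exists>z. z \<in> carrier_vec n \<and> vnorm (X k i - z) \<le> \<epsilon> k \<and> \<psi> (r k) i (X k i) \<le> g i z + \<epsilon> k" if i: "i < m" for k i
    proof -
      have e: "0 < 1 / K (r k)" using K0[of "r k"] by simp
      obtain z where z: "z \<in> carrier_vec n" "G (r k) i (X k i) - 1 / K (r k) < g i z - K (r k) * vnorm (X k i - z)"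
        using lip_env_near[where n = n and K = "K (r k)" and g = "g i" and x = "X k i", OF K0(2) gD(3)[OF i] e] unfolding G_def by blast
      have G0: "0 \<le> G (r k) i (X k i)" using bounded_measurableD(2)[OF Gb[OF i] X[OF i]] .
      have gM: "g i z \<le> M" by (rule gD(3)[OF i z(1)])
      have "1 / K (r k) \<le> 1" using K[of "r k"] by simp
      then have "K (r k) * vnorm (X k i - z) \<le> M + 1" using z(2) G0 gM by linarith
      then have "vnorm (X k i - z) \<le> (M + 1) / K (r k)" using K0[of "r k"] by (simp add: field_simps)
      also have "\<dots> \<le> \<epsilon> k" unfolding \<epsilon>_def using \<mu> K0[of "r k"] by (intro divide_right_mono) auto
      finally have a: "vnorm (X k i - z) \<le> \<epsilon> k" .
      have "0 \<le> K (r k) * vnorm (X k i - z)" using K0[of "r k"] by simp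
      then have "G (r k) i (X k i) \<le> g i z + 1 / K (r k)" using z(2) by linarith
      then have "\<psi> (r k) i (X k i) \<le> g i z + 1 / K (r k) + 2 * \<tau> (r k)"
        using close[OF i X[OF i, of k], of "r k"] by (simp add: \<psi>_def abs_le_iff)
      also have "\<dots> = g i z + (2 * \<mu> + 1) / K (r k)" by (simp add: \<tau>_def add_divide_distrib)
      also have "\<dots> \<le> g i z + \<epsilon> k" unfolding \<epsilon>_def using M K0[of "r k"] by (intro add_left_mono divide_right_mono) auto
      finally show ?thesis using a z(1) by blast
    qed
    note ex = this
    define Z where "Z = (\<lambda>k i. SOME z. z \<in> carrier_vec n \<and> vnorm (X k i - z) \<le> \<epsilon> k \<and> \<psi> (r k) i (X k i) \<le> g i z + \<epsilon> k)"
    have Z: "Z k i \<in> carrier_vec n" and near: "vnorm (X k i - Z k i) \<le> \<epsilon> k"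
      and val: "\<psi> (r k) i (X k i) \<le> g i (Z k i) + \<epsilon> k" if "i < m" for k i
      using someI_ex[OF ex[OF that, of k]] by (simp_all add: Z_def)
    have "ennreal s' \<le> f y"
    proof (rule constraint_limit[OF _ usc supp constr X EX Xy Z near _ s'(2)])
      show "0 \<le> g i x \<and> g i x \<le> M" if "i < m" "x \<in> carrier_vec n" for i x using gD(2,3)[OF that] by simp
      have "(\<lambda>k. (2 * \<mu> + M + 1) / K k) \<longlonglongrightarrow> 0" unfolding K_def by (rule LIMSEQ_Suc[OF lim_const_over_n])
      then show "\<epsilon> \<longlonglongrightarrow> 0" using LIMSEQ_subseq_LIMSEQ[OF _ r(1)] by (simp add: \<epsilon>_def o_def)
      fix k
      have "s' \<le> (\<Prod>i<m. \<psi> (r k) i (y + \<kappa> k i) powr c i)"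
        using big[of k] s' by (simp add: ennreal_less_iff)
      also have "\<dots> = (\<Prod>i<m. \<psi> (r k) i (X k i) powr c i)"
        unfolding X_def using yk by (intro prod.cong refl) (simp add: \<psi>E)
      also have "\<dots> \<le> (\<Prod>i<m. (g i (Z k i) + \<epsilon> k) powr c i)"
        using val \<psi>pos[OF _ X] c_pos by (intro prod_mono conjI powr_mono2) (auto intro: less_imp_le)
      finally show "s' \<le> (\<Prod>i<m. (g i (Z k i) + \<epsilon> k) powr c i)" .
    qed
    then show False using s(1) s'(1) by simp
  qed
  show ?thesis
  proof (rule that[OF \<Phi>m \<Phi>f])
    fix T :: real assume T: "0 < T"
    let ?A = "ennreal (\<Prod>i<m. heat_real n T (g i) (0\<^sub>v n) powr c i)"
    have "?A \<le> limsup (\<lambda>k. heat n T (W k) (0\<^sub>v n))"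
      using flow[OF T] by (intro le_Limsup always_eventually) auto
    also have "\<dots> \<le> heat n T \<Phi> (0\<^sub>v n)"
      unfolding heat_def \<Phi>_def
    proof (rule nn_integral_limsup)
      show "(\<lambda>\<xi>. W k (0\<^sub>v n + sqrt T \<cdot>\<^sub>v \<xi>)) \<in> borel_measurable (std_gauss n)" for k
        using measurable_compose_affine[OF zero_carrier_vec Wm] by simp
      show "AE \<xi> in std_gauss n. W k (0\<^sub>v n + sqrt T \<cdot>\<^sub>v \<xi>) \<le> ennreal (\<Prod>i<m. (\<mu> + M) powr c i)" for k
        by (rule AE_I2) (auto intro: Wle)
      show "(\<integral>\<^sup>+\<xi>. ennreal (\<Prod>i<m. (\<mu> + M) powr c i) \<partial>std_gauss n) < \<infinity>"
        using prob_space.emeasure_space_1[OF prob_space_std_gauss, of n] by (simp add: ennreal_mult_less_top)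
    qed simp
    finally show "?A \<le> heat n T \<Phi> (0\<^sub>v n)" .
  qed
qed

end

section \<open>Approximation from below by compactly supported semicontinuous functions\<close>

text \<open>The class of test functions to which the Gaussian inequality is applied.\<close>

definition usc_test :: "nat \<Rightarrow> (real vec \<Rightarrow> real) \<Rightarrow> bool" where
  "usc_test d g \<longleftrightarrow> g \<in> borel_measurable (lborel_vec d) \<and> usc_vec d g \<and>
     (\<exists>M R. \<forall>x\<in>carrier_vec d. 0 \<le> g x \<and> g x \<le> M \<and> (g x \<noteq> 0 \<longrightarrow> (\<forall>j<d. \<bar>x $ j\<bar> \<le> R)))"

lemma usc_testE:
  assumes "usc_test d g"
  obtains M R where "\<And>x. x \<in> carrier_vec d \<Longrightarrow> 0 \<le> g x" "\<And>x. x \<in> carrier_vec d \<Longrightarrow> g x \<le> M"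
    "\<And>x j. x \<in> carrier_vec d \<Longrightarrow> g x \<noteq> 0 \<Longrightarrow> j < d \<Longrightarrow> \<bar>x $ j\<bar> \<le> R"
  using assms unfolding usc_test_def by blast

lemma usc_test_zero: "usc_test d (\<lambda>_. 0)"
  by (auto simp: usc_test_def usc_vec_def intro!: exI[of _ 0])

lemma usc_test_add:
  assumes f: "usc_test d f" and g: "usc_test d g" shows "usc_test d (\<lambda>x. f x + g x)"
proof -
  obtain M R where MR: "\<And>x. x \<in> carrier_vec d \<Longrightarrow> 0 \<le> f x" "\<And>x. x \<in> carrier_vec d \<Longrightarrow> f x \<le> M"
    "\<And>x j. x \<in> carrier_vec d \<Longrightarrow> f x \<noteq> 0 \<Longrightarrow> j < d \<Longrightarrow> \<bar>x $ j\<bar> \<le> R" using usc_testE[OF f] by metis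
  obtain M' R' where MR': "\<And>x. x \<in> carrier_vec d \<Longrightarrow> 0 \<le> g x" "\<And>x. x \<in> carrier_vec d \<Longrightarrow> g x \<le> M'"
    "\<And>x j. x \<in> carrier_vec d \<Longrightarrow> g x \<noteq> 0 \<Longrightarrow> j < d \<Longrightarrow> \<bar>x $ j\<bar> \<le> R'" using usc_testE[OF g] by metis
  have "usc_vec d (\<lambda>x. f x + g x)"
    unfolding usc_vec_def
  proof (intro ballI allI impI)
    fix x Z and e :: real
    assume x: "x \<in> carrier_vec d" "\<forall>k. Z k \<in> carrier_vec d" "vec_tendsto d Z x" and e: "0 < e"
    have "\<forall>\<^sub>F k in sequentially. f (Z k) < f x + e / 2" "\<forall>\<^sub>F k in sequentially. g (Z k) < g x + e / 2"
      using f g x e unfolding usc_test_def usc_vec_def by auto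
    then show "\<forall>\<^sub>F k in sequentially. f (Z k) + g (Z k) < f x + g x + e" by eventually_elim linarith
  qed
  moreover have "\<forall>x\<in>carrier_vec d. 0 \<le> f x + g x \<and> f x + g x \<le> M + M' \<and>
      (f x + g x \<noteq> 0 \<longrightarrow> (\<forall>j<d. \<bar>x $ j\<bar> \<le> max R R'))"
    using MR MR' by (fastforce intro: add_mono simp: le_max_iff_disj)
  moreover have "(\<lambda>x. f x + g x) \<in> borel_measurable (lborel_vec d)"
    using f g by (intro borel_measurable_add) (auto simp: usc_test_def)
  ultimately show ?thesis unfolding usc_test_def by blast
qed

lemma usc_test_scale:
  assumes f: "usc_test d f" and c: "0 \<le> c" shows "usc_test d (\<lambda>x. c * f x)"
proof (cases "c = 0")
  case True
  then show ?thesis using usc_test_zero by simp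
next
  case False
  obtain M R where MR: "\<And>x. x \<in> carrier_vec d \<Longrightarrow> 0 \<le> f x" "\<And>x. x \<in> carrier_vec d \<Longrightarrow> f x \<le> M"
    "\<And>x j. x \<in> carrier_vec d \<Longrightarrow> f x \<noteq> 0 \<Longrightarrow> j < d \<Longrightarrow> \<bar>x $ j\<bar> \<le> R" using usc_testE[OF f] by metis
  have "usc_vec d (\<lambda>x. c * f x)"
    unfolding usc_vec_def
  proof (intro ballI allI impI)
    fix x Z and e :: real
    assume x: "x \<in> carrier_vec d" "\<forall>k. Z k \<in> carrier_vec d" "vec_tendsto d Z x" and e: "0 < e"
    have "\<forall>\<^sub>F k in sequentially. f (Z k) < f x + e / c"
      using f x e False c unfolding usc_test_def usc_vec_def by auto
    then show "\<forall>\<^sub>F k in sequentially. c * f (Z k) < c * f x + e"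
      using False c by (auto elim!: eventually_mono simp: field_simps)
  qed
  moreover have "\<forall>x\<in>carrier_vec d. 0 \<le> c * f x \<and> c * f x \<le> c * M \<and> (c * f x \<noteq> 0 \<longrightarrow> (\<forall>j<d. \<bar>x $ j\<bar> \<le> R))"
    using MR c by (auto intro: mult_left_mono)
  moreover have "(\<lambda>x. c * f x) \<in> borel_measurable (lborel_vec d)"
    using f by (intro borel_measurable_times) (auto simp: usc_test_def)
  ultimately show ?thesis unfolding usc_test_def by blast
qed

text \<open>The lower integral with respect to the test functions.  It agrees with the Lebesgue integral on
  measurable functions, which is proved by following the construction of the latter.\<close>

definition test_integral :: "nat \<Rightarrow> (real vec \<Rightarrow> ennreal) \<Rightarrow> ennreal" where
  "test_integral d F = (SUP g\<in>{g. usc_test d g \<and> (\<forall>x\<in>carrier_vec d. ennreal (g x) \<le> F x)}.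
     \<integral>\<^sup>+x. ennreal (g x) \<partial>lborel_vec d)"

lemma test_integral_mono:
  assumes "\<And>x. x \<in> carrier_vec d \<Longrightarrow> F x \<le> G x" shows "test_integral d F \<le> test_integral d G"
  unfolding test_integral_def using assms by (intro SUP_subset_mono) (auto intro: order_trans)

lemma box_in_sets: "{x \<in> carrier_vec d. \<forall>j<d. \<bar>x $ j\<bar> \<le> R} \<in> sets (lborel_vec d)"
proof -
  have "{x \<in> carrier_vec d. \<forall>j<d. \<bar>x $ j\<bar> \<le> R} = {x \<in> space (lborel_vec d). \<forall>j\<in>{..<d}. \<bar>x $ j\<bar> \<le> R}"
    by auto
  also have "\<dots> \<in> sets (lborel_vec d)"
  proof (rule sets.sets_Collect_finite_All)
    fix j assume "j \<in> {..<d}"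
    then have "j < d" by simp
    note [measurable] = measurable_vec_index[OF this]
    show "{x \<in> space (lborel_vec d). \<bar>x $ j\<bar> \<le> R} \<in> sets (lborel_vec d)" by measurable
  qed simp
  finally show ?thesis .
qed

text \<open>Inner regularity on the Polish space of sequences, transported to vectors: the indicator of a compact
  set is upper semicontinuous.\<close>

lemma inner_regular_box:
  assumes A: "A \<in> sets (lborel_vec d)" and box: "\<And>x j. x \<in> A \<Longrightarrow> j < d \<Longrightarrow> \<bar>x $ j\<bar> \<le> R" and R: "0 \<le> R"
  shows "emeasure (lborel_vec d) A \<le> test_integral d (indicator A)"
proof -
  define h where "h = (\<lambda>(x :: real vec) j. if j < d then x $ j else (0 :: real))"
  have h [measurable]: "h \<in> borel_measurable (lborel_vec d)" unfolding h_def by (rule measurable_extend_vec)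
  have Ac: "A \<subseteq> carrier_vec d" using sets.sets_into_space[OF A] by simp
  define Q where "Q = {x \<in> carrier_vec d. \<forall>j<d. \<bar>x $ j\<bar> \<le> R}"
  have Qfin: "emeasure (lborel_vec d) Q < \<infinity>"
  proof -
    let ?P = "\<Pi>\<^sub>M j\<in>{..<d}. (lborel :: real measure)"
    interpret product_sigma_finite "\<lambda>_ :: nat. lborel :: real measure" by (rule product_sigma_finite_lborel)
    have "vec d ` ({..<d} \<rightarrow>\<^sub>E {-R..R}) = Q"
    proof
      show "Q \<subseteq> vec d ` ({..<d} \<rightarrow>\<^sub>E {-R..R})"
      proof
        fix x assume x: "x \<in> Q"
        then have "x = vec d (\<lambda>j\<in>{..<d}. x $ j)" by (auto simp: Q_def)
        moreover have "(\<lambda>j\<in>{..<d}. x $ j) \<in> {..<d} \<rightarrow>\<^sub>E {-R..R}" using x by (auto simp: Q_def abs_le_iff)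
        ultimately show "x \<in> vec d ` ({..<d} \<rightarrow>\<^sub>E {-R..R})" by blast
      qed
    qed (auto simp: Q_def abs_le_iff PiE_def Pi_def)
    then have "emeasure (lborel_vec d) Q = emeasure ?P ({..<d} \<rightarrow>\<^sub>E {-R..R})"
      unfolding lborel_vec_def
      by (subst emeasure_embed_measure_image'[OF inj_on_vec_extensional, symmetric]) (auto intro!: sets_PiM_I_finite)
    also have "\<dots> = (\<Prod>j<d. emeasure lborel {-R..R})" by (rule emeasure_PiM) auto
    also have "\<dots> < \<infinity>" using R by (simp add: ennreal_power)
    finally show ?thesis .
  qed
  define \<nu> where "\<nu> = distr (density (lborel_vec d) (indicator A)) borel h"
  have hd: "h \<in> density (lborel_vec d) (indicator A) \<rightarrow>\<^sub>M borel" using h by simp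
  have \<nu>: "emeasure \<nu> B = emeasure (lborel_vec d) (A \<inter> {x \<in> carrier_vec d. h x \<in> B})" if "B \<in> sets borel" for B
  proof -
    have m: "{x \<in> carrier_vec d. h x \<in> B} \<in> sets (lborel_vec d)"
      using measurable_sets[OF h that] by (simp add: vimage_def Int_def conj_commute)
    have "emeasure \<nu> B = emeasure (density (lborel_vec d) (indicator A)) {x \<in> carrier_vec d. h x \<in> B}"
      unfolding \<nu>_def using that hd by (subst emeasure_distr) (auto simp: vimage_def Int_def conj_commute)
    then show ?thesis using A m by (simp add: emeasure_restricted)
  qed
  \<comment> \<open>\<open>h\<close> is injective with inverse \<open>vec d\<close>, so that \<open>A\<close> is the preimage of a Borel set\<close>
  have vh: "vec d (h x) = x" if "x \<in> carrier_vec d" for x using that by (auto simp: h_def)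
  define B where "B = {\<omega> :: nat \<Rightarrow> real. vec d \<omega> \<in> A}"
  have vm: "(\<lambda>\<omega> :: nat \<Rightarrow> real. vec d \<omega>) \<in> borel \<rightarrow>\<^sub>M lborel_vec d"
    by (rule measurable_lborel_vecI) (auto intro!: borel_measurable_continuous_onI)
  have Bm: "B \<in> sets borel" using measurable_sets[OF vm A] by (simp add: B_def vimage_def)
  have AB: "A \<inter> {x \<in> carrier_vec d. h x \<in> B} = A" using Ac by (auto simp: B_def vh)
  have AQ: "A \<subseteq> Q" using Ac box by (auto simp: Q_def)
  have "emeasure (lborel_vec d) A < \<infinity>"
  proof -
    have "Q \<in> sets (lborel_vec d)"
      unfolding Q_def by (rule box_in_sets)
    then show ?thesis using emeasure_mono[OF AQ] Qfin by (meson order_le_less_trans)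
  qed
  moreover have "emeasure \<nu> (space \<nu>) = emeasure (lborel_vec d) A"
    using \<nu>[of UNIV] Ac by (simp add: \<nu>_def Int_absorb2 subset_eq)
  ultimately have fin: "emeasure \<nu> (space \<nu>) \<noteq> \<infinity>" by simp
  have "emeasure (lborel_vec d) A = emeasure \<nu> B" by (simp add: \<nu>[OF Bm] AB)
  also have "\<dots> = (SUP K\<in>{K. K \<subseteq> B \<and> compact K}. emeasure \<nu> K)"
    by (rule inner_regular[OF _ fin Bm]) (simp add: \<nu>_def)
  also have "\<dots> \<le> test_integral d (indicator A)"
  proof (rule SUP_least)
    fix K assume "K \<in> {K. K \<subseteq> B \<and> compact K}"
    then have KB: "K \<subseteq> B" and K: "compact K" by auto
    have Kb: "K \<in> sets borel" using K by (intro borel_closed compact_imp_closed)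
    define S where "S = {x \<in> carrier_vec d. h x \<in> K}"
    have Sm: "S \<in> sets (lborel_vec d)"
      using measurable_sets[OF h Kb] by (simp add: S_def vimage_def Int_def conj_commute)
    have SA: "S \<subseteq> A" using KB by (auto simp: S_def B_def vh subset_eq)
    have "usc_vec d (indicat_real S)"
      unfolding usc_vec_def
    proof (intro ballI allI impI)
      fix x Z and e :: real
      assume x: "x \<in> carrier_vec d" and Z: "\<forall>k. Z k \<in> carrier_vec d" "vec_tendsto d Z x" and e: "0 < e"
      show "\<forall>\<^sub>F k in sequentially. indicat_real S (Z k) < indicat_real S x + e"
      proof (cases "x \<in> S")
        case True
        then show ?thesis using e by (auto intro!: always_eventually simp: indicator_def)
      next
        case False
        have lim: "(\<lambda>k. h (Z k)) \<longlonglongrightarrow> h x"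
        proof -
          have "(\<lambda>k. h (Z k) j) \<longlonglongrightarrow> h x j" for j
            using Z(2) by (cases "j < d") (auto simp: h_def vec_tendsto_def)
          then have "limitin (product_topology (\<lambda>_. euclidean) UNIV) (\<lambda>k. h (Z k)) (h x) sequentially"
            by (simp add: limitin_componentwise)
          then show ?thesis by (simp add: euclidean_product_topology)
        qed
        have "open (- K)" using K by (simp add: compact_imp_closed open_Compl)
        moreover have "h x \<in> - K" using False x by (simp add: S_def)
        ultimately have "\<forall>\<^sub>F k in sequentially. h (Z k) \<in> - K" using lim by (intro topological_tendstoD)
        then show ?thesis
        proof eventually_elim
          case (elim k)
          then have "Z k \<notin> S" by (simp add: S_def)
          then show ?case using e by (simp add: add_nonneg_pos)
        qed
      qed
    qed
    moreover have "\<forall>x\<in>carrier_vec d. 0 \<le> indicat_real S x \<and> indicat_real S x \<le> 1 \<and>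
        (indicat_real S x \<noteq> 0 \<longrightarrow> (\<forall>j<d. \<bar>x $ j\<bar> \<le> R))"
      using SA box by (auto simp: indicator_def)
    moreover have "indicat_real S \<in> borel_measurable (lborel_vec d)" using Sm by (rule borel_measurable_indicator)
    ultimately have "usc_test d (indicat_real S)" unfolding usc_test_def by blast
    moreover have "ennreal (indicat_real S x) \<le> indicator A x" for x using SA by (auto simp: indicator_def)
    ultimately have "(\<integral>\<^sup>+x. ennreal (indicat_real S x) \<partial>lborel_vec d) \<le> test_integral d (indicator A)"
      unfolding test_integral_def by (intro SUP_upper) auto
    moreover have "(\<integral>\<^sup>+x. ennreal (indicat_real S x) \<partial>lborel_vec d) = emeasure (lborel_vec d) S"
      using Sm by (simp add: ennreal_indicator)
    moreover have "emeasure \<nu> K = emeasure (lborel_vec d) S"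
      using SA by (simp add: \<nu>[OF Kb] S_def[symmetric] Int_absorb1)
    ultimately show "emeasure \<nu> K \<le> test_integral d (indicator A)" by simp
  qed
  finally show ?thesis .
qed

lemma test_integral_indicator:
  assumes A: "A \<in> sets (lborel_vec d)"
  shows "emeasure (lborel_vec d) A \<le> test_integral d (indicator A)"
proof -
  define S where "S = (\<lambda>k. {x \<in> A. \<forall>j<d. \<bar>x $ j\<bar> \<le> real k})"
  have Ac: "A \<subseteq> carrier_vec d" using sets.sets_into_space[OF A] by simp
  have Sm: "S k \<in> sets (lborel_vec d)" for k
  proof -
    have "A \<inter> {x \<in> carrier_vec d. \<forall>j<d. \<bar>x $ j\<bar> \<le> real k} \<in> sets (lborel_vec d)"
      by (rule sets.Int[OF A box_in_sets])
    moreover have "A \<inter> {x \<in> carrier_vec d. \<forall>j<d. \<bar>x $ j\<bar> \<le> real k} = S k"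
      using Ac by (auto simp: S_def)
    ultimately show ?thesis by (simp only:)
  qed
  have "(\<Union>k. S k) = A"
  proof
    show "A \<subseteq> (\<Union>k. S k)"
    proof
      fix x assume "x \<in> A"
      moreover obtain k :: nat where "(\<Sum>j<d. \<bar>x $ j\<bar>) \<le> real k" using real_arch_simple by blast
      then have "\<bar>x $ j\<bar> \<le> real k" if "j < d" for j
        using member_le_sum[of j "{..<d}" "\<lambda>j. \<bar>x $ j\<bar>"] that by simp
      ultimately show "x \<in> (\<Union>k. S k)" by (auto simp: S_def)
    qed
  qed (auto simp: S_def)
  moreover have "incseq S" by (auto simp: incseq_def S_def intro: order_trans)
  ultimately have "emeasure (lborel_vec d) A = (SUP k. emeasure (lborel_vec d) (S k))"
    using SUP_emeasure_incseq[of S "lborel_vec d"] Sm by (simp add: image_subset_iff)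
  also have "\<dots> \<le> test_integral d (indicator A)"
  proof (rule SUP_least)
    fix k
    have "emeasure (lborel_vec d) (S k) \<le> test_integral d (indicator (S k))"
      by (rule inner_regular_box[OF Sm]) (auto simp: S_def)
    also have "\<dots> \<le> test_integral d (indicator A)"
      by (rule test_integral_mono) (auto simp: S_def indicator_def)
    finally show "emeasure (lborel_vec d) (S k) \<le> test_integral d (indicator A)" .
  qed
  finally show ?thesis .
qed

text \<open>Superadditivity of the lower integral and its compatibility with increasing limits carry the
  bound from indicators to measurable functions.  A Lebesgue set contains a Borel set of the same
  measure.\<close>

lemma nn_integral_le_test_integral:
  assumes "F \<in> borel_measurable (lebesgue_vec d)"
  shows "(\<integral>\<^sup>+x. F x \<partial>lebesgue_vec d) \<le> test_integral d F"
  using assms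
proof (induction rule: borel_measurable_induct)
  case (cong f g)
  have "(\<integral>\<^sup>+x. f x \<partial>lebesgue_vec d) = (\<integral>\<^sup>+x. g x \<partial>lebesgue_vec d)" using cong by (intro nn_integral_cong)
  moreover have "test_integral d g \<le> test_integral d f"
    using cong by (intro test_integral_mono) (simp add: lebesgue_vec_eq_completion)
  ultimately show ?case using cong by simp
next
  case (set A)
  let ?A = "main_part (lborel_vec d) A"
  have A: "A \<in> sets (completion (lborel_vec d))" using set by (simp add: lebesgue_vec_eq_completion)
  have "(\<integral>\<^sup>+x. indicator A x \<partial>lebesgue_vec d) = emeasure (lborel_vec d) ?A"
    using A by (simp add: lebesgue_vec_eq_completion)
  also have "\<dots> \<le> test_integral d (indicator ?A)"
    by (rule test_integral_indicator[OF main_part_sets[OF A]])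
  also have "\<dots> \<le> test_integral d (indicator A)"
    using main_part_null_part_Un[OF A] by (intro test_integral_mono) (auto simp: indicator_def)
  finally show ?case .
next
  case (mult u c)
  obtain r where r: "0 \<le> r" "c = ennreal r" using mult by (cases c) auto
  have "(\<integral>\<^sup>+x. c * u x \<partial>lebesgue_vec d) = c * (\<integral>\<^sup>+x. u x \<partial>lebesgue_vec d)"
    using mult by (intro nn_integral_cmult)
  also have "\<dots> \<le> c * test_integral d u" using mult by (intro mult_left_mono) auto
  also have "\<dots> \<le> test_integral d (\<lambda>x. c * u x)"
    unfolding test_integral_def[of d u] SUP_mult_left_ennreal
  proof (rule SUP_least)
    fix g assume g: "g \<in> {g. usc_test d g \<and> (\<forall>x\<in>carrier_vec d. ennreal (g x) \<le> u x)}"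
    then have gm: "g \<in> borel_measurable (lborel_vec d)" by (simp add: usc_test_def)
    have "c * (\<integral>\<^sup>+x. ennreal (g x) \<partial>lborel_vec d) = (\<integral>\<^sup>+x. c * ennreal (g x) \<partial>lborel_vec d)"
      using gm by (intro nn_integral_cmult[symmetric]) simp
    also have "\<dots> = (\<integral>\<^sup>+x. ennreal (r * g x) \<partial>lborel_vec d)"
      using r by (simp add: ennreal_mult')
    also have "\<dots> \<le> test_integral d (\<lambda>x. c * u x)"
      unfolding test_integral_def using g r usc_test_scale[of d g r]
      by (intro SUP_upper) (auto simp: ennreal_mult' intro!: mult_left_mono)
    finally show "c * (\<integral>\<^sup>+x. ennreal (g x) \<partial>lborel_vec d) \<le> test_integral d (\<lambda>x. c * u x)" .
  qed
  finally show ?case .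
next
  case (add u v)
  let ?T = "\<lambda>u. {g. usc_test d g \<and> (\<forall>x\<in>carrier_vec d. ennreal (g x) \<le> u x)}"
  have ne: "?T w \<noteq> {}" for w using usc_test_zero[of d] by auto
  have "(\<integral>\<^sup>+x. v x + u x \<partial>lebesgue_vec d) = (\<integral>\<^sup>+x. v x \<partial>lebesgue_vec d) + (\<integral>\<^sup>+x. u x \<partial>lebesgue_vec d)"
    using add by (intro nn_integral_add)
  also have "\<dots> \<le> test_integral d v + test_integral d u" using add by (intro add_mono)
  also have "\<dots> \<le> test_integral d (\<lambda>x. v x + u x)"
  proof -
    let ?I = "\<lambda>g. \<integral>\<^sup>+x. ennreal (g x) \<partial>lborel_vec d"
    have pair: "?I g + ?I h \<le> test_integral d (\<lambda>x. v x + u x)" if g: "g \<in> ?T v" and h: "h \<in> ?T u" for g h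
    proof -
      have m: "g \<in> borel_measurable (lborel_vec d)" "h \<in> borel_measurable (lborel_vec d)"
        and t: "usc_test d g" "usc_test d h" using g h by (auto simp: usc_test_def)
      have nonneg: "0 \<le> g x" "0 \<le> h x" if "x \<in> carrier_vec d" for x
        using t that by (auto elim!: usc_testE)
      have "(\<integral>\<^sup>+x. ennreal (g x) \<partial>lborel_vec d) + (\<integral>\<^sup>+x. ennreal (h x) \<partial>lborel_vec d) =
          (\<integral>\<^sup>+x. ennreal (g x) + ennreal (h x) \<partial>lborel_vec d)"
        using m by (intro nn_integral_add[symmetric]) auto
      also have "\<dots> = (\<integral>\<^sup>+x. ennreal (g x + h x) \<partial>lborel_vec d)"
        by (intro nn_integral_cong) (simp add: nonneg)
      also have "\<dots> \<le> test_integral d (\<lambda>x. v x + u x)"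
        unfolding test_integral_def using g h nonneg
        by (intro SUP_upper) (auto intro!: usc_test_add add_mono)
      finally show "(\<integral>\<^sup>+x. ennreal (g x) \<partial>lborel_vec d) + (\<integral>\<^sup>+x. ennreal (h x) \<partial>lborel_vec d) \<le>
          test_integral d (\<lambda>x. v x + u x)" .
    qed
    have "?I g + test_integral d u \<le> test_integral d (\<lambda>x. v x + u x)" if g: "g \<in> ?T v" for g
    proof -
      have "?I g + test_integral d u = (SUP h\<in>?T u. ?I g + ?I h)"
        using ennreal_SUP_add_left[OF ne[of u], where f = ?I and c = "?I g"] by (simp add: test_integral_def[of d u] add.commute)
      also have "\<dots> \<le> test_integral d (\<lambda>x. v x + u x)" by (rule SUP_least[OF pair[OF g]])
      finally show ?thesis .
    qed
    note single = this
    have "test_integral d v + test_integral d u = (SUP g\<in>?T v. ?I g + test_integral d u)"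
      unfolding test_integral_def[of d v] by (rule ennreal_SUP_add_left[OF ne, symmetric])
    also have "\<dots> \<le> test_integral d (\<lambda>x. v x + u x)" by (rule SUP_least[OF single])
    finally show ?thesis .
  qed
  finally show ?case .
next
  case (seq U)
  have "(\<integral>\<^sup>+x. (SUP i. U i) x \<partial>lebesgue_vec d) = (SUP i. \<integral>\<^sup>+x. U i x \<partial>lebesgue_vec d)"
    using seq nn_integral_monotone_convergence_SUP[of U "lebesgue_vec d"] by (simp add: image_comp)
  also have "\<dots> \<le> test_integral d (SUP i. U i)"
  proof (rule SUP_least)
    fix i
    have "test_integral d (U i) \<le> test_integral d (SUP i. U i)"
      by (rule test_integral_mono) (auto intro: SUP_upper)
    then show "(\<integral>\<^sup>+x. U i x \<partial>lebesgue_vec d) \<le> test_integral d (SUP i. U i)"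
      using seq by (blast intro: order_trans)
  qed
  finally show ?case .
qed

lemma usc_test_approximation:
  assumes "F \<in> borel_measurable (lebesgue_vec d)" and "r < (\<integral>\<^sup>+x. F x \<partial>lebesgue_vec d)"
  obtains g where "usc_test d g" "\<And>x. x \<in> carrier_vec d \<Longrightarrow> ennreal (g x) \<le> F x"
    "r < (\<integral>\<^sup>+x. ennreal (g x) \<partial>lborel_vec d)"
proof -
  have "r < test_integral d F" using assms(2) nn_integral_le_test_integral[OF assms(1)] by (rule less_le_trans)
  then show ?thesis unfolding test_integral_def less_SUP_iff using that by blast
qed

section \<open>Gaussian vectors with prescribed covariance\<close>

lemma sym_pos_def_scalar_sym:
  assumes "sym_pos_def n A" "x \<in> carrier_vec n" "y \<in> carrier_vec n"
  shows "(A *\<^sub>v x) \<bullet> y = x \<bullet> (A *\<^sub>v y)"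
  using assms by (intro symmetric_mat_scalar_prod[where n = n]) (auto simp: sym_pos_def_def)

lemma sym_pos_def_one: "sym_pos_def n (1\<^sub>m n)"
proof -
  have "0 < x \<bullet> x" if "x \<in> carrier_vec n" "x \<noteq> 0\<^sub>v n" for x :: "real vec"
    using scalar_prod_self_nonneg[of x] scalar_prod_self_eq_0[of x n] that by (auto simp: less_le)
  then show ?thesis by (simp add: sym_pos_def_def)
qed

text \<open>Fewer than \<open>n\<close> linear equations always have a common nonzero solution, so an \<open>A\<close>-orthonormal
  family can be extended one vector at a time.\<close>

lemma extend_orthonormal:
  assumes A: "sym_pos_def n A" and "j \<le> n" and "\<And>a. a < j \<Longrightarrow> p a \<in> carrier_vec n"
    and "\<And>a b. a < j \<Longrightarrow> b < j \<Longrightarrow> p a \<bullet> (A *\<^sub>v p b) = (if a = b then 1 else 0)"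
  shows "\<exists>q. (\<forall>a<j. q a = p a) \<and> (\<forall>a<n. q a \<in> carrier_vec n) \<and>
    (\<forall>a<n. \<forall>b<n. q a \<bullet> (A *\<^sub>v q b) = (if a = b then 1 else 0))"
  using assms(2-)
proof (induction "n - j" arbitrary: j p)
  case 0
  then show ?case by (intro exI[of _ p]) auto
next
  case (Suc k)
  then have jn: "j < n" by simp
  have Ac: "A \<in> carrier_mat n n" using A by (simp add: sym_pos_def_def)
  define N where "N = mat n n (\<lambda>(a, l). if a < j then (A *\<^sub>v p a) $ l else 0)"
  have N: "N \<in> carrier_mat n n" by (simp add: N_def)
  have "N\<^sup>T *\<^sub>v unit_vec n j = 0\<^sub>v n"
    using jn by (intro eq_vecI) (auto simp: N_def)
  then have "det (N\<^sup>T) = 0"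
    using N jn by (subst det_0_iff_vec_prod_zero_field[of _ n]) (auto intro!: exI[of _ "unit_vec n j"])
  then have "det N = 0" using det_transpose[OF N] by simp
  then obtain v where v: "v \<in> carrier_vec n" "v \<noteq> 0\<^sub>v n" "N *\<^sub>v v = 0\<^sub>v n"
    using det_0_iff_vec_prod_zero_field[OF N] by blast
  have orth: "p a \<bullet> (A *\<^sub>v v) = 0" if a: "a < j" for a
  proof -
    have "(N *\<^sub>v v) $ a = 0" using v(3) a jn by simp
    moreover have "row N a = A *\<^sub>v p a" using a jn Ac by (intro eq_vecI) (auto simp: N_def)
    ultimately have "(A *\<^sub>v p a) \<bullet> v = 0" using a jn N by simp
    then show ?thesis using sym_pos_def_scalar_sym[OF A Suc.prems(2)[OF a] v(1)] by simp
  qed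
  define s where "s = (A *\<^sub>v v) \<bullet> v"
  have s: "0 < s" using A v by (auto simp: sym_pos_def_def s_def)
  define w where "w = (1 / sqrt s) \<cdot>\<^sub>v v"
  have w: "w \<in> carrier_vec n" using v by (simp add: w_def)
  have Aw: "A *\<^sub>v w = (1 / sqrt s) \<cdot>\<^sub>v (A *\<^sub>v v)" using Ac v by (simp add: w_def mult_mat_vec[of _ n n])
  have Av: "A *\<^sub>v v \<in> carrier_vec n" using Ac v by simp
  have vs: "v \<bullet> (A *\<^sub>v v) = s" using comm_scalar_prod[OF v(1) Av] by (simp add: s_def)
  have "w \<bullet> (A *\<^sub>v w) = (1 / sqrt s) * ((1 / sqrt s) * s)"
    unfolding Aw using v Av vs by (simp add: w_def)
  then have ww: "w \<bullet> (A *\<^sub>v w) = 1" using s by simp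
  have pw: "p a \<bullet> (A *\<^sub>v w) = 0" if "a < j" for a
    using orth[OF that] Suc.prems(2)[OF that] Av by (simp add: Aw)
  have wp: "w \<bullet> (A *\<^sub>v p a) = 0" if "a < j" for a
    using pw[OF that] sym_pos_def_scalar_sym[OF A w Suc.prems(2)[OF that]]
      comm_scalar_prod[OF Suc.prems(2)[OF that], of "A *\<^sub>v w"] Ac w by simp
  have "\<exists>q. (\<forall>a<Suc j. q a = (p(j := w)) a) \<and> (\<forall>a<n. q a \<in> carrier_vec n) \<and>
      (\<forall>a<n. \<forall>b<n. q a \<bullet> (A *\<^sub>v q b) = (if a = b then 1 else 0))"
    using Suc jn w ww pw wp by (intro Suc.hyps(1)) (auto simp: less_Suc_eq)
  then show ?case by (auto simp: less_Suc_eq)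
qed

lemma orthonormal_basis_matrix:
  fixes A :: "real mat"
  assumes A: "A \<in> carrier_mat n n" and q: "\<And>a. a < n \<Longrightarrow> q a \<in> carrier_vec n"
    and orth: "\<And>a b. a < n \<Longrightarrow> b < n \<Longrightarrow> q a \<bullet> (A *\<^sub>v q b) = (if a = b then 1 else 0)"
  defines "P \<equiv> mat n n (\<lambda>(l, a). q a $ l)"
  shows "P \<in> carrier_mat n n" "P\<^sup>T * A * P = 1\<^sub>m n"
proof -
  show P: "P \<in> carrier_mat n n" by (simp add: P_def)
  have col: "col P a = q a" if "a < n" for a using q[OF that] that by (intro eq_vecI) (auto simp: P_def)
  have "P\<^sup>T * (A * P) = 1\<^sub>m n"
  proof (rule eq_matI)
    fix a b assume "a < dim_row (1\<^sub>m n :: real mat)" "b < dim_col (1\<^sub>m n :: real mat)"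
    then have ab: "a < n" "b < n" by auto
    have "(P\<^sup>T * (A * P)) $$ (a, b) = col P a \<bullet> col (A * P) b" using ab P A by simp
    also have "\<dots> = q a \<bullet> (A *\<^sub>v q b)" using ab by (simp add: col_mult2[OF A P] col)
    finally show "(P\<^sup>T * (A * P)) $$ (a, b) = 1\<^sub>m n $$ (a, b)" using ab orth by simp
  qed (use P A in auto)
  then show "P\<^sup>T * A * P = 1\<^sub>m n" using P A by (simp add: assoc_mult_mat[of _ n n _ n _ n])
qed

text \<open>The columns of \<open>P\<close> form an \<open>A\<close>-orthonormal basis, so that \<open>P P\<^sup>T\<close> is the inverse of \<open>A\<close>.\<close>

lemma sym_pos_def_factor:
  assumes A: "sym_pos_def n A"
  obtains P where "P \<in> carrier_mat n n" "P\<^sup>T * A * P = 1\<^sub>m n"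
proof -
  have Ac: "A \<in> carrier_mat n n" using A by (simp add: sym_pos_def_def)
  obtain q where "\<forall>a<n. q a \<in> carrier_vec n" "\<forall>a<n. \<forall>b<n. q a \<bullet> (A *\<^sub>v q b) = (if a = b then 1 else 0)"
    using extend_orthonormal[OF A, of 0] by auto
  then show ?thesis using orthonormal_basis_matrix[OF Ac, of q] that by blast
qed

lemma factor_facts:
  fixes A P :: "real mat"
  assumes A: "A \<in> carrier_mat n n" and P: "P \<in> carrier_mat n n" and PAP: "P\<^sup>T * A * P = 1\<^sub>m n"
  shows "det P \<noteq> 0" "0 < det A" "\<bar>det P\<bar> = 1 / sqrt (det A)"
    "A * (P * P\<^sup>T) = 1\<^sub>m n" "(P * P\<^sup>T) * A = 1\<^sub>m n"
proof -
  have PT: "P\<^sup>T \<in> carrier_mat n n" using P by simp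
  have "det (P\<^sup>T * A * P) = det P * det A * det P"
    using A P PT by (simp add: det_mult[of _ n] det_transpose[OF P])
  then have d: "det P * det A * det P = 1" using PAP by simp
  then show "det P \<noteq> 0" by auto
  have d2: "(det P)\<^sup>2 * det A = 1" using d by (simp add: power2_eq_square mult_ac)
  then show dA: "0 < det A" using mult_nonneg_nonpos[OF zero_le_power2[of "det P"], of "det A"] by (cases "0 < det A") auto
  have "\<bar>det P\<bar> * sqrt (det A) = sqrt ((det P)\<^sup>2 * det A)" by (simp add: real_sqrt_mult)
  then show "\<bar>det P\<bar> = 1 / sqrt (det A)" using d2 dA by (simp add: field_simps)
  have "P\<^sup>T * (A * P) = 1\<^sub>m n" using PAP A P PT by (simp add: assoc_mult_mat[of _ n n _ n _ n])
  then have "(A * P) * P\<^sup>T = 1\<^sub>m n" using A P PT by (intro mat_mult_left_right_inverse[of "P\<^sup>T" n "A * P"]) auto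
  then show "A * (P * P\<^sup>T) = 1\<^sub>m n" using A P PT by (simp add: assoc_mult_mat[of _ n n _ n _ n])
  then show "(P * P\<^sup>T) * A = 1\<^sub>m n" using A P PT by (intro mat_mult_left_right_inverse[of A n "P * P\<^sup>T"]) auto
qed

lemma mat_inv_eq:
  assumes A: "A \<in> carrier_mat n n" and X: "X \<in> carrier_mat n n" and AX: "A * X = 1\<^sub>m n"
  shows "mat_inv A = X"
proof -
  have XA: "X * A = 1\<^sub>m n" by (rule mat_mult_left_right_inverse[OF A X AX])
  show ?thesis
  proof (cases "mat_inverse A")
    case None
    from mat_inverse(1)[OF A this, of undefined] have "A \<notin> Units (ring_mat TYPE(real) n undefined)" .
    moreover have "A \<in> Units (ring_mat TYPE(real) n undefined)"
      unfolding Units_def using A X AX XA by (auto simp: ring_mat_simps)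
    ultimately show ?thesis by blast
  next
    case (Some Y)
    have Y: "Y \<in> carrier_mat n n" "Y * A = 1\<^sub>m n" using mat_inverse(2)[OF A Some] by auto
    have "Y = Y * (A * X)" using Y AX by simp
    also have "\<dots> = (Y * A) * X" by (rule assoc_mult_mat[OF Y(1) A X, symmetric])
    also have "\<dots> = X" unfolding Y(2) using X by simp
    finally show ?thesis by (simp add: mat_inv_def Some)
  qed
qed

lemma measurable_gaussian [measurable]:
  assumes "S \<in> carrier_mat k k" shows "gaussian S \<in> borel_measurable (lborel_vec k)"
proof -
  have "(\<lambda>y. (S *\<^sub>v y) \<bullet> y) \<in> borel_measurable (lborel_vec k)"
    using measurable_mult_mat_vec[OF assms] by (intro measurable_scalar_prod[where n = k]) auto
  then show ?thesis unfolding gaussian_def by measurable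
qed

text \<open>The linear substitution \<open>y = M \<xi>\<close> turns the weight into the standard Gaussian one.\<close>

lemma gauss_law_square:
  assumes S: "sym_pos_def k S" and M: "M \<in> carrier_mat k k" and MSM: "M\<^sup>T * S * M = 1\<^sub>m k"
    and F: "F \<in> borel_measurable (lborel_vec k)"
  shows "(\<integral>\<^sup>+y. F y * ennreal (gaussian S y) \<partial>lborel_vec k) =
    ennreal (sqrt (2 * pi) ^ k / sqrt (det S)) * (\<integral>\<^sup>+\<xi>. F (M *\<^sub>v \<xi>) \<partial>std_gauss k)"
proof -
  have Sc: "S \<in> carrier_mat k k" using S by (simp add: sym_pos_def_def)
  note f = factor_facts[OF Sc M MSM]
  have Hm: "(\<lambda>y. F y * ennreal (gaussian S y)) \<in> borel_measurable (lborel_vec k)"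
    using F measurable_gaussian[OF Sc] by (intro borel_measurable_times_ennreal) auto
  have FM: "(\<lambda>\<xi>. F (M *\<^sub>v \<xi>)) \<in> borel_measurable (lborel_vec k)"
    by (rule measurable_compose[OF measurable_mult_mat_vec[OF M] F])
  have g: "gaussian S (M *\<^sub>v x) = sqrt (2 * pi) ^ k * gauss_density k x" if x: "x \<in> carrier_vec k" for x
  proof -
    have "(S *\<^sub>v (M *\<^sub>v x)) \<bullet> (M *\<^sub>v x) = (M\<^sup>T *\<^sub>v (S *\<^sub>v (M *\<^sub>v x))) \<bullet> x"
      using M Sc x by (intro transpose_vec_mult_scalar[symmetric]) auto
    also have "M\<^sup>T *\<^sub>v (S *\<^sub>v (M *\<^sub>v x)) = (M\<^sup>T * S * M) *\<^sub>v x"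
      using M Sc x by (simp add: assoc_mult_mat_vec[of _ k k _ k])
    also have "\<dots> = x" using MSM x by simp
    finally show ?thesis by (simp add: gaussian_def gauss_density_def)
  qed
  have "(\<integral>\<^sup>+y. F y * ennreal (gaussian S y) \<partial>lborel_vec k) =
      ennreal \<bar>det M\<bar> * (\<integral>\<^sup>+x. F (M *\<^sub>v x) * ennreal (gaussian S (M *\<^sub>v x)) \<partial>lborel_vec k)"
    by (rule nn_integral_lborel_vec_linear[OF Hm M f(1)])
  also have "(\<integral>\<^sup>+x. F (M *\<^sub>v x) * ennreal (gaussian S (M *\<^sub>v x)) \<partial>lborel_vec k) =
      (\<integral>\<^sup>+x. ennreal (sqrt (2 * pi) ^ k) * (ennreal (gauss_density k x) * F (M *\<^sub>v x)) \<partial>lborel_vec k)"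
    by (rule nn_integral_cong) (simp add: g ennreal_mult gauss_density_pos less_imp_le mult_ac)
  also have "\<dots> = ennreal (sqrt (2 * pi) ^ k) * (\<integral>\<^sup>+x. ennreal (gauss_density k x) * F (M *\<^sub>v x) \<partial>lborel_vec k)"
    using FM measurable_gauss_density by (intro nn_integral_cmult borel_measurable_times_ennreal) auto
  also have "(\<integral>\<^sup>+x. ennreal (gauss_density k x) * F (M *\<^sub>v x) \<partial>lborel_vec k) = (\<integral>\<^sup>+\<xi>. F (M *\<^sub>v \<xi>) \<partial>std_gauss k)"
    by (rule nn_integral_std_gauss[OF FM, symmetric])
  also have "ennreal \<bar>det M\<bar> * (ennreal (sqrt (2 * pi) ^ k) * (\<integral>\<^sup>+\<xi>. F (M *\<^sub>v \<xi>) \<partial>std_gauss k)) =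
      ennreal (sqrt (2 * pi) ^ k / sqrt (det S)) * (\<integral>\<^sup>+\<xi>. F (M *\<^sub>v \<xi>) \<partial>std_gauss k)"
    unfolding f(3) mult.assoc[symmetric] by (subst ennreal_mult[symmetric]) (use f(2) in simp_all)
  finally show ?thesis .
qed

lemma std_gauss_orthogonal:
  assumes O: "U \<in> carrier_mat k k" "U\<^sup>T * U = 1\<^sub>m k" and F: "F \<in> borel_measurable (lborel_vec k)"
  shows "(\<integral>\<^sup>+\<xi>. F (U *\<^sub>v \<xi>) \<partial>std_gauss k) = (\<integral>\<^sup>+\<xi>. F \<xi> \<partial>std_gauss k)"
proof -
  have "ennreal (sqrt (2 * pi) ^ k / sqrt (det (1\<^sub>m k :: real mat))) * (\<integral>\<^sup>+\<xi>. F (U *\<^sub>v \<xi>) \<partial>std_gauss k) =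
      ennreal (sqrt (2 * pi) ^ k / sqrt (det (1\<^sub>m k :: real mat))) * (\<integral>\<^sup>+\<xi>. F (1\<^sub>m k *\<^sub>v \<xi>) \<partial>std_gauss k)"
    using O by (subst (1 2) gauss_law_square[OF sym_pos_def_one _ _ F, symmetric]) simp_all
  then have "(\<integral>\<^sup>+\<xi>. F (U *\<^sub>v \<xi>) \<partial>std_gauss k) = (\<integral>\<^sup>+\<xi>. F (1\<^sub>m k *\<^sub>v \<xi>) \<partial>std_gauss k)"
    by (subst (asm) ennreal_mult_cancel_left) auto
  also have "\<dots> = (\<integral>\<^sup>+\<xi>. F \<xi> \<partial>std_gauss k)" by (rule nn_integral_cong) simp
  finally show ?thesis .
qed

text \<open>The image of the standard Gaussian measure under a matrix \<open>Q\<close> depends on \<open>Q * Q\<^sup>T\<close> only: \<open>Q\<close> is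
  a square matrix times orthonormal rows, and orthonormal rows can be completed to an orthogonal
  matrix.\<close>

lemma gauss_law:
  assumes S: "sym_pos_def d S" and Q: "Q \<in> carrier_mat d n" and QQS: "(Q * Q\<^sup>T) * S = 1\<^sub>m d"
    and F: "F \<in> borel_measurable (lborel_vec d)"
  shows "(\<integral>\<^sup>+y. F y * ennreal (gaussian S y) \<partial>lborel_vec d) =
    ennreal (sqrt (2 * pi) ^ d / sqrt (det S)) * (\<integral>\<^sup>+\<xi>. F (Q *\<^sub>v \<xi>) \<partial>std_gauss n)"
proof -
  have Sc: "S \<in> carrier_mat d d" and St: "S\<^sup>T = S" using S by (auto simp: sym_pos_def_def)
  obtain L where L: "L \<in> carrier_mat d d" and LSL: "L\<^sup>T * S * L = 1\<^sub>m d" using sym_pos_def_factor[OF S] .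
  have LT: "L\<^sup>T \<in> carrier_mat d d" and QT: "Q\<^sup>T \<in> carrier_mat n d" using L Q by auto
  note f = factor_facts[OF Sc L LSL]
  define R where "R = L\<^sup>T * (S * Q)"
  have R: "R \<in> carrier_mat d n" using L Sc Q by (simp add: R_def)
  have RT: "R\<^sup>T = Q\<^sup>T * (S * L)"
    unfolding R_def using L Sc Q LT by (simp add: transpose_mult[of _ d d _ n] transpose_mult[of _ d d _ n] St assoc_mult_mat[of _ n d _ d _ d])
  have RR: "R * R\<^sup>T = 1\<^sub>m d"
  proof -
    have "R * R\<^sup>T = R * (Q\<^sup>T * (S * L))" by (simp only: RT)
    also have "\<dots> = L\<^sup>T * (S * ((Q * Q\<^sup>T) * S)) * L"
      unfolding R_def using L LT Sc Q QT
      by (simp add: assoc_mult_mat[of _ d d _ d _ d] assoc_mult_mat[of _ d d _ n _ d] assoc_mult_mat[of _ d n _ d _ d]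
          assoc_mult_mat[of _ d n _ n _ d] assoc_mult_mat[of _ n d _ d _ d])
    also have "\<dots> = L\<^sup>T * S * L" using Sc by (simp add: QQS)
    finally show ?thesis by (simp add: LSL)
  qed
  have LR: "L * R = Q"
  proof -
    have "L * R = ((L * L\<^sup>T) * S) * Q"
      unfolding R_def using L LT Sc Q
      by (simp add: assoc_mult_mat[of _ d d _ d _ d] assoc_mult_mat[of _ d d _ d _ n])
    then show ?thesis using f(5) Q by simp
  qed
  define r where "r = (\<lambda>a. row R a)"
  have r: "r a \<in> carrier_vec n" if "a < d" for a using R that by (simp add: r_def)
  have rr: "r a \<bullet> r b = (if a = b then 1 else 0)" if "a < d" "b < d" for a b
  proof -
    have "r a \<bullet> r b = (R * R\<^sup>T) $$ (a, b)" using that R by (simp add: r_def)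
    then show ?thesis using that by (simp add: RR)
  qed
  have complete: "\<exists>q. (\<forall>a<j. q a = r a) \<and> (\<forall>a<n. q a \<in> carrier_vec n) \<and>
      (\<forall>a<n. \<forall>b<n. q a \<bullet> q b = (if a = b then 1 else 0))" if "j \<le> n" "j \<le> d" for j
  proof -
    have "\<exists>q. (\<forall>a<j. q a = r a) \<and> (\<forall>a<n. q a \<in> carrier_vec n) \<and>
        (\<forall>a<n. \<forall>b<n. q a \<bullet> (1\<^sub>m n *\<^sub>v q b) = (if a = b then 1 else 0))"
      using that r rr by (intro extend_orthonormal[OF sym_pos_def_one]) (auto intro: less_le_trans)
    then show ?thesis by (metis one_mult_mat_vec)
  qed
  have basis: "\<exists>U \<in> carrier_mat n n. U\<^sup>T * U = 1\<^sub>m n \<and> (\<forall>a<n. row U a = q a)"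
    if q: "\<forall>a<n. q a \<in> carrier_vec n" "\<forall>a<n. \<forall>b<n. q a \<bullet> q b = (if a = b then 1 else 0)" for q :: "nat \<Rightarrow> real vec"
  proof -
    define P where "P = mat n n (\<lambda>(l, a). q a $ l)"
    have P: "P \<in> carrier_mat n n" by (simp add: P_def)
    have PP: "P\<^sup>T * 1\<^sub>m n * P = 1\<^sub>m n"
      unfolding P_def by (rule orthonormal_basis_matrix(2)[where q = q]) (use q in simp_all)
    have PT: "P\<^sup>T \<in> carrier_mat n n" using P by simp
    have "P * P\<^sup>T = 1\<^sub>m n" using P PT PP by (intro mat_mult_left_right_inverse[of "P\<^sup>T" n P]) auto
    moreover have "row (P\<^sup>T) a = q a" if "a < n" for a
      using q(1) that P by (intro eq_vecI) (auto simp: P_def)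
    ultimately show ?thesis using PT by (intro bexI[of _ "P\<^sup>T"]) auto
  qed
  \<comment> \<open>an orthonormal family in \<open>n\<close>-space has at most \<open>n\<close> members\<close>
  have dn: "d \<le> n"
  proof (rule ccontr)
    assume "\<not> d \<le> n"
    then have nd: "n < d" by simp
    obtain q where q: "\<forall>a<n. q a = r a" "\<forall>a<n. q a \<in> carrier_vec n" "\<forall>a<n. \<forall>b<n. q a \<bullet> q b = (if a = b then 1 else 0)"
      using complete[of n] nd by auto
    obtain U where U: "U \<in> carrier_mat n n" "U\<^sup>T * U = 1\<^sub>m n" "\<forall>a<n. row U a = q a" using basis[OF q(2,3)] by blast
    have "U *\<^sub>v r n = 0\<^sub>v n" using U q(1) rr nd by (intro eq_vecI) auto
    then have "U\<^sup>T *\<^sub>v (U *\<^sub>v r n) = U\<^sup>T *\<^sub>v 0\<^sub>v n" by simp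
    moreover have "U\<^sup>T *\<^sub>v (U *\<^sub>v r n) = r n"
      using U(1,2) r[OF nd] assoc_mult_mat_vec[of "U\<^sup>T" n n U n "r n"] by simp
    moreover have "U\<^sup>T *\<^sub>v 0\<^sub>v n = 0\<^sub>v n" using U(1) by (intro eq_vecI) auto
    ultimately show False using rr[OF nd nd] by simp
  qed
  obtain q where q: "\<forall>a<d. q a = r a" "\<forall>a<n. q a \<in> carrier_vec n" "\<forall>a<n. \<forall>b<n. q a \<bullet> q b = (if a = b then 1 else 0)"
    using complete[of d] dn by auto
  obtain U where U: "U \<in> carrier_mat n n" "U\<^sup>T * U = 1\<^sub>m n" "\<forall>a<n. row U a = q a" using basis[OF q(2,3)] by blast
  have FL: "(\<lambda>y. F (L *\<^sub>v y)) \<in> borel_measurable (lborel_vec d)"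
    by (rule measurable_compose[OF measurable_mult_mat_vec[OF L] F])
  have FLt: "(\<lambda>x. F (L *\<^sub>v vec d (\<lambda>j. x $ j))) \<in> borel_measurable (lborel_vec n)"
    by (rule measurable_compose[OF measurable_take_coordinates[OF dn] FL])
  have "(\<integral>\<^sup>+\<xi>. F (Q *\<^sub>v \<xi>) \<partial>std_gauss n) = (\<integral>\<^sup>+\<xi>. F (L *\<^sub>v vec d (\<lambda>j. (U *\<^sub>v \<xi>) $ j)) \<partial>std_gauss n)"
  proof (rule nn_integral_cong)
    fix \<xi> assume "\<xi> \<in> space (std_gauss n)"
    then have \<xi>: "\<xi> \<in> carrier_vec n" by simp
    have "vec d (\<lambda>j. (U *\<^sub>v \<xi>) $ j) = R *\<^sub>v \<xi>"
      using U q(1) R dn by (intro eq_vecI) (auto simp: r_def)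
    then show "F (Q *\<^sub>v \<xi>) = F (L *\<^sub>v vec d (\<lambda>j. (U *\<^sub>v \<xi>) $ j))"
      using L R \<xi> LR assoc_mult_mat_vec[OF L R \<xi>] by simp
  qed
  also have "\<dots> = (\<integral>\<^sup>+\<xi>. F (L *\<^sub>v vec d (\<lambda>j. \<xi> $ j)) \<partial>std_gauss n)"
    by (rule std_gauss_orthogonal[OF U(1,2) FLt])
  also have "\<dots> = (\<integral>\<^sup>+\<xi>. F (L *\<^sub>v \<xi>) \<partial>std_gauss d)"
    by (rule nn_integral_std_gauss_take[OF FL dn])
  finally show ?thesis using gauss_law_square[OF S L LSL F] by simp
qed

section \<open>The frame attached to a Brascamp-Lieb datum\<close>

text \<open>Associativity with hypotheses on dimensions, which rewriting can discharge for products of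
  matrices of different shapes.\<close>

lemma mult_assoc_dim:
  fixes A :: "real mat"
  assumes "dim_col A = dim_row B" "dim_col B = dim_row C"
  shows "A * B * C = A * (B * C)"
  using assms by (intro assoc_mult_mat[of A "dim_row A" "dim_row B" B "dim_row C" C "dim_col C"]) auto

lemma transpose_mult_dim:
  fixes A :: "real mat"
  assumes "dim_col A = dim_row B"
  shows "(A * B)\<^sup>T = B\<^sup>T * A\<^sup>T"
  using assms by (intro transpose_mult[of A "dim_row A" "dim_row B" B "dim_col B"]) auto

lemma finsum_mat_index:
  assumes "finite I" and "\<And>i. i \<in> I \<Longrightarrow> f i \<in> carrier_mat k l"
  shows "finsum_mat k l f I \<in> carrier_mat k l \<and>
    (\<forall>a<k. \<forall>b<l. finsum_mat k l f I $$ (a, b) = (\<Sum>i\<in>I. f i $$ (a, b)))"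
  using assms
proof (induction I rule: finite_induct)
  case empty
  interpret comm_monoid "monoid_mat TYPE(real) k l" by (rule comm_monoid_mat)
  show ?case unfolding finsum_mat_def finprod_empty by (simp add: monoid_mat_def)
next
  case (insert i I)
  interpret comm_monoid "monoid_mat TYPE(real) k l" by (rule comm_monoid_mat)
  have "finsum_mat k l f (insert i I) = f i + finsum_mat k l f I"
    unfolding finsum_mat_def using insert by (subst finprod_insert) (auto simp: monoid_mat_def)
  then show ?case using insert by auto
qed

lemma abs_quadratic_form_le:
  fixes M :: "real mat"
  assumes "M \<in> carrier_mat k k" "z \<in> carrier_vec k" "\<And>j. j < k \<Longrightarrow> \<bar>z $ j\<bar> \<le> R"
  shows "\<bar>(M *\<^sub>v z) \<bullet> z\<bar> \<le> (\<Sum>a<k. \<Sum>b<k. \<bar>M $$ (a, b)\<bar> * (R * R))"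
proof -
  have "(M *\<^sub>v z) \<bullet> z = (\<Sum>a<k. \<Sum>b<k. M $$ (a, b) * z $ b * z $ a)"
    using assms mult_mat_vec_index[OF assms(1,2)] by (simp add: scalar_prod_real[where n = k] sum_distrib_right)
  also have "\<bar>\<dots>\<bar> \<le> (\<Sum>a<k. \<Sum>b<k. \<bar>M $$ (a, b) * z $ b * z $ a\<bar>)"
    by (intro order_trans[OF sum_abs] sum_mono sum_abs)
  also have "\<dots> \<le> (\<Sum>a<k. \<Sum>b<k. \<bar>M $$ (a, b)\<bar> * (R * R))"
  proof (intro sum_mono)
    fix a b assume "a \<in> {..<k}" "b \<in> {..<k}"
    then have "\<bar>z $ b\<bar> * \<bar>z $ a\<bar> \<le> R * R" using assms(3) by (intro mult_mono) (auto intro: order_trans[OF abs_ge_zero])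
    then show "\<bar>M $$ (a, b) * z $ b * z $ a\<bar> \<le> \<bar>M $$ (a, b)\<bar> * (R * R)"
      unfolding abs_mult mult.assoc by (intro mult_left_mono) auto
  qed
  finally show ?thesis .
qed

lemma vnorm_mult_mat_vec_le:
  assumes "M \<in> carrier_mat n k" "z \<in> carrier_vec k" "\<And>j. j < k \<Longrightarrow> \<bar>z $ j\<bar> \<le> R"
  shows "vnorm (M *\<^sub>v z) \<le> (\<Sum>a<n. \<Sum>b<k. \<bar>M $$ (a, b)\<bar> * \<bar>R\<bar>)"
proof -
  have Mz: "M *\<^sub>v z \<in> carrier_vec n" using assms by simp
  have "vnorm (M *\<^sub>v z) = L2_set (\<lambda>a. (M *\<^sub>v z) $ a) {..<n}"
    using Mz by (simp add: vnorm_def L2_set_def scalar_prod_real[OF Mz] power2_eq_square del: index_mult_mat_vec)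
  also have "\<dots> \<le> (\<Sum>a<n. \<bar>(M *\<^sub>v z) $ a\<bar>)" by (rule L2_set_le_sum_abs)
  also have "\<dots> \<le> (\<Sum>a<n. \<Sum>b<k. \<bar>M $$ (a, b)\<bar> * \<bar>R\<bar>)"
  proof (rule sum_mono)
    fix a assume "a \<in> {..<n}"
    then have "\<bar>(M *\<^sub>v z) $ a\<bar> = \<bar>\<Sum>b<k. M $$ (a, b) * z $ b\<bar>" using mult_mat_vec_index[OF assms(1,2)] by simp
    also have "\<dots> \<le> (\<Sum>b<k. \<bar>M $$ (a, b) * z $ b\<bar>)" by (rule sum_abs)
    also have "\<dots> \<le> (\<Sum>b<k. \<bar>M $$ (a, b)\<bar> * \<bar>R\<bar>)"
      unfolding abs_mult using assms(3) by (intro sum_mono mult_left_mono) (auto intro: order_trans[OF _ abs_ge_self])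
    finally show "\<bar>(M *\<^sub>v z) $ a\<bar> \<le> (\<Sum>b<k. \<bar>M $$ (a, b)\<bar> * \<bar>R\<bar>)" .
  qed
  finally show ?thesis .
qed

lemma usc_vec_compose_mat:
  assumes g: "usc_vec d g" and M: "M \<in> carrier_mat d n"
  shows "usc_vec n (\<lambda>x. g (M *\<^sub>v x))"
  unfolding usc_vec_def
proof (intro ballI allI impI)
  fix x Z and e :: real
  assume x: "x \<in> carrier_vec n" and Z: "\<forall>k. Z k \<in> carrier_vec n" "vec_tendsto n Z x" and e: "0 < e"
  have "vec_tendsto d (\<lambda>k. M *\<^sub>v Z k) (M *\<^sub>v x)"
    unfolding vec_tendsto_def
  proof (intro allI impI)
    fix j assume j: "j < d"
    have "(\<lambda>k. \<Sum>l<n. M $$ (j, l) * Z k $ l) \<longlonglongrightarrow> (\<Sum>l<n. M $$ (j, l) * x $ l)"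
      using Z(2) by (intro tendsto_intros) (auto simp: vec_tendsto_def)
    then show "(\<lambda>k. (M *\<^sub>v Z k) $ j) \<longlonglongrightarrow> (M *\<^sub>v x) $ j"
      using Z(1) x j by (simp add: mult_mat_vec_index[OF M] del: index_mult_mat_vec)
  qed
  moreover have "\<forall>k. M *\<^sub>v Z k \<in> carrier_vec d" "M *\<^sub>v x \<in> carrier_vec d" using M Z(1) x by auto
  ultimately show "\<forall>\<^sub>F k in sequentially. g (M *\<^sub>v Z k) < g (M *\<^sub>v x) + e"
    using g[unfolded usc_vec_def, rule_format, of "M *\<^sub>v x" "\<lambda>k. M *\<^sub>v Z k" e] e by blast
qed

text \<open>A matrix \<open>P\<close> with \<open>P P\<^sup>T = A\<^sup>-\<^sup>1\<close> is kept as a parameter; any two differ by an orthogonal change of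
  coordinates.\<close>

locale gaussian_datum =
  fixes n m :: nat and d :: "nat \<Rightarrow> nat" and c :: "nat \<Rightarrow> real" and B :: "nat \<Rightarrow> real mat" and A P :: "real mat"
  assumes datum: "BL_datum n m d c B"
    and dims: "(\<Sum>i<m. c i * real (d i)) = real n"
    and A: "sym_pos_def n A"
    and A_inv: "mat_inv A =
      finsum_mat n n (\<lambda>i. c i \<cdot>\<^sub>m ((B i)\<^sup>T * mat_inv (B i * A * (B i)\<^sup>T) * B i)) {..<m}"
    and P: "P \<in> carrier_mat n n" and PAP: "P\<^sup>T * A * P = 1\<^sub>m n"
begin

definition S :: "nat \<Rightarrow> real mat" where "S i = B i * A * (B i)\<^sup>T"
definition X :: "nat \<Rightarrow> real mat" where "X i = mat_inv (S i)"

text \<open>\<open>Q i\<close> sends the standard Gaussian vector to one with covariance \<open>X i\<close>, and \<open>E i\<close> is the orthogonal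
  projection onto the orthogonal complement of its kernel.\<close>

definition Q :: "nat \<Rightarrow> real mat" where "Q i = X i * (B i * (A * P))"
definition E :: "nat \<Rightarrow> real mat" where "E i = P\<^sup>T * (A * ((B i)\<^sup>T * Q i))"

lemma A_carrier: "A \<in> carrier_mat n n" and A_sym: "A\<^sup>T = A"
  using A by (auto simp: sym_pos_def_def)

lemma c_pos: "i < m \<Longrightarrow> 0 < c i" and B_carrier: "i < m \<Longrightarrow> B i \<in> carrier_mat (d i) n"
  using datum by (auto simp: BL_datum_def)

lemma PT: "P\<^sup>T \<in> carrier_mat n n" using P by simp
lemma BT: "i < m \<Longrightarrow> (B i)\<^sup>T \<in> carrier_mat n (d i)" using B_carrier by simp

lemma S_carrier: "i < m \<Longrightarrow> S i \<in> carrier_mat (d i) (d i)"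
  using carrier_matD[OF A_carrier] carrier_matD[OF B_carrier] by (intro carrier_matI) (simp_all add: S_def)

lemma S_pos_def: assumes i: "i < m" shows "sym_pos_def (d i) (S i)"
  unfolding sym_pos_def_def
proof (intro conjI ballI impI)
  note car = A_carrier B_carrier[OF i] BT[OF i]
  show "S i \<in> carrier_mat (d i) (d i)" by (rule S_carrier[OF i])
  show "(S i)\<^sup>T = S i"
    unfolding S_def using carrier_matD[OF car(1)] carrier_matD[OF car(2)] A_sym by (simp add: transpose_mult_dim mult_assoc_dim)
  fix x :: "real vec" assume x: "x \<in> carrier_vec (d i)" "x \<noteq> 0\<^sub>v (d i)"
  define y where "y = (B i)\<^sup>T *\<^sub>v x"
  have y: "y \<in> carrier_vec n" using car x by (simp add: y_def)
  have "x \<in> (\<lambda>x. B i *\<^sub>v x) ` carrier_vec n" using datum i x by (simp add: BL_datum_def)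
  then obtain z where z: "z \<in> carrier_vec n" "x = B i *\<^sub>v z" by blast
  have "y \<bullet> z = x \<bullet> x"
    using transpose_vec_mult_scalar[OF car(2) z(1) x(1)] by (simp add: y_def flip: z(2))
  moreover have "x \<bullet> x \<noteq> 0" using scalar_prod_self_eq_0 x by blast
  ultimately have "y \<noteq> 0\<^sub>v n" using z by auto
  then have "0 < (A *\<^sub>v y) \<bullet> y" using A y by (simp add: sym_pos_def_def)
  also have "(A *\<^sub>v y) \<bullet> y = y \<bullet> (A *\<^sub>v y)" using comm_scalar_prod[of "A *\<^sub>v y" n y] car y by simp
  also have "\<dots> = x \<bullet> (B i *\<^sub>v (A *\<^sub>v y))"
    using transpose_vec_mult_scalar[OF car(2), of "A *\<^sub>v y" x] car x y by (simp add: y_def)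
  also have "B i *\<^sub>v (A *\<^sub>v y) = S i *\<^sub>v x"
    using car x by (simp add: S_def y_def assoc_mult_mat_vec[of _ "d i" n _ "d i"] assoc_mult_mat_vec[of _ "d i" n _ n])
  also have "x \<bullet> (S i *\<^sub>v x) = (S i *\<^sub>v x) \<bullet> x" using comm_scalar_prod[of x "d i" "S i *\<^sub>v x"] S_carrier[OF i] x by simp
  finally show "0 < (S i *\<^sub>v x) \<bullet> x" .
qed

lemma X_facts:
  assumes i: "i < m"
  shows "X i \<in> carrier_mat (d i) (d i)" "S i * X i = 1\<^sub>m (d i)" "X i * S i = 1\<^sub>m (d i)" "(X i)\<^sup>T = X i" "0 < det (S i)"
proof -
  obtain L where L: "L \<in> carrier_mat (d i) (d i)" "L\<^sup>T * S i * L = 1\<^sub>m (d i)"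
    using sym_pos_def_factor[OF S_pos_def[OF i]] .
  note f = factor_facts[OF S_carrier[OF i] L]
  have "X i = L * L\<^sup>T" unfolding X_def using L f by (intro mat_inv_eq[OF S_carrier[OF i]]) auto
  then show "X i \<in> carrier_mat (d i) (d i)" "S i * X i = 1\<^sub>m (d i)" "X i * S i = 1\<^sub>m (d i)" "(X i)\<^sup>T = X i" "0 < det (S i)"
    using L f by (auto simp: transpose_mult[of _ "d i" "d i" _ "d i"])
qed

lemma det_A_pos: "0 < det A" and A_inverse: "mat_inv A = P * P\<^sup>T" and PPA: "(P * P\<^sup>T) * A = 1\<^sub>m n"
  using factor_facts[OF A_carrier P PAP] P PT by (auto intro: mat_inv_eq[OF A_carrier])

lemma dimensions:
  assumes "i < m"
  shows "dim_row A = n" "dim_col A = n" "dim_row P = n" "dim_col P = n" "dim_row (B i) = d i" "dim_col (B i) = n"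
    "dim_row (X i) = d i" "dim_col (X i) = d i" "dim_row (S i) = d i" "dim_col (S i) = d i"
  using A_carrier P B_carrier[OF assms] X_facts(1)[OF assms] S_carrier[OF assms] by auto

lemma PPA_cancel: "Z \<in> carrier_mat n k \<Longrightarrow> P * (P\<^sup>T * (A * Z)) = Z"
proof -
  assume Z: "Z \<in> carrier_mat n k"
  have "P * (P\<^sup>T * (A * Z)) = ((P * P\<^sup>T) * A) * Z" using carrier_matD[OF P] carrier_matD[OF A_carrier] carrier_matD[OF Z] by (simp add: mult_assoc_dim)
  then show ?thesis using PPA Z by simp
qed

lemma XS_cancel: "i < m \<Longrightarrow> Z \<in> carrier_mat (d i) k \<Longrightarrow> X i * (B i * (A * ((B i)\<^sup>T * Z))) = Z"
proof -
  assume i: "i < m" and Z: "Z \<in> carrier_mat (d i) k"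
  have "X i * (B i * (A * ((B i)\<^sup>T * Z))) = (X i * S i) * Z"
    unfolding S_def using carrier_matD[OF Z] dimensions[OF i] by (simp add: mult_assoc_dim)
  then show ?thesis using X_facts(3)[OF i] Z by simp
qed

lemma Q_carrier: "i < m \<Longrightarrow> Q i \<in> carrier_mat (d i) n"
  unfolding Q_def using X_facts(1) B_carrier A_carrier P by (meson mult_carrier_mat)

lemma BA_carrier: "i < m \<Longrightarrow> (B i)\<^sup>T * Q i \<in> carrier_mat n n"
  using BT Q_carrier by (meson mult_carrier_mat)

lemma E_carrier: "i < m \<Longrightarrow> E i \<in> carrier_mat n n"
  unfolding E_def using PT A_carrier BA_carrier by (meson mult_carrier_mat)

lemma P_E: "i < m \<Longrightarrow> P * E i = (B i)\<^sup>T * Q i"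
  unfolding E_def by (rule PPA_cancel[OF BA_carrier])

lemma Q_E: assumes i: "i < m" shows "Q i * E i = Q i"
proof -
  have "Q i * E i = X i * (B i * (A * (P * E i)))"
    unfolding Q_def using dimensions[OF i] carrier_matD[OF E_carrier[OF i]] by (simp add: mult_assoc_dim)
  also have "\<dots> = Q i" unfolding P_E[OF i] by (rule XS_cancel[OF i Q_carrier[OF i]])
  finally show ?thesis .
qed

lemma Q_transpose: assumes i: "i < m" shows "(Q i)\<^sup>T = P\<^sup>T * (A * ((B i)\<^sup>T * X i))"
proof -
  have "(A * P)\<^sup>T = P\<^sup>T * A" using transpose_mult[OF A_carrier P] A_sym by simp
  moreover have "(B i * (A * P))\<^sup>T = (A * P)\<^sup>T * (B i)\<^sup>T" using A_carrier P B_carrier[OF i] by (intro transpose_mult) auto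
  moreover have "(Q i)\<^sup>T = (B i * (A * P))\<^sup>T * (X i)\<^sup>T"
    unfolding Q_def using A_carrier P B_carrier[OF i] X_facts(1)[OF i] by (intro transpose_mult) auto
  ultimately show ?thesis using dimensions[OF i] X_facts(4)[OF i] by (simp add: mult_assoc_dim)
qed

lemma Q_covariance: assumes i: "i < m" shows "(Q i * (Q i)\<^sup>T) * S i = 1\<^sub>m (d i)"
proof -
  note car = PT P A_carrier BT[OF i] B_carrier[OF i] X_facts(1)[OF i] S_carrier[OF i]
  have "(B i)\<^sup>T * (X i * S i) \<in> carrier_mat n (d i)" using car by auto
  note p = PPA_cancel[OF this]
  have "(Q i * (Q i)\<^sup>T) * S i = X i * (B i * (A * (P * (P\<^sup>T * (A * ((B i)\<^sup>T * (X i * S i)))))))"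
    unfolding Q_transpose[OF i] unfolding Q_def using dimensions[OF i] by (simp add: mult_assoc_dim)
  also have "\<dots> = X i * S i" unfolding p using car by (intro XS_cancel[OF i]) auto
  finally show ?thesis using X_facts(3)[OF i] by simp
qed

lemma E_transpose: assumes i: "i < m" shows "(E i)\<^sup>T = E i"
proof -
  note car = PT P A_carrier BT[OF i] B_carrier[OF i] X_facts(1)[OF i]
  have "((B i)\<^sup>T * Q i)\<^sup>T = (Q i)\<^sup>T * B i" using BT[OF i] Q_carrier[OF i] by (simp add: transpose_mult[of _ n "d i" _ n])
  moreover have "(A * ((B i)\<^sup>T * Q i))\<^sup>T = ((B i)\<^sup>T * Q i)\<^sup>T * A\<^sup>T" by (rule transpose_mult[OF A_carrier BA_carrier[OF i]])
  moreover have "(E i)\<^sup>T = (A * ((B i)\<^sup>T * Q i))\<^sup>T * P"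
    unfolding E_def using A_carrier BA_carrier[OF i] PT by (subst transpose_mult[of _ n n _ n]) auto
  ultimately have "(E i)\<^sup>T = ((Q i)\<^sup>T * B i) * A * P" by (simp add: A_sym)
  also have "\<dots> = P\<^sup>T * (A * ((B i)\<^sup>T * (X i * (B i * (A * P)))))"
    unfolding Q_transpose[OF i] using dimensions[OF i] by (simp add: mult_assoc_dim)
  finally show ?thesis by (simp add: E_def Q_def)
qed

lemma E_idempotent: assumes i: "i < m" shows "E i * E i = E i"
proof -
  have "E i * E i = P\<^sup>T * (A * ((B i)\<^sup>T * (Q i * E i)))"
    unfolding E_def[of i] using dimensions[OF i] carrier_matD[OF Q_carrier[OF i]] by (simp add: mult_assoc_dim)
  then show ?thesis unfolding Q_E[OF i] E_def[symmetric] .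
qed

text \<open>This is the hypothesis on the inverse of \<open>A\<close> conjugated by \<open>P\<close>, because \<open>E i\<close> is the product
  \<open>P\<^sup>T A ((B i)\<^sup>T X i B i) A P\<close>.\<close>

lemma E_resolution:
  assumes x: "x \<in> carrier_vec n" and j: "j < n"
  shows "(\<Sum>i<m. c i * (E i *\<^sub>v x) $ j) = x $ j"
proof -
  define y where "y = (A * P) *\<^sub>v x"
  define G where "G = P\<^sup>T * A"
  define W where "W = (\<lambda>i. (B i)\<^sup>T * X i * B i)"
  have AP: "A * P \<in> carrier_mat n n" and G: "G \<in> carrier_mat n n" using A_carrier P PT by (auto simp: G_def)
  have y: "y \<in> carrier_vec n" using AP x by (simp add: y_def)
  have W: "W i \<in> carrier_mat n n" if "i < m" for i
    unfolding W_def using BT[OF that] X_facts(1)[OF that] B_carrier[OF that] by auto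
  have Ex: "E i *\<^sub>v x = G *\<^sub>v (W i *\<^sub>v y)" if i: "i < m" for i
  proof -
    have "E i = G * (W i * (A * P))"
      unfolding E_def Q_def G_def W_def
      using dimensions[OF i] by (simp add: mult_assoc_dim)
    then show ?thesis
      using G W[OF i] AP x assoc_mult_mat_vec[OF G, of "W i * (A * P)" n x] assoc_mult_mat_vec[OF W[OF i] AP x]
      by (simp add: y_def)
  qed
  have inv: "(\<Sum>i<m. c i * (W i *\<^sub>v y) $ l) = (P *\<^sub>v x) $ l" if l: "l < n" for l
  proof -
    have car: "c i \<cdot>\<^sub>m W i \<in> carrier_mat n n" if "i \<in> {..<m}" for i using W that by simp
    have ent: "mat_inv A $$ (l, q) = (\<Sum>i<m. c i * W i $$ (l, q))" if q: "q < n" for q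
    proof -
      have "mat_inv A = finsum_mat n n (\<lambda>i. c i \<cdot>\<^sub>m W i) {..<m}" unfolding A_inv W_def X_def S_def ..
      then have "mat_inv A $$ (l, q) = (\<Sum>i<m. (c i \<cdot>\<^sub>m W i) $$ (l, q))"
        using finsum_mat_index[of "{..<m}" "\<lambda>i. c i \<cdot>\<^sub>m W i" n n] car l q by simp
      also have "\<dots> = (\<Sum>i<m. c i * W i $$ (l, q))"
        using carrier_matD[OF W] l q by (intro sum.cong refl) simp
      finally show ?thesis .
    qed
    have PP: "P * P\<^sup>T \<in> carrier_mat n n" using P PT by simp
    have "(\<Sum>i<m. c i * (W i *\<^sub>v y) $ l) = (\<Sum>i<m. \<Sum>q<n. c i * W i $$ (l, q) * y $ q)"
      using l by (intro sum.cong refl) (simp add: mult_mat_vec_index[OF W y] sum_distrib_left mult.assoc del: index_mult_mat_vec)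
    also have "\<dots> = (\<Sum>q<n. mat_inv A $$ (l, q) * y $ q)"
      by (subst sum.swap) (simp add: ent sum_distrib_right)
    also have "\<dots> = ((P * P\<^sup>T) *\<^sub>v y) $ l"
      unfolding A_inverse using mult_mat_vec_index[OF PP y l] by simp
    also have "(P * P\<^sup>T) *\<^sub>v y = P *\<^sub>v x"
    proof -
      have "(P * P\<^sup>T) *\<^sub>v y = ((P * P\<^sup>T) * (A * P)) *\<^sub>v x"
        unfolding y_def by (rule assoc_mult_mat_vec[OF PP AP x, symmetric])
      also have "(P * P\<^sup>T) * (A * P) = P" using PPA_cancel[OF P] carrier_matD[OF P] carrier_matD[OF A_carrier] by (simp add: mult_assoc_dim)
      finally show ?thesis .
    qed
    finally show ?thesis .
  qed
  have Px: "P *\<^sub>v x \<in> carrier_vec n" using P x by simp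
  have "(\<Sum>i<m. c i * (E i *\<^sub>v x) $ j) = (\<Sum>i<m. \<Sum>l<n. G $$ (j, l) * (c i * (W i *\<^sub>v y) $ l))"
  proof (intro sum.cong refl)
    fix i assume "i \<in> {..<m}"
    then have i: "i < m" by simp
    have Wy: "W i *\<^sub>v y \<in> carrier_vec n" using W[OF i] y by simp
    show "c i * (E i *\<^sub>v x) $ j = (\<Sum>l<n. G $$ (j, l) * (c i * (W i *\<^sub>v y) $ l))"
      unfolding Ex[OF i] mult_mat_vec_index[OF G Wy j] by (simp only: sum_distrib_left mult_ac)
  qed
  also have "\<dots> = (\<Sum>l<n. G $$ (j, l) * (\<Sum>i<m. c i * (W i *\<^sub>v y) $ l))"
    by (subst sum.swap) (simp only: sum_distrib_left)
  also have "\<dots> = (\<Sum>l<n. G $$ (j, l) * (P *\<^sub>v x) $ l)" using inv by (intro sum.cong refl) simp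
  also have "\<dots> = (G *\<^sub>v (P *\<^sub>v x)) $ j" by (rule mult_mat_vec_index[OF G Px j, symmetric])
  also have "G *\<^sub>v (P *\<^sub>v x) = x"
    using assoc_mult_mat_vec[OF G P x] PAP x by (simp add: G_def)
  finally show ?thesis .
qed

sublocale projection_frame n m c E
  using E_carrier E_transpose E_idempotent c_pos E_resolution by unfold_locales

text \<open>The argument of \<open>f\<close> in the constraint is the image under \<open>P\<close> of the combination in the frame.\<close>

lemma P_combine:
  assumes Y: "\<And>i. i < m \<Longrightarrow> Y i \<in> carrier_vec n"
  shows "P *\<^sub>v combine Y = finsum_vec TYPE(real) n (\<lambda>i. c i \<cdot>\<^sub>v ((B i)\<^sup>T *\<^sub>v (Q i *\<^sub>v Y i))) {..<m}"
proof (rule eq_vecI)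
  let ?v = "\<lambda>i. c i \<cdot>\<^sub>v ((B i)\<^sup>T *\<^sub>v (Q i *\<^sub>v Y i))"
  have v: "?v \<in> {..<m} \<rightarrow> carrier_vec n" using BT Q_carrier Y by (auto intro!: mult_mat_vec_carrier)
  have fc: "finsum_vec TYPE(real) n ?v {..<m} \<in> carrier_vec n" by (rule finsum_vec_closed[OF v])
  show "dim_vec (P *\<^sub>v combine Y) = dim_vec (finsum_vec TYPE(real) n ?v {..<m})" using P fc by simp
  fix j assume "j < dim_vec (finsum_vec TYPE(real) n ?v {..<m})"
  then have j: "j < n" using fc by simp
  have BQ: "((B i)\<^sup>T *\<^sub>v (Q i *\<^sub>v Y i)) $ j = (\<Sum>l<n. P $$ (j, l) * (E i *\<^sub>v Y i) $ l)" if i: "i < m" for i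
  proof -
    have "(B i)\<^sup>T *\<^sub>v (Q i *\<^sub>v Y i) = P *\<^sub>v (E i *\<^sub>v Y i)"
      using assoc_mult_mat_vec[OF BT[OF i] Q_carrier[OF i] Y[OF i]] assoc_mult_mat_vec[OF P E_carrier[OF i] Y[OF i]]
      by (simp add: P_E[OF i])
    then show ?thesis using mult_mat_vec_index[OF P E_vec_carrier[OF i Y[OF i]] j] by simp
  qed
  have "(P *\<^sub>v combine Y) $ j = (\<Sum>l<n. P $$ (j, l) * combine Y $ l)"
    by (rule mult_mat_vec_index[OF P combine_carrier j])
  also have "\<dots> = (\<Sum>l<n. \<Sum>i<m. c i * (P $$ (j, l) * (E i *\<^sub>v Y i) $ l))"
    by (intro sum.cong refl) (simp add: combine_def sum_distrib_left mult_ac del: index_mult_mat_vec)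
  also have "\<dots> = (\<Sum>i<m. c i * ((B i)\<^sup>T *\<^sub>v (Q i *\<^sub>v Y i)) $ j)"
    by (subst sum.swap) (simp add: BQ sum_distrib_left del: index_mult_mat_vec)
  also have "\<dots> = (\<Sum>i<m. ?v i $ j)"
    using j by (intro sum.cong refl) (simp add: carrier_matD[OF B_carrier] del: index_mult_mat_vec)
  also have "\<dots> = finsum_vec TYPE(real) n ?v {..<m} $ j"
    by (rule index_finsum_vec[symmetric]) (use j v in auto)
  finally show "(P *\<^sub>v combine Y) $ j = finsum_vec TYPE(real) n ?v {..<m} $ j" .
qed

end

section \<open>The inequality for compactly supported test functions\<close>

lemma sym_pos_def_det_pos:
  assumes S: "sym_pos_def k S" shows "0 < det S"
proof -
  have Sc: "S \<in> carrier_mat k k" using S by (simp add: sym_pos_def_def)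
  obtain L where L: "L \<in> carrier_mat k k" "L\<^sup>T * S * L = 1\<^sub>m k" using sym_pos_def_factor[OF S] .
  show ?thesis by (rule factor_facts(2)[OF Sc L])
qed

text \<open>After the substitution \<open>y = sqrt T \<eta>\<close> the Gaussian weight flattens as \<open>T\<close> grows, so that the heat flow
  at large time measures the Lebesgue integral.\<close>

lemma gauss_law_heat:
  fixes F :: "real vec \<Rightarrow> ennreal"
  assumes S: "sym_pos_def d S" and Q: "Q \<in> carrier_mat d n" and QQS: "(Q * Q\<^sup>T) * S = 1\<^sub>m d"
    and F: "F \<in> borel_measurable (lborel_vec d)" and T: "0 < T"
  shows "(\<integral>\<^sup>+y. F y * ennreal (gaussian S ((1 / sqrt T) \<cdot>\<^sub>v y)) \<partial>lborel_vec d) =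
    ennreal (sqrt (2 * pi * T) ^ d / sqrt (det S)) * heat n T (\<lambda>\<eta>. F (Q *\<^sub>v \<eta>)) (0\<^sub>v n)"
proof -
  have Sc: "S \<in> carrier_mat d d" using S by (simp add: sym_pos_def_def)
  define r where "r = sqrt T"
  have r: "0 < r" using T by (simp add: r_def)
  define G where "G = (\<lambda>y. F y * ennreal (gaussian S ((1 / r) \<cdot>\<^sub>v y)))"
  have sm: "(\<lambda>y. a \<cdot>\<^sub>v y) \<in> lborel_vec d \<rightarrow>\<^sub>M lborel_vec d" for a :: real
    by (intro measurable_smult_vec) auto
  have gm: "(\<lambda>y. gaussian S ((1 / r) \<cdot>\<^sub>v y)) \<in> borel_measurable (lborel_vec d)"
    by (rule measurable_compose[OF sm measurable_gaussian[OF Sc]])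
  have Gm: "G \<in> borel_measurable (lborel_vec d)"
    unfolding G_def using F gm by (intro borel_measurable_times_ennreal measurable_compose[OF _ measurable_ennreal])
  have Fr: "(\<lambda>y. F (r \<cdot>\<^sub>v y)) \<in> borel_measurable (lborel_vec d)" by (rule measurable_compose[OF sm F])
  have "(\<integral>\<^sup>+y. G y \<partial>lborel_vec d) = ennreal (\<bar>r\<bar> ^ d) * (\<integral>\<^sup>+x. G (r \<cdot>\<^sub>v x + 0\<^sub>v d) \<partial>lborel_vec d)"
    by (rule nn_integral_lborel_vec_affine[OF Gm]) (use r in auto)
  also have "(\<integral>\<^sup>+x. G (r \<cdot>\<^sub>v x + 0\<^sub>v d) \<partial>lborel_vec d) = (\<integral>\<^sup>+x. F (r \<cdot>\<^sub>v x) * ennreal (gaussian S x) \<partial>lborel_vec d)"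
  proof (rule nn_integral_cong)
    fix x assume "x \<in> space (lborel_vec d)"
    then have x: "x \<in> carrier_vec d" by simp
    have "r \<cdot>\<^sub>v x + 0\<^sub>v d = r \<cdot>\<^sub>v x" using x by simp
    moreover have "(1 / r) \<cdot>\<^sub>v (r \<cdot>\<^sub>v x) = x" using r by (simp add: smult_smult_assoc)
    ultimately show "G (r \<cdot>\<^sub>v x + 0\<^sub>v d) = F (r \<cdot>\<^sub>v x) * ennreal (gaussian S x)" by (simp only: G_def)
  qed
  also have "\<dots> = ennreal (sqrt (2 * pi) ^ d / sqrt (det S)) * (\<integral>\<^sup>+\<xi>. F (r \<cdot>\<^sub>v (Q *\<^sub>v \<xi>)) \<partial>std_gauss n)"
    by (rule gauss_law[OF S Q QQS Fr])
  also have "(\<integral>\<^sup>+\<xi>. F (r \<cdot>\<^sub>v (Q *\<^sub>v \<xi>)) \<partial>std_gauss n) = heat n T (\<lambda>\<eta>. F (Q *\<^sub>v \<eta>)) (0\<^sub>v n)"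
    unfolding heat_def
  proof (rule nn_integral_cong)
    fix \<xi> assume "\<xi> \<in> space (std_gauss n)"
    then have \<xi>: "\<xi> \<in> carrier_vec n" by simp
    have "0\<^sub>v n + r \<cdot>\<^sub>v \<xi> = r \<cdot>\<^sub>v \<xi>" using \<xi> by simp
    moreover have "Q *\<^sub>v (r \<cdot>\<^sub>v \<xi>) = r \<cdot>\<^sub>v (Q *\<^sub>v \<xi>)" by (rule mult_mat_vec[OF Q \<xi>])
    ultimately show "F (r \<cdot>\<^sub>v (Q *\<^sub>v \<xi>)) = F (Q *\<^sub>v (0\<^sub>v n + sqrt T \<cdot>\<^sub>v \<xi>))" by (simp only: r_def)
  qed
  also have "ennreal (\<bar>r\<bar> ^ d) * (ennreal (sqrt (2 * pi) ^ d / sqrt (det S)) * heat n T (\<lambda>\<eta>. F (Q *\<^sub>v \<eta>)) (0\<^sub>v n)) =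
      ennreal (sqrt (2 * pi * T) ^ d / sqrt (det S)) * heat n T (\<lambda>\<eta>. F (Q *\<^sub>v \<eta>)) (0\<^sub>v n)"
  proof -
    have "0 \<le> sqrt (2 * pi) ^ d / sqrt (det S)" using sym_pos_def_det_pos[OF S] by simp
    then have "ennreal (\<bar>r\<bar> ^ d) * ennreal (sqrt (2 * pi) ^ d / sqrt (det S)) =
        ennreal (\<bar>r\<bar> ^ d * (sqrt (2 * pi) ^ d / sqrt (det S)))" by (intro ennreal_mult[symmetric]) simp_all
    also have "\<bar>r\<bar> ^ d * (sqrt (2 * pi) ^ d / sqrt (det S)) = sqrt (2 * pi * T) ^ d / sqrt (det S)"
      using r by (simp add: r_def real_sqrt_mult power_mult_distrib)
    finally show ?thesis unfolding mult.assoc[symmetric] by (rule arg_cong)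
  qed
  finally show ?thesis by (simp only: G_def r_def)
qed

lemma finsum_vec_cong:
  fixes f g :: "'i \<Rightarrow> real vec"
  assumes "finite I" and "\<And>i. i \<in> I \<Longrightarrow> g i \<in> carrier_vec n" and eq: "\<And>i. i \<in> I \<Longrightarrow> f i = g i"
  shows "finsum_vec TYPE(real) n f I = finsum_vec TYPE(real) n g I"
proof -
  have g: "g \<in> I \<rightarrow> carrier_vec n" and f: "f \<in> I \<rightarrow> carrier_vec n" using assms by auto
  show ?thesis
  proof (rule eq_vecI)
    show "dim_vec (finsum_vec TYPE(real) n f I) = dim_vec (finsum_vec TYPE(real) n g I)"
      using carrier_vecD[OF finsum_vec_closed[OF f]] carrier_vecD[OF finsum_vec_closed[OF g]] by simp
    fix j assume "j < dim_vec (finsum_vec TYPE(real) n g I)"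
    then have j: "j < n" using carrier_vecD[OF finsum_vec_closed[OF g]] by simp
    have "finsum_vec TYPE(real) n f I $ j = (\<Sum>i\<in>I. f i $ j)" by (rule index_finsum_vec[OF assms(1) j f])
    also have "\<dots> = (\<Sum>i\<in>I. g i $ j)" using eq by (intro sum.cong) auto
    also have "\<dots> = finsum_vec TYPE(real) n g I $ j" by (rule index_finsum_vec[OF assms(1) j g, symmetric])
    finally show "finsum_vec TYPE(real) n f I $ j = finsum_vec TYPE(real) n g I $ j" .
  qed
qed

context gaussian_datum
begin

text \<open>A right inverse of \<open>Q i\<close> whose range is the range of \<open>E i\<close>.\<close>

definition K :: "nat \<Rightarrow> real mat" where "K i = P\<^sup>T * (A * (B i)\<^sup>T)"

lemma K_carrier: "i < m \<Longrightarrow> K i \<in> carrier_mat n (d i)"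
  using dimensions by (intro carrier_matI) (simp_all add: K_def)

lemma E_eq_K_Q: assumes i: "i < m" shows "E i = K i * Q i"
  unfolding E_def K_def using dimensions[OF i] carrier_matD[OF Q_carrier[OF i]] by (simp add: mult_assoc_dim)

lemma Q_K: assumes i: "i < m" shows "Q i * K i = 1\<^sub>m (d i)"
proof -
  have "Q i * K i = X i * (B i * (A * (P * (P\<^sup>T * (A * (B i)\<^sup>T)))))"
    unfolding Q_def K_def using dimensions[OF i] by (simp add: mult_assoc_dim)
  also have "\<dots> = X i * S i"
    unfolding PPA_cancel[OF BT[OF i]] S_def using dimensions[OF i] by (simp add: mult_assoc_dim)
  finally show ?thesis using X_facts(3)[OF i] by simp
qed

lemma KT_K: assumes i: "i < m" shows "(K i)\<^sup>T * K i = S i"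
proof -
  have "(K i)\<^sup>T * K i = B i * (A * (P * (P\<^sup>T * (A * (B i)\<^sup>T))))"
    unfolding K_def using dimensions[OF i] A_sym by (simp add: mult_assoc_dim transpose_mult_dim)
  also have "\<dots> = S i"
    unfolding PPA_cancel[OF BT[OF i]] S_def using dimensions[OF i] by (simp add: mult_assoc_dim)
  finally show ?thesis .
qed

lemma sqrt_det_S_prod: "(\<Prod>i<m. sqrt (det (S i)) powr c i) = sqrt (\<Prod>i<m. det (S i) powr c i)"
proof (rule real_sqrt_unique[symmetric])
  have "(\<Prod>i<m. sqrt (det (S i)) powr c i)\<^sup>2 = (\<Prod>i<m. (sqrt (det (S i)) * sqrt (det (S i))) powr c i)"
    unfolding power2_eq_square prod.distrib[symmetric] using X_facts(5)
    by (intro prod.cong refl) (simp add: powr_mult del: real_sqrt_mult_self)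
  also have "\<dots> = (\<Prod>i<m. det (S i) powr c i)" using X_facts(5) by (intro prod.cong refl) (simp add: less_imp_le)
  finally show "(\<Prod>i<m. sqrt (det (S i)) powr c i)\<^sup>2 = (\<Prod>i<m. det (S i) powr c i)" .
qed (auto intro: prod_nonneg)

lemma det_S_prod_pos: "0 < (\<Prod>i<m. det (S i) powr c i)"
proof (rule prod_pos)
  fix i assume "i \<in> {..<m}"
  then show "0 < det (S i) powr c i" using X_facts(5)[of i] by simp
qed

definition Cr :: real where "Cr = sqrt (det A / (\<Prod>i<m. det (S i) powr c i))"

lemma Cr_pos: "0 < Cr" using det_A_pos det_S_prod_pos by (simp add: Cr_def)

text \<open>On the bounded support of \<open>g\<close> the Gaussian weight at time \<open>T\<close> is at least \<open>exp (- \<kappa> / (2 * T))\<close>, which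
  tends to one.\<close>

lemma test_lower_bound:
  assumes i: "i < m" and g: "usc_test (d i) g" and T: "0 < T"
    and R: "\<And>x j. x \<in> carrier_vec (d i) \<Longrightarrow> g x \<noteq> 0 \<Longrightarrow> j < d i \<Longrightarrow> \<bar>x $ j\<bar> \<le> R"
  defines "\<kappa> \<equiv> \<Sum>a<d i. \<Sum>b<d i. \<bar>S i $$ (a, b)\<bar> * (R * R)"
  shows "ennreal (exp (- \<kappa> / (2 * T))) * (\<integral>\<^sup>+x. ennreal (g x) \<partial>lborel_vec (d i)) \<le>
    ennreal (sqrt (2 * pi * T) ^ d i / sqrt (det (S i))) * heat n T (\<lambda>\<eta>. ennreal (g (Q i *\<^sub>v \<eta>))) (0\<^sub>v n)"
proof -
  have gm: "(\<lambda>x. ennreal (g x)) \<in> borel_measurable (lborel_vec (d i))"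
    using g unfolding usc_test_def by (intro measurable_compose[OF _ measurable_ennreal]) auto
  have "ennreal (exp (- \<kappa> / (2 * T))) * (\<integral>\<^sup>+x. ennreal (g x) \<partial>lborel_vec (d i)) =
      (\<integral>\<^sup>+x. ennreal (exp (- \<kappa> / (2 * T))) * ennreal (g x) \<partial>lborel_vec (d i))"
    by (rule nn_integral_cmult[OF gm, symmetric])
  also have "\<dots> \<le> (\<integral>\<^sup>+x. ennreal (g x) * ennreal (gaussian (S i) ((1 / sqrt T) \<cdot>\<^sub>v x)) \<partial>lborel_vec (d i))"
  proof (rule nn_integral_mono)
    fix x assume "x \<in> space (lborel_vec (d i))"
    then have x: "x \<in> carrier_vec (d i)" by simp
    show "ennreal (exp (- \<kappa> / (2 * T))) * ennreal (g x) \<le> ennreal (g x) * ennreal (gaussian (S i) ((1 / sqrt T) \<cdot>\<^sub>v x))"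
    proof (cases "g x = 0")
      case False
      have "\<bar>(S i *\<^sub>v x) \<bullet> x\<bar> \<le> \<kappa>"
        unfolding \<kappa>_def using R[OF x False] by (intro abs_quadratic_form_le[OF S_carrier[OF i] x])
      then have "(S i *\<^sub>v x) \<bullet> x \<le> \<kappa>" by simp
      moreover have "(S i *\<^sub>v ((1 / sqrt T) \<cdot>\<^sub>v x)) \<bullet> ((1 / sqrt T) \<cdot>\<^sub>v x) = ((S i *\<^sub>v x) \<bullet> x) / T"
      proof -
        have Sx: "S i *\<^sub>v x \<in> carrier_vec (d i)" using S_carrier[OF i] x by simp
        have "(S i *\<^sub>v ((1 / sqrt T) \<cdot>\<^sub>v x)) \<bullet> ((1 / sqrt T) \<cdot>\<^sub>v x) = (1 / sqrt T) * ((1 / sqrt T) * ((S i *\<^sub>v x) \<bullet> x))"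
          unfolding mult_mat_vec[OF S_carrier[OF i] x] using Sx x by simp
        then show ?thesis using T by (simp add: field_simps)
      qed
      ultimately have "exp (- \<kappa> / (2 * T)) \<le> gaussian (S i) ((1 / sqrt T) \<cdot>\<^sub>v x)"
        using T by (simp add: gaussian_def field_simps)
      then show ?thesis by (subst mult.commute) (intro mult_left_mono ennreal_leI, auto)
    qed simp
  qed
  also have "\<dots> = ennreal (sqrt (2 * pi * T) ^ d i / sqrt (det (S i))) * heat n T (\<lambda>\<eta>. ennreal (g (Q i *\<^sub>v \<eta>))) (0\<^sub>v n)"
    by (rule gauss_law_heat[OF S_pos_def[OF i] Q_carrier[OF i] Q_covariance[OF i] gm T])
  finally show ?thesis .
qed

text \<open>The Gaussian weight is at most one, and \<open>\<Phi>\<close> at \<open>P\<^sup>T A z\<close> is at most \<open>f\<close> at \<open>z\<close>.\<close>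

lemma test_upper_bound:
  assumes \<Phi>: "\<Phi> \<in> borel_measurable (lborel_vec n)" "\<And>y. y \<in> carrier_vec n \<Longrightarrow> \<Phi> y \<le> f (P *\<^sub>v y)"
    and T: "0 < T"
  shows "ennreal (sqrt (2 * pi * T) ^ n / sqrt (det A)) * heat n T \<Phi> (0\<^sub>v n) \<le> (\<integral>\<^sup>+x. f x \<partial>lborel_vec n)"
proof -
  define G where "G = P\<^sup>T * A"
  have G: "G \<in> carrier_mat n n" using PT A_carrier by (simp add: G_def)
  have GP: "G *\<^sub>v (P *\<^sub>v x) = x" and PG: "P *\<^sub>v (G *\<^sub>v x) = x" if x: "x \<in> carrier_vec n" for x
  proof -
    have "G * P = 1\<^sub>m n" using PAP by (simp add: G_def)
    then show "G *\<^sub>v (P *\<^sub>v x) = x" using assoc_mult_mat_vec[OF G P x] x by simp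
    have "P * G = 1\<^sub>m n" using PPA carrier_matD[OF P] carrier_matD[OF A_carrier] by (simp add: G_def mult_assoc_dim)
    then show "P *\<^sub>v (G *\<^sub>v x) = x" using assoc_mult_mat_vec[OF P G x] x by simp
  qed
  have F: "(\<lambda>z. \<Phi> (G *\<^sub>v z)) \<in> borel_measurable (lborel_vec n)"
    by (rule measurable_compose[OF measurable_mult_mat_vec[OF G] \<Phi>(1)])
  have "heat n T \<Phi> (0\<^sub>v n) = heat n T (\<lambda>\<eta>. \<Phi> (G *\<^sub>v (P *\<^sub>v \<eta>))) (0\<^sub>v n)"
    unfolding heat_def by (intro nn_integral_cong arg_cong[where f = \<Phi>] GP[symmetric]) simp
  then have "ennreal (sqrt (2 * pi * T) ^ n / sqrt (det A)) * heat n T \<Phi> (0\<^sub>v n) =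
      (\<integral>\<^sup>+z. \<Phi> (G *\<^sub>v z) * ennreal (gaussian A ((1 / sqrt T) \<cdot>\<^sub>v z)) \<partial>lborel_vec n)"
    using gauss_law_heat[OF A P PPA F T] by simp
  also have "\<dots> \<le> (\<integral>\<^sup>+z. f z \<partial>lborel_vec n)"
  proof (rule nn_integral_mono)
    fix z assume "z \<in> space (lborel_vec n)"
    then have z: "z \<in> carrier_vec n" by simp
    define w where "w = (1 / sqrt T) \<cdot>\<^sub>v z"
    have w: "w \<in> carrier_vec n" using z by (simp add: w_def)
    have "0 \<le> (A *\<^sub>v w) \<bullet> w"
    proof (cases "w = 0\<^sub>v n")
      case True
      then show ?thesis using A_carrier by simp
    next
      case False
      then show ?thesis using A w by (simp add: sym_pos_def_def less_imp_le)
    qed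
    then have "ennreal (gaussian A w) \<le> 1" by (simp add: gaussian_def)
    then have "\<Phi> (G *\<^sub>v z) * ennreal (gaussian A w) \<le> \<Phi> (G *\<^sub>v z)"
      using mult_left_mono[of "ennreal (gaussian A w)" 1 "\<Phi> (G *\<^sub>v z)"] by simp
    also have "\<dots> \<le> f z" using \<Phi>(2)[of "G *\<^sub>v z"] PG[OF z] G z by simp
    finally show "\<Phi> (G *\<^sub>v z) * ennreal (gaussian A ((1 / sqrt T) \<cdot>\<^sub>v z)) \<le> f z" by (simp only: w_def)
  qed
  finally show ?thesis .
qed

text \<open>The powers of the time variable on the two sides agree because of the homogeneity condition.\<close>

lemma homogeneity:
  assumes N: "0 < N" and a: "\<And>i. i < m \<Longrightarrow> 0 \<le> a i"
  shows "(\<Prod>i<m. (a i / N ^ d i) powr c i) = (\<Prod>i<m. a i powr c i) / N ^ n"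
proof -
  have "(\<Prod>i<m. (a i / N ^ d i) powr c i) = (\<Prod>i<m. a i powr c i / N powr (c i * real (d i)))"
    using N a by (intro prod.cong refl) (simp add: powr_divide powr_powr mult.commute flip: powr_realpow)
  also have "\<dots> = (\<Prod>i<m. a i powr c i) / N powr (\<Sum>i<m. c i * real (d i))"
    using N by (simp add: prod_dividef powr_sum)
  finally show ?thesis using N by (simp add: dims powr_realpow)
qed

text \<open>The Gaussian inequality is applied to \<open>g i\<close> composed with \<open>Q i\<close>.  The first claim follows from the lower
  bound at time \<open>1\<close>, the second from both bounds as the time tends to infinity.\<close>

lemma test_inequality:
  assumes g: "\<And>i. i < m \<Longrightarrow> usc_test (d i) (g i)"
    and constr: "\<And>x. (\<And>i. i < m \<Longrightarrow> x i \<in> carrier_vec (d i)) \<Longrightarrow>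
      (\<Prod>i<m. g i (x i) powr c i) \<le> f (finsum_vec TYPE(real) n (\<lambda>i. c i \<cdot>\<^sub>v ((B i)\<^sup>T *\<^sub>v x i)) {..<m})"
  defines "J \<equiv> \<lambda>i. \<integral>\<^sup>+x. ennreal (g i x) \<partial>lborel_vec (d i)"
  shows "\<And>i. i < m \<Longrightarrow> J i < \<infinity>"
    and "ennreal (\<Prod>i<m. enn2real (J i) powr c i) \<le> ennreal Cr * (\<integral>\<^sup>+x. ennreal (f x) \<partial>lborel_vec n)"
proof -
  have "\<forall>i\<in>{..<m}. \<exists>M R. \<forall>x\<in>carrier_vec (d i). 0 \<le> g i x \<and> g i x \<le> M \<and> (g i x \<noteq> 0 \<longrightarrow> (\<forall>j<d i. \<bar>x $ j\<bar> \<le> R))"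
    using g by (auto simp: usc_test_def)
  then obtain M R where "\<forall>i\<in>{..<m}. \<forall>x\<in>carrier_vec (d i). 0 \<le> g i x \<and> g i x \<le> M i \<and> (g i x \<noteq> 0 \<longrightarrow> (\<forall>j<d i. \<bar>x $ j\<bar> \<le> R i))"
    by (elim bchoice[THEN exE]) (use bchoice in metis)
  then have g0: "0 \<le> g i x" and gM: "g i x \<le> M i" and gR: "g i x \<noteq> 0 \<Longrightarrow> j < d i \<Longrightarrow> \<bar>x $ j\<bar> \<le> R i"
    if "i < m" "x \<in> carrier_vec (d i)" for i x j using that by auto
  define M0 where "M0 = (\<Sum>i<m. \<bar>M i\<bar>)"
  define \<rho> where "\<rho> = (\<lambda>i. \<Sum>a<n. \<Sum>b<d i. \<bar>K i $$ (a, b)\<bar> * \<bar>R i\<bar>)"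
  define R0 where "R0 = (\<Sum>i<m. \<rho> i)"
  define h where "h = (\<lambda>i \<eta>. g i (Q i *\<^sub>v \<eta>))"
  have Qv: "Q i *\<^sub>v \<eta> \<in> carrier_vec (d i)" if "i < m" "\<eta> \<in> carrier_vec n" for i \<eta>
    using Q_carrier[OF that(1)] that(2) by (rule mult_mat_vec_carrier)
  have h: "bounded_measurable n 0 M0 (h i)" if i: "i < m" for i
  proof -
    have "h i \<in> borel_measurable (lborel_vec n)"
      unfolding h_def using g[OF i] unfolding usc_test_def
      by (intro measurable_compose[OF measurable_mult_mat_vec[OF Q_carrier[OF i]]]) auto
    moreover have "M i \<le> M0"
      using member_le_sum[of i "{..<m}" "\<lambda>i. \<bar>M i\<bar>"] i by (simp add: M0_def)
    ultimately show ?thesis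
      unfolding bounded_measurable_def using g0[OF i Qv[OF i]] order_trans[OF gM[OF i Qv[OF i]]] by (simp add: h_def)
  qed
  have supp: "vnorm (E i *\<^sub>v x) \<le> R0" if i: "i < m" and x: "x \<in> carrier_vec n" and ne: "h i x \<noteq> 0" for i x
  proof -
    have "E i *\<^sub>v x = K i *\<^sub>v (Q i *\<^sub>v x)"
      unfolding E_eq_K_Q[OF i] by (rule assoc_mult_mat_vec[OF K_carrier[OF i] Q_carrier[OF i] x])
    moreover have "vnorm (K i *\<^sub>v (Q i *\<^sub>v x)) \<le> \<rho> i"
      unfolding \<rho>_def using gR[OF i Qv[OF i x]] ne
      by (intro vnorm_mult_mat_vec_le[OF K_carrier[OF i] Qv[OF i x]]) (simp add: h_def)
    moreover have "\<rho> i \<le> R0"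
      unfolding R0_def using i by (intro member_le_sum) (auto simp: \<rho>_def intro!: sum_nonneg)
    ultimately show ?thesis by simp
  qed
  have hc: "ennreal (\<Prod>i<m. h i (Y i) powr c i) \<le> ennreal (f (P *\<^sub>v combine Y))"
    if Y: "\<And>i. i < m \<Longrightarrow> Y i \<in> carrier_vec n" for Y
    using constr[of "\<lambda>i. Q i *\<^sub>v Y i"] Qv Y by (intro ennreal_leI) (simp add: h_def P_combine[OF Y])
  have inv: "h i (E i *\<^sub>v y) = h i y" if i: "i < m" and y: "y \<in> carrier_vec n" for i y
    using assoc_mult_mat_vec[OF Q_carrier[OF i] E_carrier[OF i] y] by (simp add: h_def Q_E[OF i])
  have usc: "usc_vec n (h i)" if i: "i < m" for i
    unfolding h_def by (rule usc_vec_compose_mat[OF _ Q_carrier[OF i]]) (use g[OF i] in \<open>simp add: usc_test_def\<close>)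
  have M0: "0 \<le> M0" unfolding M0_def by (intro sum_nonneg) auto
  obtain \<Phi> where \<Phi>: "\<Phi> \<in> borel_measurable (lborel_vec n)" "\<And>y. y \<in> carrier_vec n \<Longrightarrow> \<Phi> y \<le> ennreal (f (P *\<^sub>v y))"
    "\<And>T. 0 < T \<Longrightarrow> ennreal (\<Prod>i<m. heat_real n T (h i) (0\<^sub>v n) powr c i) \<le> heat n T \<Phi> (0\<^sub>v n)"
    using gaussian_inequality_usc[where g = h and f = "\<lambda>y. ennreal (f (P *\<^sub>v y))", OF h M0 inv usc supp hc] by blast
  define \<kappa> where "\<kappa> = (\<lambda>i. \<Sum>a<d i. \<Sum>b<d i. \<bar>S i $$ (a, b)\<bar> * (R i * R i))"
  define s where "s = (\<lambda>i. sqrt (det (S i)))"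
  have s: "0 < s i" if "i < m" for i using X_facts(5)[OF that] by (simp add: s_def)
  have heat_h: "heat n T (\<lambda>\<eta>. ennreal (g i (Q i *\<^sub>v \<eta>))) (0\<^sub>v n) = ennreal (heat_real n T (h i) (0\<^sub>v n))" if i: "i < m" for i T
    using ennreal_heat_real[OF h[OF i] zero_carrier_vec order_refl, of T] by (simp add: h_def)
  have low: "ennreal (exp (- \<kappa> i / (2 * T))) * J i \<le> ennreal (sqrt (2 * pi * T) ^ d i / s i) * ennreal (heat_real n T (h i) (0\<^sub>v n))"
    if i: "i < m" and T: "0 < T" for i T
    unfolding heat_h[OF i, symmetric] s_def J_def \<kappa>_def by (rule test_lower_bound[OF i g[OF i] T gR[OF i]])
  show Jfin: "J i < \<infinity>" if i: "i < m" for i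
  proof -
    have "ennreal (sqrt (2 * pi * 1) ^ d i / s i) * ennreal (heat_real n 1 (h i) (0\<^sub>v n)) < \<infinity>"
      by (simp add: ennreal_mult_less_top)
    then have "ennreal (exp (- \<kappa> i / (2 * 1))) * J i < \<infinity>" using low[OF i, of 1] by (auto intro: le_less_trans)
    then show ?thesis by (auto simp: ennreal_mult_less_top)
  qed
  define q where "q = (\<lambda>i. enn2real (J i))"
  have q: "0 \<le> q i" for i by (simp add: q_def)
  have Jq: "J i = ennreal (q i)" if "i < m" for i using Jfin[OF that] by (simp add: q_def)
  have main: "ennreal ((\<Prod>i<m. (exp (- \<kappa> i / (2 * T)) * q i * s i) powr c i) / sqrt (det A)) \<le> (\<integral>\<^sup>+x. ennreal (f x) \<partial>lborel_vec n)"
    if T: "0 < T" for T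
  proof -
    define N where "N = sqrt (2 * pi * T)"
    have N: "0 < N" using T by (simp add: N_def)
    have le: "(exp (- \<kappa> i / (2 * T)) * q i * s i) / N ^ d i \<le> heat_real n T (h i) (0\<^sub>v n)" if i: "i < m" for i
    proof -
      have H: "0 \<le> heat_real n T (h i) (0\<^sub>v n)" by (rule heat_real_bounds(1)[OF h[OF i] zero_carrier_vec])
      have "ennreal (exp (- \<kappa> i / (2 * T)) * q i) = ennreal (exp (- \<kappa> i / (2 * T))) * ennreal (q i)"
        by (rule ennreal_mult) (simp_all add: q)
      also have "\<dots> \<le> ennreal (N ^ d i / s i) * ennreal (heat_real n T (h i) (0\<^sub>v n))"
        using low[OF i T] unfolding Jq[OF i] N_def .
      also have "\<dots> = ennreal (N ^ d i / s i * heat_real n T (h i) (0\<^sub>v n))"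
        using H N s[OF i] by (intro ennreal_mult[symmetric]) simp_all
      finally have "ennreal (exp (- \<kappa> i / (2 * T)) * q i) \<le> ennreal (N ^ d i / s i * heat_real n T (h i) (0\<^sub>v n))" .
      then have "exp (- \<kappa> i / (2 * T)) * q i \<le> N ^ d i / s i * heat_real n T (h i) (0\<^sub>v n)"
        using H N s[OF i] by (subst (asm) ennreal_le_iff) auto
      then show ?thesis using N s[OF i] by (simp add: field_simps)
    qed
    have "(\<Prod>i<m. (exp (- \<kappa> i / (2 * T)) * q i * s i) powr c i) / N ^ n =
        (\<Prod>i<m. ((exp (- \<kappa> i / (2 * T)) * q i * s i) / N ^ d i) powr c i)"
      using q s N by (intro homogeneity[symmetric]) (auto simp: less_imp_le)
    also have "\<dots> \<le> (\<Prod>i<m. heat_real n T (h i) (0\<^sub>v n) powr c i)"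
      using le q s N c_pos by (intro prod_mono conjI powr_mono2) (auto simp: less_imp_le)
    finally have "ennreal ((\<Prod>i<m. (exp (- \<kappa> i / (2 * T)) * q i * s i) powr c i) / N ^ n) \<le> heat n T \<Phi> (0\<^sub>v n)"
      using \<Phi>(3)[OF T] by (meson ennreal_leI order_trans)
    then have "ennreal (N ^ n / sqrt (det A)) * ennreal ((\<Prod>i<m. (exp (- \<kappa> i / (2 * T)) * q i * s i) powr c i) / N ^ n) \<le>
        ennreal (N ^ n / sqrt (det A)) * heat n T \<Phi> (0\<^sub>v n)" by (rule mult_left_mono) simp
    also have "\<dots> \<le> (\<integral>\<^sup>+x. ennreal (f x) \<partial>lborel_vec n)"
      unfolding N_def by (rule test_upper_bound[OF \<Phi>(1,2) T])
    also have "ennreal (N ^ n / sqrt (det A)) * ennreal ((\<Prod>i<m. (exp (- \<kappa> i / (2 * T)) * q i * s i) powr c i) / N ^ n) =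
        ennreal ((\<Prod>i<m. (exp (- \<kappa> i / (2 * T)) * q i * s i) powr c i) / sqrt (det A))"
      using N det_A_pos by (subst ennreal_mult[symmetric]) (auto intro!: divide_nonneg_pos prod_nonneg)
    finally show ?thesis .
  qed
  define \<tau> where "\<tau> = (\<lambda>k. real (Suc k))"
  have \<tau>: "0 < \<tau> k" for k by (simp add: \<tau>_def)
  have \<kappa>0: "(\<lambda>k. - \<kappa> i / (2 * \<tau> k)) \<longlonglongrightarrow> 0" for i
    unfolding \<tau>_def
    by (rule real_tendsto_divide_at_top[OF tendsto_const])
      (intro filterlim_tendsto_pos_mult_at_top[OF tendsto_const] filterlim_compose[OF filterlim_real_sequentially filterlim_Suc], simp)
  have "(\<lambda>k. (\<Prod>i<m. (exp (- \<kappa> i / (2 * \<tau> k)) * q i * s i) powr c i) / sqrt (det A))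
      \<longlonglongrightarrow> (\<Prod>i<m. (exp 0 * q i * s i) powr c i) / sqrt (det A)"
  proof (intro tendsto_divide tendsto_prod tendsto_const)
    fix i assume "i \<in> {..<m}"
    then have i: "i < m" by simp
    show "(\<lambda>k. (exp (- \<kappa> i / (2 * \<tau> k)) * q i * s i) powr c i) \<longlonglongrightarrow> (exp 0 * q i * s i) powr c i"
      by (rule tendsto_powr', intro tendsto_mult tendsto_exp \<kappa>0 tendsto_const, rule tendsto_const)
        (use c_pos[OF i] q[of i] s[OF i] in \<open>auto simp: less_imp_le\<close>)
  qed (use det_A_pos in simp)
  then have "(\<lambda>k. ennreal ((\<Prod>i<m. (exp (- \<kappa> i / (2 * \<tau> k)) * q i * s i) powr c i) / sqrt (det A)))
      \<longlonglongrightarrow> ennreal ((\<Prod>i<m. (exp 0 * q i * s i) powr c i) / sqrt (det A))" by (rule tendsto_ennrealI)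
  then have lim: "ennreal ((\<Prod>i<m. (exp 0 * q i * s i) powr c i) / sqrt (det A)) \<le> (\<integral>\<^sup>+x. ennreal (f x) \<partial>lborel_vec n)"
    by (rule LIMSEQ_le_const2) (use main \<tau> in blast)
  have qs: "(\<Prod>i<m. (exp 0 * q i * s i) powr c i) = (\<Prod>i<m. q i powr c i) * sqrt (\<Prod>i<m. det (S i) powr c i)"
    unfolding sqrt_det_S_prod[symmetric] prod.distrib[symmetric]
    using q s by (intro prod.cong refl) (simp add: powr_mult less_imp_le s_def)
  have "(\<Prod>i<m. q i powr c i) = Cr * ((\<Prod>i<m. (exp 0 * q i * s i) powr c i) / sqrt (det A))"
  proof -
    have "Y = sqrt (a / D) * (Y * sqrt D / sqrt a)" if "0 < a" "0 < D" for Y a D :: real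
      using that by (simp add: real_sqrt_divide)
    from this[OF det_A_pos det_S_prod_pos] show ?thesis
      unfolding Cr_def qs .
  qed
  then have "ennreal (\<Prod>i<m. q i powr c i) = ennreal Cr * ennreal ((\<Prod>i<m. (exp 0 * q i * s i) powr c i) / sqrt (det A))"
    using Cr_pos det_A_pos by (simp only:) (intro ennreal_mult divide_nonneg_pos prod_nonneg; simp)
  also have "\<dots> \<le> ennreal Cr * (\<integral>\<^sup>+x. ennreal (f x) \<partial>lborel_vec n)" by (rule mult_left_mono[OF lim]) simp
  finally show "ennreal (\<Prod>i<m. enn2real (J i) powr c i) \<le> ennreal Cr * (\<integral>\<^sup>+x. ennreal (f x) \<partial>lborel_vec n)"
    by (simp add: q_def)
qed

end

section \<open>Arbitrary functions and Gaussian extremisers\<close>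

lemma tendsto_prod_ennreal_nonzero:
  fixes u :: "nat \<Rightarrow> 'i \<Rightarrow> ennreal"
  assumes "finite I" and "\<And>i. i \<in> I \<Longrightarrow> (\<lambda>k. u k i) \<longlonglongrightarrow> l i" and "\<And>i. i \<in> I \<Longrightarrow> l i \<noteq> 0"
  shows "(\<lambda>k. \<Prod>i\<in>I. u k i) \<longlonglongrightarrow> (\<Prod>i\<in>I. l i)"
  using assms
proof (induction I rule: finite_induct)
  case (insert i I)
  then have "(\<Prod>i\<in>I. l i) \<noteq> 0" "l i \<noteq> 0" by auto
  then have "(\<lambda>k. u k i * (\<Prod>i\<in>I. u k i)) \<longlonglongrightarrow> l i * (\<Prod>i\<in>I. l i)"
    using insert by (intro tendsto_mult_ennreal) auto
  then show ?case using insert by simp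
qed simp

text \<open>An exhaustion of a positive extended real from strictly below, whose powers converge as well.\<close>

lemma exhaust_powr:
  assumes "a \<noteq> 0" and c: "0 < c"
  obtains r :: "nat \<Rightarrow> real" where "\<And>k. 0 \<le> r k" "\<And>k. ennreal (r k) < a" "(\<lambda>k. ennreal (r k powr c)) \<longlonglongrightarrow> ennreal_powr a c"
proof (cases a)
  case top
  have "(real k powr (1 / c)) powr c = real k" for k using c by (simp add: powr_powr)
  moreover have "(\<lambda>k. ennreal (real k)) \<longlonglongrightarrow> \<infinity>"
    using filterlim_real_sequentially unfolding infinity_ennreal_def by (subst ennreal_tendsto_top_eq_at_top)
  ultimately show ?thesis
    using top that[of "\<lambda>k. real k powr (1 / c)"] by (simp add: ennreal_powr_def)
next
  case (real x)
  then have x: "0 < x" using assms by (auto simp: less_le)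
  define r where "r = (\<lambda>k. (1 - inverse (real (Suc k))) * x)"
  have le: "inverse (real (Suc k)) \<le> 1" for k by (simp add: field_simps)
  have r0: "0 \<le> r k" for k using le[of k] x by (simp add: r_def)
  have rx: "r k < x" for k using x by (simp add: r_def algebra_simps)
  have "r \<longlonglongrightarrow> (1 - 0) * x" unfolding r_def by (intro tendsto_intros LIMSEQ_inverse_real_of_nat)
  then have "(\<lambda>k. r k powr c) \<longlonglongrightarrow> x powr c" using x by (intro tendsto_powr) auto
  then have "(\<lambda>k. ennreal (r k powr c)) \<longlonglongrightarrow> ennreal (x powr c)" by (rule tendsto_ennrealI)
  then show ?thesis
    using that[of r] r0 rx real x by (simp add: ennreal_powr_def ennreal_less_iff)
qed

context gaussian_datum
begin

text \<open>If one of the integrals vanishes, so does the left-hand side.  Otherwise all factors have positive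
  limits in \<open>[0, \<infinity>]\<close>, where multiplication is continuous, and the inequality for test functions passes
  to the limit, infinite integrals included.\<close>

lemma rev_BL_inequality_Cr: "rev_BL_inequality n m d c B (ennreal Cr)"
  unfolding rev_BL_inequality_def
proof (intro allI impI)
  fix fs f
  assume fs: "\<forall>i<m. nonneg_measurable (d i) (fs i)" and f: "nonneg_measurable n f"
    and constr: "rev_BL_constraint n m d c B fs f"
  define I where "I = (\<lambda>i. \<integral>\<^sup>+x. ennreal (fs i x) \<partial>lebesgue_vec (d i))"
  define Jf where "Jf = (\<integral>\<^sup>+x. ennreal (f x) \<partial>lborel_vec n)"
  have lhs: "rev_BL_lhs m d c fs = (\<Prod>i<m. ennreal_powr (I i) (c i))" by (simp only: rev_BL_lhs_def I_def)
  have "rev_BL_lhs m d c fs \<le> ennreal Cr * Jf"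
  proof (cases "\<exists>i<m. I i = 0")
    case True
    then obtain i where i: "i < m" "I i = 0" by blast
    then have "ennreal_powr (I i) (c i) = 0" by (simp add: ennreal_powr_def)
    then have z: "(\<Prod>i<m. ennreal_powr (I i) (c i)) = 0" using i(1) by (intro prod_zero) auto
    show ?thesis unfolding lhs z by simp
  next
    case False
    have "\<exists>r. (\<forall>k. 0 \<le> r k) \<and> (\<forall>k. ennreal (r k) < I i) \<and> (\<lambda>k. ennreal (r k powr c i)) \<longlonglongrightarrow> ennreal_powr (I i) (c i)"
      if i: "i < m" for i
      using exhaust_powr[of "I i" "c i"] False c_pos[OF i] i by metis
    then obtain r where r: "\<And>i k. i < m \<Longrightarrow> 0 \<le> r i k" "\<And>i k. i < m \<Longrightarrow> ennreal (r i k) < I i"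
      "\<And>i. i < m \<Longrightarrow> (\<lambda>k. ennreal (r i k powr c i)) \<longlonglongrightarrow> ennreal_powr (I i) (c i)"
      by metis
    have bound: "(\<Prod>i<m. ennreal (r i k powr c i)) \<le> ennreal Cr * Jf" for k
    proof -
      have "\<exists>g. usc_test (d i) g \<and> (\<forall>x\<in>carrier_vec (d i). ennreal (g x) \<le> ennreal (fs i x)) \<and>
          ennreal (r i k) < (\<integral>\<^sup>+x. ennreal (g x) \<partial>lborel_vec (d i))" if i: "i < m" for i
      proof -
        have "(\<lambda>x. ennreal (fs i x)) \<in> borel_measurable (lebesgue_vec (d i))"
          using fs i unfolding nonneg_measurable_def by (intro measurable_compose[OF _ measurable_ennreal]) auto
        from usc_test_approximation[OF this r(2)[OF i, of k, unfolded I_def]] show ?thesis by metis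
      qed
      then obtain g where g: "\<And>i. i < m \<Longrightarrow> usc_test (d i) (g i)"
        "\<And>i x. i < m \<Longrightarrow> x \<in> carrier_vec (d i) \<Longrightarrow> ennreal (g i x) \<le> ennreal (fs i x)"
        "\<And>i. i < m \<Longrightarrow> ennreal (r i k) < (\<integral>\<^sup>+x. ennreal (g i x) \<partial>lborel_vec (d i))" by metis
      define J where "J = (\<lambda>i. \<integral>\<^sup>+x. ennreal (g i x) \<partial>lborel_vec (d i))"
      have gc: "(\<Prod>i<m. g i (x i) powr c i) \<le> f (finsum_vec TYPE(real) n (\<lambda>i. c i \<cdot>\<^sub>v ((B i)\<^sup>T *\<^sub>v x i)) {..<m})"
        if x: "\<And>i. i < m \<Longrightarrow> x i \<in> carrier_vec (d i)" for x
      proof -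
        have "(\<Prod>i<m. g i (x i) powr c i) \<le> (\<Prod>i<m. fs i (x i) powr c i)"
        proof (intro prod_mono conjI powr_mono2)
          fix i assume "i \<in> {..<m}"
          then have i: "i < m" by simp
          show "0 \<le> c i" using c_pos[OF i] by simp
          obtain M R where "\<And>x. x \<in> carrier_vec (d i) \<Longrightarrow> 0 \<le> g i x" using usc_testE[OF g(1)[OF i]] by metis
          then show "0 \<le> g i (x i)" using x[OF i] by blast
          have "0 \<le> fs i (x i)" using fs i x[OF i] by (simp add: nonneg_measurable_def)
          then show "g i (x i) \<le> fs i (x i)" using g(2)[OF i x[OF i]] by (simp add: ennreal_le_iff)
        qed simp
        also have "\<dots> \<le> f (finsum_vec TYPE(real) n (\<lambda>i. c i \<cdot>\<^sub>v ((B i)\<^sup>T *\<^sub>v x i)) {..<m})"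
          using constr x by (simp add: rev_BL_constraint_def)
        finally show ?thesis .
      qed
      have "ennreal (r i k powr c i) \<le> ennreal (enn2real (J i) powr c i)" if i: "i < m" for i
      proof -
        have "r i k \<le> enn2real (J i)"
          using enn2real_mono[OF less_imp_le[OF g(3)[OF i]]] test_inequality(1)[OF g(1) gc i] r(1)[OF i, of k]
          by (simp add: J_def)
        then show ?thesis using r(1)[OF i, of k] c_pos[OF i] by (intro ennreal_leI powr_mono2) auto
      qed
      then have "(\<Prod>i<m. ennreal (r i k powr c i)) \<le> (\<Prod>i<m. ennreal (enn2real (J i) powr c i))"
        by (intro prod_mono_ennreal) auto
      also have "\<dots> = ennreal (\<Prod>i<m. enn2real (J i) powr c i)" by (rule prod_ennreal) simp
      also have "\<dots> \<le> ennreal Cr * Jf" unfolding Jf_def J_def by (rule test_inequality(2)[OF g(1) gc])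
      finally show ?thesis .
    qed
    have "ennreal_powr (I i) (c i) \<noteq> 0" if i: "i < m" for i
    proof (cases "I i")
      case (real a)
      then show ?thesis using False i by (auto simp: ennreal_powr_def)
    qed (simp add: ennreal_powr_def)
    then have "(\<lambda>k. \<Prod>i<m. ennreal (r i k powr c i)) \<longlonglongrightarrow> (\<Prod>i<m. ennreal_powr (I i) (c i))"
      using r(3) by (intro tendsto_prod_ennreal_nonzero) auto
    then show ?thesis unfolding lhs by (rule LIMSEQ_le_const2) (use bound in blast)
  qed
  then show "rev_BL_lhs m d c fs \<le> ennreal Cr * (\<integral>\<^sup>+x. ennreal (f x) \<partial>lebesgue_vec n)"
    by (simp only: Jf_def lebesgue_vec_eq_completion nn_integral_completion)
qed

text \<open>In the coordinates \<open>K i *\<^sub>v x i\<close> the Gaussian constraint is the contraction property of the frame.\<close>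

lemma gaussian_constraint: "rev_BL_constraint n m d c B (\<lambda>i. gaussian (S i)) (gaussian A)"
  unfolding rev_BL_constraint_def
proof (intro allI impI)
  fix x :: "nat \<Rightarrow> real vec" assume "\<forall>i<m. x i \<in> carrier_vec (d i)"
  then have x: "x i \<in> carrier_vec (d i)" if "i < m" for i using that by blast
  define \<eta> where "\<eta> = (\<lambda>i. K i *\<^sub>v x i)"
  have \<eta>: "\<eta> i \<in> carrier_vec n" if "i < m" for i
    unfolding \<eta>_def using K_carrier[OF that] x[OF that] by (rule mult_mat_vec_carrier)
  have norm: "(S i *\<^sub>v x i) \<bullet> x i = \<eta> i \<bullet> \<eta> i" if i: "i < m" for i
  proof -
    have "S i *\<^sub>v x i = (K i)\<^sup>T *\<^sub>v \<eta> i"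
      unfolding KT_K[OF i, symmetric] \<eta>_def using K_carrier[OF i] x[OF i] by (intro assoc_mult_mat_vec) auto
    then have "(S i *\<^sub>v x i) \<bullet> x i = \<eta> i \<bullet> (K i *\<^sub>v x i)"
      using transpose_vec_mult_scalar[OF K_carrier[OF i] x[OF i] \<eta>[OF i]] by simp
    then show ?thesis by (simp add: \<eta>_def)
  qed
  define v where "v = combine \<eta>"
  have v: "v \<in> carrier_vec n" by (simp add: v_def)
  have sum: "finsum_vec TYPE(real) n (\<lambda>i. c i \<cdot>\<^sub>v ((B i)\<^sup>T *\<^sub>v x i)) {..<m} = P *\<^sub>v v"
  proof -
    have "finsum_vec TYPE(real) n (\<lambda>i. c i \<cdot>\<^sub>v ((B i)\<^sup>T *\<^sub>v x i)) {..<m} =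
        finsum_vec TYPE(real) n (\<lambda>i. c i \<cdot>\<^sub>v ((B i)\<^sup>T *\<^sub>v (Q i *\<^sub>v \<eta> i))) {..<m}"
    proof (rule finsum_vec_cong)
      fix i assume "i \<in> {..<m}"
      then have i: "i < m" by simp
      have "Q i *\<^sub>v \<eta> i = x i"
        unfolding \<eta>_def using assoc_mult_mat_vec[OF Q_carrier[OF i] K_carrier[OF i] x[OF i]] x[OF i] by (simp add: Q_K[OF i])
      then show "c i \<cdot>\<^sub>v ((B i)\<^sup>T *\<^sub>v x i) = c i \<cdot>\<^sub>v ((B i)\<^sup>T *\<^sub>v (Q i *\<^sub>v \<eta> i))" by simp
      show "c i \<cdot>\<^sub>v ((B i)\<^sup>T *\<^sub>v (Q i *\<^sub>v \<eta> i)) \<in> carrier_vec n"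
        using mult_mat_vec_carrier[OF BT[OF i] mult_mat_vec_carrier[OF Q_carrier[OF i] \<eta>[OF i]]] by simp
    qed simp
    also have "\<dots> = P *\<^sub>v v" unfolding v_def by (rule P_combine[symmetric]) (rule \<eta>)
    finally show ?thesis .
  qed
  have contraction: "v \<bullet> v \<le> (\<Sum>i<m. c i * (\<eta> i \<bullet> \<eta> i))" unfolding v_def by (rule combine_contraction) (rule \<eta>)
  have quad: "(A *\<^sub>v (P *\<^sub>v v)) \<bullet> (P *\<^sub>v v) = v \<bullet> v"
  proof -
    have APv: "A *\<^sub>v (P *\<^sub>v v) \<in> carrier_vec n" using A_carrier P v by (intro mult_mat_vec_carrier) auto
    have "P\<^sup>T *\<^sub>v (A *\<^sub>v (P *\<^sub>v v)) = (P\<^sup>T * A * P) *\<^sub>v v"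
      using P A_carrier v by (simp add: assoc_mult_mat_vec[of _ n n _ n])
    then have "P\<^sup>T *\<^sub>v (A *\<^sub>v (P *\<^sub>v v)) = v" using PAP v by simp
    then show ?thesis using transpose_vec_mult_scalar[OF P v APv] by simp
  qed
  have "(\<Prod>i<m. gaussian (S i) (x i) powr c i) = (\<Prod>i<m. exp (- (c i * (\<eta> i \<bullet> \<eta> i)) / 2))"
    by (intro prod.cong refl) (simp add: gaussian_def norm exp_powr_real mult.commute)
  also have "\<dots> = exp (\<Sum>i<m. - (c i * (\<eta> i \<bullet> \<eta> i)) / 2)" by (simp add: exp_sum)
  also have "(\<Sum>i<m. - (c i * (\<eta> i \<bullet> \<eta> i)) / 2) = - (\<Sum>i<m. c i * (\<eta> i \<bullet> \<eta> i)) / 2"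
    by (simp add: sum_negf sum_divide_distrib)
  also have "exp (- (\<Sum>i<m. c i * (\<eta> i \<bullet> \<eta> i)) / 2) \<le> gaussian A (P *\<^sub>v v)"
    using contraction by (simp add: gaussian_def quad)
  finally show "(\<Prod>i<m. gaussian (S i) (x i) powr c i)
      \<le> gaussian A (finsum_vec TYPE(real) n (\<lambda>i. c i \<cdot>\<^sub>v ((B i)\<^sup>T *\<^sub>v x i)) {..<m})"
    unfolding sum .
qed

end

lemma nn_integral_gaussian:
  assumes S: "sym_pos_def k S"
  shows "(\<integral>\<^sup>+x. ennreal (gaussian S x) \<partial>lebesgue_vec k) = ennreal (sqrt (2 * pi) ^ k / sqrt (det S))"
proof -
  obtain L where L: "L \<in> carrier_mat k k" "L\<^sup>T * S * L = 1\<^sub>m k" using sym_pos_def_factor[OF S] .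
  have "(\<integral>\<^sup>+x. ennreal (gaussian S x) \<partial>lebesgue_vec k) = (\<integral>\<^sup>+x. 1 * ennreal (gaussian S x) \<partial>lborel_vec k)"
    by (simp add: lebesgue_vec_eq_completion nn_integral_completion)
  also have "\<dots> = ennreal (sqrt (2 * pi) ^ k / sqrt (det S)) * (\<integral>\<^sup>+\<xi>. 1 \<partial>std_gauss k)"
    by (rule gauss_law_square[OF S L]) simp
  also have "(\<integral>\<^sup>+\<xi>. 1 \<partial>std_gauss k) = 1"
    using prob_space.emeasure_space_1[OF prob_space_std_gauss, of k] by simp
  finally show ?thesis by simp
qed

lemma nonneg_measurable_gaussian: "sym_pos_def k S \<Longrightarrow> nonneg_measurable k (gaussian S)"
  unfolding nonneg_measurable_def lebesgue_vec_eq_completion sym_pos_def_def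
  by (auto intro: measurable_completion measurable_gaussian) (simp add: gaussian_def)

context gaussian_datum
begin

lemma gaussian_equality:
  "rev_BL_lhs m d c (\<lambda>i. gaussian (S i)) = ennreal Cr * (\<integral>\<^sup>+x. ennreal (gaussian A x) \<partial>lebesgue_vec n)"
proof -
  define N where "N = sqrt (2 * pi)"
  define D where "D = (\<Prod>i<m. det (S i) powr c i)"
  have N: "0 < N" by (simp add: N_def)
  have D: "0 < D" unfolding D_def by (rule det_S_prod_pos)
  have s: "0 < sqrt (det (S i))" if "i < m" for i using X_facts(5)[OF that] by simp
  have "rev_BL_lhs m d c (\<lambda>i. gaussian (S i)) = (\<Prod>i<m. ennreal ((N ^ d i / sqrt (det (S i))) powr c i))"
    unfolding rev_BL_lhs_def
  proof (rule prod.cong[OF refl])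
    fix i assume "i \<in> {..<m}"
    then have i: "i < m" by simp
    have "0 \<le> N ^ d i / sqrt (det (S i))" using N s[OF i] by simp
    then show "ennreal_powr (\<integral>\<^sup>+x. ennreal (gaussian (S i) x) \<partial>lebesgue_vec (d i)) (c i) =
        ennreal ((N ^ d i / sqrt (det (S i))) powr c i)"
      unfolding nn_integral_gaussian[OF S_pos_def[OF i]] N_def[symmetric] by (simp add: ennreal_powr_def)
  qed
  also have "\<dots> = ennreal (\<Prod>i<m. (N ^ d i / sqrt (det (S i))) powr c i)" by (rule prod_ennreal) simp
  also have "(\<Prod>i<m. (N ^ d i / sqrt (det (S i))) powr c i) = (\<Prod>i<m. inverse ((sqrt (det (S i)) / N ^ d i) powr c i))"
    using N s by (intro prod.cong refl) (simp add: less_imp_le powr_divide)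
  also have "\<dots> = inverse ((\<Prod>i<m. sqrt (det (S i)) powr c i) / N ^ n)"
    using prod_inversef[of "\<lambda>i. (sqrt (det (S i)) / N ^ d i) powr c i" "{..<m}"]
      homogeneity[OF N, of "\<lambda>i. sqrt (det (S i))"] s by (simp only: o_def) (simp add: less_imp_le)
  also have "\<dots> = Cr * (N ^ n / sqrt (det A))"
    using D det_A_pos N unfolding sqrt_det_S_prod Cr_def D_def[symmetric] by (simp add: real_sqrt_divide)
  also have "ennreal (Cr * (N ^ n / sqrt (det A))) = ennreal Cr * (\<integral>\<^sup>+x. ennreal (gaussian A x) \<partial>lebesgue_vec n)"
    unfolding nn_integral_gaussian[OF A] N_def[symmetric] using Cr_pos N det_A_pos by (intro ennreal_mult) auto
  finally show ?thesis .
qed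

lemma is_rev_BL_constant_Cr: "is_rev_BL_constant n m d c B (ennreal Cr)"
  unfolding is_rev_BL_constant_def
proof (intro conjI allI impI)
  show "rev_BL_inequality n m d c B (ennreal Cr)" by (rule rev_BL_inequality_Cr)
  fix C' assume C': "rev_BL_inequality n m d c B C'"
  define I where "I = (\<integral>\<^sup>+x. ennreal (gaussian A x) \<partial>lebesgue_vec n)"
  have I: "0 < I" "I < \<infinity>" using det_A_pos by (auto simp: I_def nn_integral_gaussian[OF A])
  have nm: "\<forall>i<m. nonneg_measurable (d i) (gaussian (S i))"
    using nonneg_measurable_gaussian S_pos_def by blast
  have "rev_BL_lhs m d c (\<lambda>i. gaussian (S i)) \<le> C' * I"
    unfolding I_def
    by (rule C'[unfolded rev_BL_inequality_def, THEN spec, THEN spec, THEN mp, THEN mp, THEN mp,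
          OF nm nonneg_measurable_gaussian[OF A] gaussian_constraint])
  then have "ennreal Cr * I \<le> C' * I" by (simp only: gaussian_equality I_def)
  then have "I * ennreal Cr \<le> I * C'" by (simp only: mult.commute)
  then show "ennreal Cr \<le> C'" using I by (subst (asm) ennreal_mult_le_mult_iff) auto
qed

end

theorem theorem3:
  fixes n m :: nat and d :: "nat \<Rightarrow> nat" and c :: "nat \<Rightarrow> real"
    and B :: "nat \<Rightarrow> real mat" and A :: "real mat"
  assumes datum: "BL_datum n m d c B"
    and dims: "(\<Sum>i<m. c i * real (d i)) = real n"
    and A: "sym_pos_def n A"
    and A_inv: "mat_inv A =
      finsum_mat n n (\<lambda>i. c i \<cdot>\<^sub>m ((B i)\<^sup>T * mat_inv (B i * A * (B i)\<^sup>T) * B i)) {..<m}"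
  shows "let Cr = ennreal (sqrt (det A / (\<Prod>i<m. det (B i * A * (B i)\<^sup>T) powr c i)));
             fs = (\<lambda>i. gaussian (B i * A * (B i)\<^sup>T));
             f = gaussian A
         in is_rev_BL_constant n m d c B Cr \<and>
            rev_BL_constraint n m d c B fs f \<and>
            rev_BL_lhs m d c fs = Cr * (\<integral>\<^sup>+x. ennreal (f x) \<partial>lebesgue_vec n)"
proof -
  obtain P where "P \<in> carrier_mat n n" "P\<^sup>T * A * P = 1\<^sub>m n" using sym_pos_def_factor[OF A] .
  then interpret gaussian_datum n m d c B A P
    using datum dims A A_inv by unfold_locales
  show ?thesis
    using is_rev_BL_constant_Cr gaussian_constraint gaussian_equality unfolding Let_def Cr_def S_def by blast
qed

end
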